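(* Let $n>r>0$ and $m\ge0$ be integers, let $\Lambda(r,n,m)$ be the derived-discrete algebra described in the context, and let $\mathsf{M}$ be a silting subcategory of $\mathsf{D}^b(\Lambda(r,n,m))$. Then the CW complex of two-term $\mathsf{M}$-silting subcategories is contractible.
   Context: Let $\mathbf{k}$ be an algebraically closed field. Algebra $\Lambda(r,n,m)$: the quiver $Q(r,n,m)$ has $n+m$ vertices $-m,\dots,-1,0,1,\dots,n-1$, an oriented cycle $0\to 1\to\cdots\to n-1\to 0$ with arrows $\alpha_i\colon i\to i+1$ ($0\le i\le n-2$) and $\alpha_{n-1}\colon n-1\to 0$, and a tail $-m\to\cdots\to -1\to 0$. The ideal $I(r,n,m)$ is generated by the $r$ consecutive length-two paths along the cycle passing through the vertices $0,n-1,\dots,n-r+1$ (i.e. $\alpha_{n-1}$ followed by $\alpha_0$; $\alpha_{n-2}$ followed by $\alpha_{n-1}$; ...; $\alpha_{n-r}$ followed by $\alpha_{n-r+1}$). Put $\Lambda(r,n,m)=\mathbf{k}Q(r,n,m)/I(r,n,m)$ and let $\mathsf{D}=\mathsf{D}^b(\Lambda(r,n,m))$ be the bounded derived category of finite-dimensional modules, with suspension $\Sigma$. Subcategories are full, additive and closed under isomorphisms; silting subcategories are also closed under direct summands. $\mathsf{C}^\perp=\{D\mid\mathrm{Hom}(\mathsf{C},D)=0\}$; $\mathsf{C}_1*\mathsf{C}_2$ is the full subcategory of objects $D$ in triangles $C_1\to D\to C_2\to\Sigma C_1$ with $C_i\in\mathsf{C}_i$. $\mathsf{M}\subset\mathsf{D}$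 is silting if $\mathrm{Hom}(\mathsf{M},\Sigma^i\mathsf{M})=0$ for all $i>0$ and the smallest thick subcategory containing $\mathsf{M}$ is $\mathsf{D}$. Silting subcategories are partially ordered by $\mathsf{M}\le\mathsf{N}\iff\mathrm{Hom}(\mathsf{M},\Sigma^i\mathsf{N})=0$ for all $i>0$. A silting pair $(\mathsf{M},\mathsf{M}')$ is a silting subcategory $\mathsf{M}$ with a functorially finite (summand-closed) subcategory $\mathsf{M}'\subseteq\mathsf{M}$; the right mutation is the silting subcategory $\mathsf{R}_{\mathsf{M}'}(\mathsf{M})=(\Sigma^{-1}\mathsf{M}*\mathsf{M}')\cap(\Sigma^{-1}\mathsf{M}')^\perp$. Silting pairs are partially ordered by $(\mathsf{N},\mathsf{N}')\le(\mathsf{M},\mathsf{M}')\iff\mathsf{R}_{\mathsf{M}'}(\mathsf{M})\le\mathsf{R}_{\mathsf{N}'}(\mathsf{N})\le\mathsf{N}\le\mathsf{M}$, and $\mathbb{P}_2(\mathsf{D})$ is this poset with a bottom element $\hat0$ adjoined. $\mathbb{P}_2(\mathsf{D})$ is a CW poset, and $\mathsf{silt}_2(\mathsf{D})$ is the regular CW complex with face poset $\mathbb{P}_2(\mathsf{D})$ (closed cells correspond to silting pairs, ordered by inclusion). A two-term $\mathsf{M}$-silting subcategory is a silting subcategory $\mathsf{N}$ of $\mathsf{D}$ with $\mathsf{N}\subseteq\Sigma^{-1}\mathsf{M}*\mathsf{M}$ (equivalently $\Sigma^{-1}\mathsf{M}\le\mathsf{N}\le\mathsf{M}$). The CW complex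 of two-term $\mathsf{M}$-silting subcategories is the subcomplex of $\mathsf{silt}_2(\mathsf{D})$ formed by the cells of all silting pairs $(\mathsf{N},\mathsf{N}')$ for which $\mathsf{N}$ and $\mathsf{R}_{\mathsf{N}'}(\mathsf{N})$ are both two-term $\mathsf{M}$-silting, i.e. of all $(\mathsf{N},\mathsf{N}')\le(\mathsf{M},0)$. *)

theory Defs
  imports
    "HOL-Analysis.Abstract_Euclidean_Space"
    "HOL-Computational_Algebra.Polynomial"
    "Graph_Theory.Arc_Walk"
    "Jordan_Normal_Form.Matrix"
    "HOL-Algebra.QuotRing"
begin

section \<open>Algebras given by quivers with relations\<close>

text \<open>A \<open>'k\<close>-algebra is a ring together with its structure map from the ground field.\<close>

record ('a, 'k) kalgebra = "'a ring" +
  scal :: "'k \<Rightarrow> 'a"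

text \<open>A path \<open>(u, p, v)\<close> records its two end points and the list of its arrows in the order
  in which they are traversed; trivial paths have the empty list.\<close>

type_synonym ('v, 'e) qpath = "'v \<times> 'e list \<times> 'v"

definition qpaths :: "('v, 'e) pre_digraph \<Rightarrow> ('v, 'e) qpath set" where
  "qpaths Q = {(u, p, v). pre_digraph.awalk Q u p v}"

text \<open>All ways of writing a path as \<open>q \<circ> p\<close>, that is, as \<open>p\<close> followed by \<open>q\<close>.\<close>

definition qpath_splits ::
    "('v, 'e) pre_digraph \<Rightarrow> ('v, 'e) qpath \<Rightarrow> (('v, 'e) qpath \<times> ('v, 'e) qpath) set" where
  "qpath_splits Q x = {((v, q, w), (u, p, v)) | u p v q w.
     (v, q, w) \<in> qpaths Q \<and> (u, p, v) \<in> qpaths Q \<and> x = (u, p @ q, w)}"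

text \<open>Elements of the path algebra are the finitely supported functions on paths. Paths are
  multiplied like maps (the right factor is traversed first), so that left modules are the
  covariant representations of the quiver.\<close>

definition path_algebra ::
    "('v, 'e) pre_digraph \<Rightarrow> (('v, 'e) qpath \<Rightarrow> 'k::field, 'k) kalgebra" where
  "path_algebra Q = \<lparr>
     carrier = {f. finite {x. f x \<noteq> 0} \<and> {x. f x \<noteq> 0} \<subseteq> qpaths Q},
     mult = (\<lambda>f g x. \<Sum>(q, p) \<in> qpath_splits Q x. f q * g p),
     one = (\<lambda>x. if x \<in> {(v, [], v) | v. v \<in> verts Q} then 1 else 0),
     zero = (\<lambda>x. 0),
     add = (\<lambda>f g x. f x + g x),
     scal = (\<lambda>c x. if x \<in> {(v, [], v) | v. v \<in> verts Q} then c else 0)\<rparr>"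

text \<open>The algebra \<open>kQ/I\<close>, where \<open>I\<close> is the two-sided ideal generated by a set of paths.\<close>

definition quiver_algebra ::
    "('v, 'e) pre_digraph \<Rightarrow> ('v, 'e) qpath set \<Rightarrow> ((('v, 'e) qpath \<Rightarrow> 'k::field) set, 'k) kalgebra"
  where
  "quiver_algebra Q R = (let A = path_algebra Q;
       I = Idl\<^bsub>A\<^esub> {(\<lambda>x. if x = p then 1 else 0) | p. p \<in> R}
     in ring.extend (A Quot I) \<lparr>scal = (\<lambda>c. I +>\<^bsub>A\<^esub> scal A c)\<rparr>)"

text \<open>Every vertex of \<open>Q(r,n,m)\<close> is the tail of exactly one arrow, so arrows are named by their
  tails: \<open>i\<close> stands for \<open>\<alpha>\<^sub>i\<close> on the cycle, and for the arrow \<open>i \<rightarrow> i+1\<close> if \<open>i < 0\<close>.\<close>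

definition dd_quiver :: "nat \<Rightarrow> nat \<Rightarrow> (int, int) pre_digraph" where
  "dd_quiver n m = \<lparr>verts = {- int m ..< int n}, arcs = {- int m ..< int n},
     tail = (\<lambda>i. i), head = (\<lambda>i. if i = int n - 1 then 0 else i + 1)\<rparr>"

text \<open>The path of length two on the cycle with middle vertex \<open>i\<close>, for
  \<open>i = 0, n-1, \<dots>, n-r+1\<close>, i.e. \<open>i = (n - j) mod n\<close> with \<open>j < r\<close>.\<close>

definition dd_relations :: "nat \<Rightarrow> nat \<Rightarrow> (int, int) qpath set" where
  "dd_relations r n = {((i - 1) mod int n, [(i - 1) mod int n, i], (i + 1) mod int n) | i j.
     j < r \<and> i = (int n - int j) mod int n}"

definition dd_algebra ::
    "nat \<Rightarrow> nat \<Rightarrow> nat \<Rightarrow> (((int, int) qpath \<Rightarrow> 'k::field) set, 'k) kalgebra" where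
  "dd_algebra r n m = quiver_algebra (dd_quiver n m) (dd_relations r n)"


section \<open>Finite-dimensional modules and bounded complexes\<close>

text \<open>A finite-dimensional left module is carried by a coordinate space \<open>k\<^sup>d\<close>, with the algebra
  acting by matrices; every finite-dimensional module is isomorphic to one of this form.
  Values of \<open>act\<close> outside the carrier of the algebra are irrelevant.\<close>

record ('a, 'k) fdmod =
  mdim :: nat
  act :: "'a \<Rightarrow> 'k mat"

definition fd_module :: "('a, 'k::field) kalgebra \<Rightarrow> ('a, 'k) fdmod \<Rightarrow> bool" where
  "fd_module A V \<longleftrightarrow> act V \<in> ring_hom A (ring_mat TYPE('k) (mdim V) ()) \<and>
     (\<forall>c. act V (scal A c) = c \<cdot>\<^sub>m 1\<^sub>m (mdim V))"

definition mod_hom ::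
    "('a, 'k::field) kalgebra \<Rightarrow> ('a, 'k) fdmod \<Rightarrow> ('a, 'k) fdmod \<Rightarrow> 'k mat set" where
  "mod_hom A V W = {F \<in> carrier_mat (mdim W) (mdim V).
     \<forall>a \<in> carrier A. F * act V a = act W a * F}"

record ('a, 'k) cpx =
  ob :: "int \<Rightarrow> ('a, 'k) fdmod"
  df :: "int \<Rightarrow> 'k mat"

abbreviation cdim :: "('a, 'k) cpx \<Rightarrow> int \<Rightarrow> nat" where
  "cdim X i \<equiv> mdim (ob X i)"

definition bdd_complex :: "('a, 'k::field) kalgebra \<Rightarrow> ('a, 'k) cpx \<Rightarrow> bool" where
  "bdd_complex A X \<longleftrightarrow> (\<forall>i. fd_module A (ob X i)) \<and>
     (\<forall>i. df X i \<in> mod_hom A (ob X i) (ob X (i + 1))) \<and>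
     (\<forall>i. df X (i + 1) * df X i = 0\<^sub>m (cdim X (i + 2)) (cdim X i)) \<and>
     finite {i. cdim X i \<noteq> 0}"

type_synonym 'k cmap = "int \<Rightarrow> 'k mat"

definition chain_maps ::
    "('a, 'k::field) kalgebra \<Rightarrow> ('a, 'k) cpx \<Rightarrow> ('a, 'k) cpx \<Rightarrow> 'k cmap set" where
  "chain_maps A X Y = {f. \<forall>i. f i \<in> mod_hom A (ob X i) (ob Y i) \<and>
     f (i + 1) * df X i = df Y i * f i}"

definition cmap_comp :: "'k::field cmap \<Rightarrow> 'k cmap \<Rightarrow> 'k cmap" where
  "cmap_comp g f = (\<lambda>i. g i * f i)"

definition cmap_id :: "('a, 'k::field) cpx \<Rightarrow> 'k cmap" where
  "cmap_id X = (\<lambda>i. 1\<^sub>m (cdim X i))"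

definition homotopic_maps ::
    "('a, 'k::field) kalgebra \<Rightarrow> ('a, 'k) cpx \<Rightarrow> ('a, 'k) cpx \<Rightarrow> 'k cmap \<Rightarrow> 'k cmap \<Rightarrow> bool" where
  "homotopic_maps A X Y f g \<longleftrightarrow> (\<exists>h. \<forall>i. h i \<in> mod_hom A (ob X i) (ob Y (i - 1)) \<and>
     f i - g i = df Y (i - 1) * h i + h (i + 1) * df X i)"

definition cocycles :: "('a, 'k::field) cpx \<Rightarrow> int \<Rightarrow> 'k vec set" where
  "cocycles X i = {x \<in> carrier_vec (cdim X i). df X i *\<^sub>v x = 0\<^sub>v (cdim X (i + 1))}"

definition coboundaries :: "('a, 'k::field) cpx \<Rightarrow> int \<Rightarrow> 'k vec set" where
  "coboundaries X i = {df X (i - 1) *\<^sub>v x | x. x \<in> carrier_vec (cdim X (i - 1))}"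

text \<open>The two conjuncts say that \<open>H\<^sup>i(f)\<close> is injective and surjective.\<close>

definition quasi_iso :: "('a, 'k::field) cpx \<Rightarrow> ('a, 'k) cpx \<Rightarrow> 'k cmap \<Rightarrow> bool" where
  "quasi_iso X Y f \<longleftrightarrow> (\<forall>i.
     (\<forall>x \<in> cocycles X i. f i *\<^sub>v x \<in> coboundaries Y i \<longrightarrow> x \<in> coboundaries X i) \<and>
     (\<forall>y \<in> cocycles Y i. \<exists>x \<in> cocycles X i. y - f i *\<^sub>v x \<in> coboundaries Y i))"

definition cpx_shift :: "('a, 'k::field) cpx \<Rightarrow> ('a, 'k) cpx" where
  "cpx_shift X = \<lparr>ob = (\<lambda>i. ob X (i + 1)), df = (\<lambda>i. - df X (i + 1))\<rparr>"

definition cmap_shift :: "'k cmap \<Rightarrow> 'k cmap" where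
  "cmap_shift f = (\<lambda>i. f (i + 1))"

definition mod_sum :: "('a, 'k::field) fdmod \<Rightarrow> ('a, 'k) fdmod \<Rightarrow> ('a, 'k) fdmod" where
  "mod_sum V W = \<lparr>mdim = mdim V + mdim W, act = (\<lambda>a. four_block_mat
     (act V a) (0\<^sub>m (mdim V) (mdim W)) (0\<^sub>m (mdim W) (mdim V)) (act W a))\<rparr>"

definition cone :: "('a, 'k::field) cpx \<Rightarrow> ('a, 'k) cpx \<Rightarrow> 'k cmap \<Rightarrow> ('a, 'k) cpx" where
  "cone X Y f = \<lparr>ob = (\<lambda>i. mod_sum (ob X (i + 1)) (ob Y i)),
     df = (\<lambda>i. four_block_mat
       (- df X (i + 1)) (0\<^sub>m (cdim X (i + 2)) (cdim Y i)) (f (i + 1)) (df Y i))\<rparr>"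

definition cone_in :: "('a, 'k::field) cpx \<Rightarrow> ('a, 'k) cpx \<Rightarrow> 'k cmap" where
  "cone_in X Y = (\<lambda>i. four_block_mat
     (0\<^sub>m (cdim X (i + 1)) 0) (0\<^sub>m (cdim X (i + 1)) (cdim Y i))
     (0\<^sub>m (cdim Y i) 0) (1\<^sub>m (cdim Y i)))"

definition cone_out :: "('a, 'k::field) cpx \<Rightarrow> ('a, 'k) cpx \<Rightarrow> 'k cmap" where
  "cone_out X Y = (\<lambda>i. four_block_mat
     (1\<^sub>m (cdim X (i + 1))) (0\<^sub>m (cdim X (i + 1)) (cdim Y i))
     (0\<^sub>m 0 (cdim X (i + 1))) (0\<^sub>m 0 (cdim Y i)))"


section \<open>The bounded derived category\<close>

text \<open>The data of a triangulated category: objects, morphism sets, composition (\<open>comp g f\<close>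
  is \<open>f\<close> followed by \<open>g\<close>), identities, suspension on objects and on morphisms, and
  the distinguished triangles \<open>X \<rightarrow> Y \<rightarrow> Z \<rightarrow> \<Sigma>X\<close> as tuples \<open>(X, Y, Z, u, v, w)\<close>.\<close>

record ('o, 'm) tricat =
  objs :: "'o set"
  homs :: "'o \<Rightarrow> 'o \<Rightarrow> 'm set"
  cmp :: "'m \<Rightarrow> 'm \<Rightarrow> 'm"
  idt :: "'o \<Rightarrow> 'm"
  sus :: "'o \<Rightarrow> 'o"
  susm :: "'m \<Rightarrow> 'm"
  tris :: "('o \<times> 'o \<times> 'o \<times> 'm \<times> 'm \<times> 'm) set"

text \<open>A roof \<open>src \<leftarrow> apex \<rightarrow> tgt\<close> whose left leg is a quasi-isomorphism. Morphisms of
  the derived category are classes of roofs, taken in the homotopy category.\<close>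

record ('a, 'k) roof =
  src :: "('a, 'k) cpx"
  apex :: "('a, 'k) cpx"
  tgt :: "('a, 'k) cpx"
  bleg :: "'k cmap"
  fleg :: "'k cmap"

definition is_roof :: "('a, 'k::field) kalgebra \<Rightarrow> ('a, 'k) roof \<Rightarrow> bool" where
  "is_roof A \<rho> \<longleftrightarrow> bdd_complex A (src \<rho>) \<and> bdd_complex A (apex \<rho>) \<and> bdd_complex A (tgt \<rho>) \<and>
     bleg \<rho> \<in> chain_maps A (apex \<rho>) (src \<rho>) \<and> quasi_iso (apex \<rho>) (src \<rho>) (bleg \<rho>) \<and>
     fleg \<rho> \<in> chain_maps A (apex \<rho>) (tgt \<rho>)"

definition roof_equiv :: "('a, 'k::field) kalgebra \<Rightarrow> ('a, 'k) roof \<Rightarrow> ('a, 'k) roof \<Rightarrow> bool" where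
  "roof_equiv A \<rho> \<sigma> \<longleftrightarrow> src \<rho> = src \<sigma> \<and> tgt \<rho> = tgt \<sigma> \<and>
     (\<exists>W u v. bdd_complex A W \<and> u \<in> chain_maps A W (apex \<rho>) \<and> v \<in> chain_maps A W (apex \<sigma>) \<and>
        quasi_iso W (src \<rho>) (cmap_comp (bleg \<rho>) u) \<and>
        homotopic_maps A W (src \<rho>) (cmap_comp (bleg \<rho>) u) (cmap_comp (bleg \<sigma>) v) \<and>
        homotopic_maps A W (tgt \<rho>) (cmap_comp (fleg \<rho>) u) (cmap_comp (fleg \<sigma>) v))"

definition roof_class :: "('a, 'k::field) kalgebra \<Rightarrow> ('a, 'k) roof \<Rightarrow> ('a, 'k) roof set" where
  "roof_class A \<rho> = {\<sigma>. is_roof A \<sigma> \<and> roof_equiv A \<rho> \<sigma>}"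

text \<open>The image of a chain map in the derived category.\<close>

definition der_map ::
    "('a, 'k::field) kalgebra \<Rightarrow> ('a, 'k) cpx \<Rightarrow> ('a, 'k) cpx \<Rightarrow> 'k cmap \<Rightarrow> ('a, 'k) roof set" where
  "der_map A X Y f =
     roof_class A \<lparr>src = X, apex = X, tgt = Y, bleg = cmap_id X, fleg = f\<rparr>"

definition der_hom ::
    "('a, 'k::field) kalgebra \<Rightarrow> ('a, 'k) cpx \<Rightarrow> ('a, 'k) cpx \<Rightarrow> ('a, 'k) roof set set" where
  "der_hom A X Y = {roof_class A \<rho> | \<rho>. is_roof A \<rho> \<and> src \<rho> = X \<and> tgt \<rho> = Y}"

definition der_comp ::
    "('a, 'k::field) kalgebra \<Rightarrow> ('a, 'k) roof set \<Rightarrow> ('a, 'k) roof set \<Rightarrow> ('a, 'k) roof set" where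
  "der_comp A \<psi> \<phi> = {\<tau>. \<exists>\<rho> \<in> \<phi>. \<exists>\<sigma> \<in> \<psi>. \<exists>W p q. bdd_complex A W \<and>
     p \<in> chain_maps A W (apex \<rho>) \<and> quasi_iso W (apex \<rho>) p \<and> q \<in> chain_maps A W (apex \<sigma>) \<and>
     homotopic_maps A W (tgt \<rho>) (cmap_comp (fleg \<rho>) p) (cmap_comp (bleg \<sigma>) q) \<and>
     \<tau> \<in> roof_class A \<lparr>src = src \<rho>, apex = W, tgt = tgt \<sigma>,
           bleg = cmap_comp (bleg \<rho>) p, fleg = cmap_comp (fleg \<sigma>) q\<rparr>}"

definition roof_shift :: "('a, 'k::field) roof \<Rightarrow> ('a, 'k) roof" where
  "roof_shift \<rho> = \<lparr>src = cpx_shift (src \<rho>), apex = cpx_shift (apex \<rho>), tgt = cpx_shift (tgt \<rho>),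
     bleg = cmap_shift (bleg \<rho>), fleg = cmap_shift (fleg \<rho>)\<rparr>"

definition is_iso :: "('o, 'm) tricat \<Rightarrow> 'o \<Rightarrow> 'o \<Rightarrow> 'm \<Rightarrow> bool" where
  "is_iso D X Y f \<longleftrightarrow> f \<in> homs D X Y \<and>
     (\<exists>g \<in> homs D Y X. cmp D g f = idt D X \<and> cmp D f g = idt D Y)"

text \<open>\<open>D\<^sup>b(mod A)\<close>; the distinguished triangles are those isomorphic to the triangle of a mapping
  cone.\<close>

definition derived_cat_data ::
    "('a, 'k::field) kalgebra \<Rightarrow> (('a, 'k) cpx, ('a, 'k) roof set) tricat" where
  "derived_cat_data A = \<lparr>objs = {X. bdd_complex A X}, homs = der_hom A, cmp = der_comp A,
     idt = (\<lambda>X. der_map A X X (cmap_id X)), sus = cpx_shift, susm = (\<lambda>\<phi>. roof_shift ` \<phi>),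
     tris = {}\<rparr>"

definition derived_cat ::
    "('a, 'k::field) kalgebra \<Rightarrow> (('a, 'k) cpx, ('a, 'k) roof set) tricat" where
  "derived_cat A = (let D = derived_cat_data A in D\<lparr>tris := {(X, Y, Z, u, v, w).
     X \<in> objs D \<and> Y \<in> objs D \<and> Z \<in> objs D \<and>
     u \<in> homs D X Y \<and> v \<in> homs D Y Z \<and> w \<in> homs D Z (sus D X) \<and>
     (\<exists>X' Y' f a b c. X' \<in> objs D \<and> Y' \<in> objs D \<and> f \<in> chain_maps A X' Y' \<and>
        is_iso D X X' a \<and> is_iso D Y Y' b \<and> is_iso D Z (cone X' Y' f) c \<and>
        cmp D b u = cmp D (der_map A X' Y' f) a \<and>
        cmp D c v = cmp D (der_map A Y' (cone X' Y' f) (cone_in X' Y')) b \<and>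
        cmp D (susm D a) w =
          cmp D (der_map A (cone X' Y' f) (cpx_shift X') (cone_out X' Y')) c)}\<rparr>)"


section \<open>Silting subcategories and silting pairs\<close>

text \<open>Full subcategories are given by their sets of objects.\<close>

definition isomorphic :: "('o, 'm) tricat \<Rightarrow> 'o \<Rightarrow> 'o \<Rightarrow> bool" where
  "isomorphic D X Y \<longleftrightarrow> (\<exists>f. is_iso D X Y f)"

definition zero_object :: "('o, 'm) tricat \<Rightarrow> 'o \<Rightarrow> bool" where
  "zero_object D X \<longleftrightarrow> X \<in> objs D \<and>
     (\<forall>Y \<in> objs D. is_singleton (homs D X Y) \<and> is_singleton (homs D Y X))"

text \<open>\<open>S\<close> is a direct sum of \<open>X\<close> and \<open>Y\<close>. In an additive category, direct sums are the same
  as coproducts.\<close>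

definition direct_sum :: "('o, 'm) tricat \<Rightarrow> 'o \<Rightarrow> 'o \<Rightarrow> 'o \<Rightarrow> bool" where
  "direct_sum D X Y S \<longleftrightarrow> X \<in> objs D \<and> Y \<in> objs D \<and> S \<in> objs D \<and>
     (\<exists>i \<in> homs D X S. \<exists>j \<in> homs D Y S. \<forall>T \<in> objs D. \<forall>f \<in> homs D X T. \<forall>g \<in> homs D Y T.
        \<exists>!h. h \<in> homs D S T \<and> cmp D h i = f \<and> cmp D h j = g)"

text \<open>\<open>Hom(X, Y) = 0\<close>; morphism sets are abelian groups, hence zero iff they have exactly one
  element.\<close>

definition hom_zero :: "('o, 'm) tricat \<Rightarrow> 'o \<Rightarrow> 'o \<Rightarrow> bool" where
  "hom_zero D X Y \<longleftrightarrow> is_singleton (homs D X Y)"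

definition subcat :: "('o, 'm) tricat \<Rightarrow> 'o set \<Rightarrow> bool" where
  "subcat D C \<longleftrightarrow> C \<subseteq> objs D \<and>
     (\<forall>X \<in> C. \<forall>Y \<in> objs D. isomorphic D X Y \<longrightarrow> Y \<in> C) \<and>
     (\<forall>Z. zero_object D Z \<longrightarrow> Z \<in> C) \<and>
     (\<forall>X \<in> C. \<forall>Y \<in> C. \<forall>S. direct_sum D X Y S \<longrightarrow> S \<in> C)"

definition summand_closed :: "('o, 'm) tricat \<Rightarrow> 'o set \<Rightarrow> bool" where
  "summand_closed D C \<longleftrightarrow> (\<forall>X Y S. direct_sum D X Y S \<and> S \<in> C \<longrightarrow> X \<in> C \<and> Y \<in> C)"

definition thick :: "('o, 'm) tricat \<Rightarrow> 'o set \<Rightarrow> bool" where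
  "thick D C \<longleftrightarrow> subcat D C \<and> summand_closed D C \<and>
     (\<forall>X \<in> objs D. sus D X \<in> C \<longleftrightarrow> X \<in> C) \<and>
     (\<forall>X Y Z u v w. (X, Y, Z, u, v, w) \<in> tris D \<and> X \<in> C \<and> Y \<in> C \<longrightarrow> Z \<in> C)"

definition right_perp :: "('o, 'm) tricat \<Rightarrow> 'o set \<Rightarrow> 'o set" where
  "right_perp D C = {Y \<in> objs D. \<forall>X \<in> C. hom_zero D X Y}"

definition star :: "('o, 'm) tricat \<Rightarrow> 'o set \<Rightarrow> 'o set \<Rightarrow> 'o set" where
  "star D C1 C2 = {Y \<in> objs D. \<exists>X \<in> C1. \<exists>Z \<in> C2. \<exists>u v w. (X, Y, Z, u, v, w) \<in> tris D}"

text \<open>\<open>\<Sigma>\<inverse>C\<close>, for \<open>C\<close> closed under isomorphisms.\<close>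

definition desus :: "('o, 'm) tricat \<Rightarrow> 'o set \<Rightarrow> 'o set" where
  "desus D C = {X \<in> objs D. sus D X \<in> C}"

text \<open>\<open>M \<le> N\<close> iff \<open>Hom(M, \<Sigma>\<^sup>iN) = 0\<close> for all \<open>i > 0\<close>.\<close>

definition silt_le :: "('o, 'm) tricat \<Rightarrow> 'o set \<Rightarrow> 'o set \<Rightarrow> bool" where
  "silt_le D M N \<longleftrightarrow> (\<forall>X \<in> M. \<forall>Y \<in> N. \<forall>i > 0. hom_zero D X ((sus D ^^ i) Y))"

definition silting :: "('o, 'm) tricat \<Rightarrow> 'o set \<Rightarrow> bool" where
  "silting D M \<longleftrightarrow> subcat D M \<and> summand_closed D M \<and>
     (\<forall>X \<in> M. \<forall>Y \<in> M. \<forall>i > 0. hom_zero D X ((sus D ^^ i) Y)) \<and>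
     (thick D) hull M = objs D"

text \<open>Every object of \<open>M\<close> has a right and a left \<open>M'\<close>-approximation.\<close>

definition functorially_finite :: "('o, 'm) tricat \<Rightarrow> 'o set \<Rightarrow> 'o set \<Rightarrow> bool" where
  "functorially_finite D M M' \<longleftrightarrow> (\<forall>X \<in> M.
     (\<exists>P \<in> M'. \<exists>f \<in> homs D P X. \<forall>N \<in> M'. \<forall>g \<in> homs D N X. \<exists>h \<in> homs D N P. g = cmp D f h) \<and>
     (\<exists>P \<in> M'. \<exists>f \<in> homs D X P. \<forall>N \<in> M'. \<forall>g \<in> homs D X N. \<exists>h \<in> homs D P N. g = cmp D h f))"

definition silting_pairs :: "('o, 'm) tricat \<Rightarrow> ('o set \<times> 'o set) set" where
  "silting_pairs D = {(M, M'). silting D M \<and> M' \<subseteq> M \<and> subcat D M' \<and> summand_closed D M' \<and>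
     functorially_finite D M M'}"

definition right_mutation :: "('o, 'm) tricat \<Rightarrow> 'o set \<Rightarrow> 'o set \<Rightarrow> 'o set" where
  "right_mutation D M' M = star D (desus D M) M' \<inter> right_perp D (desus D M')"

definition pair_le ::
    "('o, 'm) tricat \<Rightarrow> ('o set \<times> 'o set) \<Rightarrow> ('o set \<times> 'o set) \<Rightarrow> bool" where
  "pair_le D = (\<lambda>(N, N') (M, M').
     silt_le D (right_mutation D M' M) (right_mutation D N' N) \<and>
     silt_le D (right_mutation D N' N) N \<and> silt_le D N M)"

text \<open>The poset \<open>P\<^sub>2(D)\<close>; \<open>None\<close> is the adjoined bottom element.\<close>

definition P2 :: "('o, 'm) tricat \<Rightarrow> ('o set \<times> 'o set) option set" where
  "P2 D = insert None (Some ` silting_pairs D)"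

fun P2_le :: "('o, 'm) tricat \<Rightarrow> ('o set \<times> 'o set) option \<Rightarrow> ('o set \<times> 'o set) option \<Rightarrow> bool" where
  "P2_le D None y = True"
| "P2_le D (Some p) None = False"
| "P2_le D (Some p) (Some q) = pair_le D p q"

definition two_term_silting :: "('o, 'm) tricat \<Rightarrow> 'o set \<Rightarrow> 'o set \<Rightarrow> bool" where
  "two_term_silting D M N \<longleftrightarrow> silting D N \<and> N \<subseteq> star D (desus D M) M"


section \<open>Regular CW complexes\<close>

definition disc :: "nat \<Rightarrow> (nat \<Rightarrow> real) topology" where
  "disc d = subtopology (Euclidean_space d) {x. (\<Sum>i<d. x i ^ 2) \<le> 1}"

definition open_disc :: "nat \<Rightarrow> (nat \<Rightarrow> real) set" where
  "open_disc d = {x \<in> topspace (Euclidean_space d). (\<Sum>i<d. x i ^ 2) < 1}"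

text \<open>\<open>e i\<close> (\<open>i \<in> I\<close>) are the open cells of a regular CW structure on \<open>X\<close>: they partition the
  Hausdorff space \<open>X\<close>, the characteristic maps are homeomorphisms onto the closed cells, the
  boundary of a cell meets only finitely many cells, all of lower dimension, and \<open>X\<close> has the
  weak topology.\<close>

definition regular_CW :: "'x topology \<Rightarrow> 'i set \<Rightarrow> ('i \<Rightarrow> 'x set) \<Rightarrow> bool" where
  "regular_CW X I e \<longleftrightarrow> Hausdorff_space X \<and> disjoint_family_on e I \<and> (\<Union>i\<in>I. e i) = topspace X \<and>
     (\<exists>dm :: 'i \<Rightarrow> nat. \<forall>i\<in>I.
        (\<exists>\<Phi>. homeomorphic_map (disc (dm i)) (subtopology X (X closure_of e i)) \<Phi> \<and>
             \<Phi> ` open_disc (dm i) = e i) \<and>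
        finite {j\<in>I. e j \<inter> (X closure_of e i) \<noteq> {}} \<and>
        (\<forall>j\<in>I. e j \<inter> (X closure_of e i - e i) \<noteq> {} \<longrightarrow> dm j < dm i)) \<and>
     (\<forall>C \<subseteq> topspace X. (\<forall>i\<in>I. closedin X (C \<inter> (X closure_of e i))) \<longrightarrow> closedin X C)"

text \<open>\<open>(X, e)\<close> is the regular CW complex \<open>silt\<^sub>2(D)\<close>: its cells are indexed by the silting pairs in
  such a way that \<open>P2 D\<close> becomes its face poset, the closed cells together with the empty face
  ordered by inclusion. This determines the complex up to cellular homeomorphism.\<close>

definition is_silt2 ::
    "('o, 'm) tricat \<Rightarrow> 'x topology \<Rightarrow> ('o set \<times> 'o set \<Rightarrow> 'x set) \<Rightarrow> bool" where
  "is_silt2 D X e \<longleftrightarrow> regular_CW X (silting_pairs D) e \<and>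
     (let face = (\<lambda>z. case z of None \<Rightarrow> {} | Some p \<Rightarrow> X closure_of e p)
      in \<forall>y \<in> P2 D. \<forall>z \<in> P2 D. P2_le D y z \<longleftrightarrow> face y \<subseteq> face z)"

definition two_term_complex ::
    "('o, 'm) tricat \<Rightarrow> 'x topology \<Rightarrow> ('o set \<times> 'o set \<Rightarrow> 'x set) \<Rightarrow> 'o set \<Rightarrow> 'x topology" where
  "two_term_complex D X e M = subtopology X (\<Union>(N, N') \<in> {(N, N') \<in> silting_pairs D.
     two_term_silting D M N \<and> two_term_silting D M (right_mutation D N' N)}. X closure_of e (N, N'))"

end

theory Submission
  imports Defs "HOL-Library.Function_Algebras"
begin

text \<open>The whole complex of two-term \<open>M\<close>-silting subcategories is one closed cell. Let \<open>zeros\<close> be the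
subcategory of zero objects. Then \<open>(M, zeros)\<close> is a silting pair whose right mutation is
\<open>\<Sigma>\<inverse>M\<close>, and \<open>\<Sigma>\<inverse>M\<close> and \<open>M\<close> are both two-term \<open>M\<close>-silting, so the cell of this pair belongs to
the complex. Conversely, let \<open>(N, N')\<close> be a silting pair with right mutation \<open>R\<close> such that \<open>N\<close>
and \<open>R\<close> lie in \<open>\<Sigma>\<inverse>M * M\<close>. Applying \<open>Hom(-, \<Sigma>\<^sup>iM)\<close> and \<open>Hom(\<Sigma>\<inverse>M, \<Sigma>\<^sup>i-)\<close> to the triangles that
place \<open>N\<close> and \<open>R\<close> there, and \<open>Hom(-, \<Sigma>\<^sup>iN)\<close> to those that place \<open>R\<close> in \<open>\<Sigma>\<inverse>N * N'\<close>, gives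
\<open>\<Sigma>\<inverse>M \<le> R \<le> N \<le> M\<close>, which says that \<open>(N, N') \<le> (M, zeros)\<close> (lemma \<open>two_term_pair_le\<close>). In the face
poset this means that the closed cell of \<open>(N, N')\<close> is contained in that of \<open>(M, zeros)\<close>. Hence the
complex equals the closed cell of \<open>(M, zeros)\<close> (\<open>two_term_complex_eq_cell\<close>), which is a disc and
contracts radially.

The argument uses a suspension that is an automorphism, the long exact \<open>Hom\<close>-sequences of
triangles in the form of a vanishing statement, and a few degenerate triangles; these
are the assumptions of the locales \<open>shifted_category\<close> and \<open>triangle_category\<close>. Most of the theory
verifies them for the category of roofs of bounded complexes over an algebra \<open>A\<close>. Quasi-isomorphisms
of complexes satisfy the Ore condition and cancellation up to homotopy (\<open>ore\<close>,
\<open>cancel_quasi_iso\<close>), so roofs form a category by the calculus of right fractions. A morphism space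
in the derived category vanishes iff every roof becomes null-homotopic after refining its apex
(\<open>hom_zero_derived_iff\<close>), and exactness then reduces to the weak kernel and weak cokernel
properties of mapping cones together with the invariance of cones under quasi-isomorphisms
(\<open>factor_through_cone_source\<close>, \<open>extend_over_cone\<close>, \<open>quasi_iso_cone_map\<close>).\<close>

section \<open>Matrices acting on zero-padded sequences\<close>

text \<open>Identities between block matrices and between vectors of varying dimensions carry many dimension
side conditions. Vectors are therefore padded by zeros to sequences, which form an abelian group
under pointwise addition, and a matrix acts on all sequences by ignoring the superfluous entries.
Equations of matrices become equations of additive maps and are solved by rewriting.\<close>

type_synonym 'k seqv = "nat \<Rightarrow> 'k"

text \<open>The sequence \<open>restr n x + pushr n y\<close> represents the concatenation of a vector of length \<open>n\<close> with
a second one; \<open>dropl n\<close> recovers the second block.\<close>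

definition restr :: "nat \<Rightarrow> 'k::zero seqv \<Rightarrow> 'k seqv" where
  "restr n x = (\<lambda>i. if i < n then x i else 0)"

definition pushr :: "nat \<Rightarrow> 'k::zero seqv \<Rightarrow> 'k seqv" where
  "pushr n x = (\<lambda>i. if i < n then 0 else x (i - n))"

definition dropl :: "nat \<Rightarrow> 'k seqv \<Rightarrow> 'k seqv" where
  "dropl n x = (\<lambda>i. x (i + n))"

definition mop :: "'k::semiring_0 mat \<Rightarrow> 'k seqv \<Rightarrow> 'k seqv" where
  "mop F x = (\<lambda>i. if i < dim_row F then \<Sum>j<dim_col F. F $$ (i, j) * x j else 0)"

lemma restr_additive [simp]:
  fixes x y :: "'k::ab_group_add seqv"
  shows "restr n (x + y) = restr n x + restr n y" "restr n (x - y) = restr n x - restr n y"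
    "restr n (- x) = - restr n x" "restr n (0 :: 'k seqv) = 0"
  by (auto simp: restr_def fun_eq_iff)

lemma pushr_additive [simp]:
  fixes x y :: "'k::ab_group_add seqv"
  shows "pushr n (x + y) = pushr n x + pushr n y" "pushr n (x - y) = pushr n x - pushr n y"
    "pushr n (- x) = - pushr n x" "pushr n (0 :: 'k seqv) = 0"
  by (auto simp: pushr_def fun_eq_iff)

lemma dropl_additive [simp]:
  fixes x y :: "'k::ab_group_add seqv"
  shows "dropl n (x + y) = dropl n x + dropl n y" "dropl n (x - y) = dropl n x - dropl n y"
    "dropl n (- x) = - dropl n x" "dropl n (0 :: 'k seqv) = 0"
  by (auto simp: dropl_def fun_eq_iff)

lemma mop_additive [simp]:
  fixes x y :: "'k::ring seqv"
  shows "mop F (x + y) = mop F x + mop F y" "mop F (x - y) = mop F x - mop F y"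
    "mop F (- x) = - mop F x" "mop F (0 :: 'k seqv) = 0"
  by (auto simp: mop_def fun_eq_iff algebra_simps sum.distrib sum_subtractf sum_negf)

lemma restr_pushr_dropl [simp]:
  fixes x :: "'k::ab_group_add seqv"
  shows "restr n (restr n x) = restr n x" "restr n (pushr n x) = 0" "dropl n (restr n x) = 0"
    "dropl n (pushr n x) = x"
    "restr (n + m) (restr n x) = restr n x" "restr (n + m) (pushr n x) = pushr n (restr m x)"
    "restr n (restr (n + m) x) = restr n x" "dropl n (restr (n + m) x) = restr m (dropl n x)"
    "restr 0 x = 0"
  by (auto simp: restr_def pushr_def dropl_def fun_eq_iff)

lemma restr_add:
  "restr (n + m) x = restr n x + pushr n (restr m (dropl n x :: 'k::ab_group_add seqv))"
  by (auto simp: restr_def pushr_def dropl_def fun_eq_iff)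

lemma restr_mop: "dim_row F = n \<Longrightarrow> restr n (mop F x) = mop F x"
  by (auto simp: mop_def restr_def fun_eq_iff)

lemma mop_restr: "dim_col F = n \<Longrightarrow> mop F (restr n x) = mop F x"
  by (auto simp: mop_def restr_def fun_eq_iff intro!: sum.cong)

lemma mop_mult: "dim_col F = dim_row G \<Longrightarrow> mop (F * G) x = mop F (mop G (x :: 'k::field seqv))"
proof -
  assume d: "dim_col F = dim_row G"
  have "(\<Sum>j<dim_col G. (\<Sum>l<dim_row G. F $$ (i, l) * G $$ (l, j)) * x j)
      = (\<Sum>l<dim_col F. F $$ (i, l) * (\<Sum>j<dim_col G. G $$ (l, j) * x j))" for i
    unfolding sum_distrib_left sum_distrib_right d by (subst sum.swap) (simp add: mult.assoc)
  then show ?thesis using d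
    by (auto simp: mop_def fun_eq_iff scalar_prod_def atLeast0LessThan)
qed

lemma mop_one [simp]: "mop (1\<^sub>m n) x = restr n (x :: 'k::field seqv)"
  by (auto simp: mop_def restr_def fun_eq_iff if_distrib[of "\<lambda>t. t * _"] cong: if_cong)

lemma mop_zero [simp]: "mop (0\<^sub>m n m) x = (0 :: 'k::field seqv)"
  by (auto simp: mop_def fun_eq_iff)

lemma mop_add: "dim_row F = dim_row G \<Longrightarrow> dim_col F = dim_col G \<Longrightarrow>
    mop (F + G) x = mop F x + mop G (x :: 'k::field seqv)"
  by (auto simp: mop_def fun_eq_iff algebra_simps sum.distrib)

lemma mop_minus: "dim_row F = dim_row G \<Longrightarrow> dim_col F = dim_col G \<Longrightarrow>
    mop (F - G) x = mop F x - mop G (x :: 'k::field seqv)"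
  by (auto simp: mop_def fun_eq_iff algebra_simps sum_subtractf)

lemma mop_uminus [simp]: "mop (- F) x = - mop F (x :: 'k::field seqv)"
  by (auto simp: mop_def fun_eq_iff sum_negf)

lemma mop_four_block:
  assumes "dim_row B = dim_row A" "dim_col B = dim_col D" "dim_row C = dim_row D"
    "dim_col C = dim_col A"
  shows "mop (four_block_mat A B C D) x =
    mop A x + mop B (dropl (dim_col A) x) +
    pushr (dim_row A) (mop C x + mop D (dropl (dim_col A) (x :: 'k::field seqv)))"
proof (rule ext)
  fix i
  have split: "(\<Sum>j<p + q. g j) = (\<Sum>j<p. g j) + (\<Sum>j<q. g (j + p))"
    for p q and g :: "nat \<Rightarrow> 'k"
    by (induction q) (simp_all add: add.assoc add.commute[of p])
  show "mop (four_block_mat A B C D) x i = (mop A x + mop B (dropl (dim_col A) x) +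
    pushr (dim_row A) (mop C x + mop D (dropl (dim_col A) x))) i"
    using assms by (auto simp: mop_def pushr_def dropl_def split)
qed

text \<open>The entries of a matrix are read off from its action on unit sequences.\<close>

lemma mat_eq_iff_mop:
  "F = G \<longleftrightarrow> dim_row F = dim_row G \<and> dim_col F = dim_col G \<and> (\<forall>x. mop F x = mop G (x :: 'k::field seqv))"
proof (intro iffI; (elim conjE)?)
  assume d: "dim_row F = dim_row G" "dim_col F = dim_col G" and e: "\<forall>x. mop F x = mop G x"
  show "F = G"
  proof (rule eq_matI)
    fix i j assume ij: "i < dim_row G" "j < dim_col G"
    have "mop F (\<lambda>l. if l = j then 1 else 0) i = mop G (\<lambda>l. if l = j then 1 else 0) i"
      using e by simp
    then show "F $$ (i, j) = G $$ (i, j)"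
      using ij d by (simp add: mop_def if_distrib[of "\<lambda>t. _ * t"] cong: if_cong)
  qed (use d in auto)
qed auto

section \<open>Modules and complexes\<close>

lemma dropl_0 [simp]: "dropl 0 x = x"
  by (simp add: dropl_def)

lemma dropl_mop: "dim_row F = n \<Longrightarrow> dropl n (mop F x) = (0 :: 'k::field seqv)"
  by (auto simp: mop_def dropl_def fun_eq_iff)

lemma mop_pushr: "dim_col F = n \<Longrightarrow> mop F (pushr n x) = (0 :: 'k::field seqv)"
  by (auto simp: mop_def pushr_def fun_eq_iff intro!: sum.neutral)

lemma fd_module_act_carrier:
  "fd_module A V \<Longrightarrow> a \<in> carrier A \<Longrightarrow> act V a \<in> carrier_mat (mdim V) (mdim V)"
  by (auto simp: fd_module_def ring_hom_def ring_mat_simps)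

lemma mod_hom_dims:
  "F \<in> mod_hom A V W \<Longrightarrow> dim_row F = mdim W \<and> dim_col F = mdim V"
  by (auto simp: mod_hom_def)

lemma mod_homI:
  fixes F :: "'k::field mat"
  assumes "fd_module A V" "fd_module A W" "dim_row F = mdim W" "dim_col F = mdim V"
    and "\<And>a x. a \<in> carrier A \<Longrightarrow> mop F (mop (act V a) x) = mop (act W a) (mop F x)"
  shows "F \<in> mod_hom A V W"
proof -
  have "F * act V a = act W a * F" if a: "a \<in> carrier A" for a
    using fd_module_act_carrier[OF assms(1) a] fd_module_act_carrier[OF assms(2) a] assms(3-) a
    by (auto simp: mat_eq_iff_mop mop_mult)
  then show ?thesis using assms by (auto simp: mod_hom_def)
qed

lemma mod_hom_mop:
  fixes F :: "'k::field mat"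
  assumes "F \<in> mod_hom A V W" "fd_module A V" "fd_module A W" "a \<in> carrier A"
  shows "mop F (mop (act V a) x) = mop (act W a) (mop F x)"
proof -
  have "F * act V a = act W a * F" using assms by (auto simp: mod_hom_def)
  then have "mop (F * act V a) x = mop (act W a * F) x" by simp
  then show ?thesis
    using fd_module_act_carrier[OF assms(2,4)] fd_module_act_carrier[OF assms(3,4)] assms(1)
    by (auto simp: mop_mult mod_hom_def)
qed

lemma mod_hom_times:
  fixes F G :: "'k::field mat"
  assumes "F \<in> mod_hom A V W" "G \<in> mod_hom A U V" "fd_module A U" "fd_module A V" "fd_module A W"
  shows "F * G \<in> mod_hom A U W"
  using assms by (intro mod_homI) (auto simp: mop_mult mod_hom_dims mod_hom_mop)

lemma mod_hom_add:
  fixes F G :: "'k::field mat"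
  assumes "F \<in> mod_hom A V W" "G \<in> mod_hom A V W" "fd_module A V" "fd_module A W"
  shows "F + G \<in> mod_hom A V W"
  using assms by (intro mod_homI) (auto simp: mop_add mod_hom_dims mod_hom_mop)

lemma mod_hom_uminus:
  fixes F G :: "'k::field mat"
  assumes "F \<in> mod_hom A V W" "fd_module A V" "fd_module A W"
  shows "- F \<in> mod_hom A V W"
  using assms by (intro mod_homI) (auto simp: mod_hom_dims mod_hom_mop)

lemma mod_hom_zero:
  assumes "fd_module A V" "fd_module A W"
  shows "0\<^sub>m (mdim W) (mdim V) \<in> mod_hom A V (W :: ('a, 'k::field) fdmod)"
  using assms by (intro mod_homI) auto

lemma mod_hom_one:
  assumes "fd_module A V"
  shows "1\<^sub>m (mdim V) \<in> mod_hom A V (V :: ('a, 'k::field) fdmod)"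
  using assms
  by (intro mod_homI) (auto simp: restr_mop mop_restr dest: fd_module_act_carrier)

lemma mdim_mod_sum [simp]: "mdim (mod_sum V W) = mdim V + mdim W"
  by (simp add: mod_sum_def)

lemma mop_act_mod_sum:
  assumes "fd_module A V" "fd_module A W" "a \<in> carrier A"
  shows "mop (act (mod_sum V W) a) x =
    mop (act V a) x + pushr (mdim V) (mop (act W a) (dropl (mdim V) (x :: 'k::field seqv)))"
  using fd_module_act_carrier[OF assms(1,3)] fd_module_act_carrier[OF assms(2,3)]
  by (auto simp: mod_sum_def mop_four_block)

lemma fd_module_mod_sum:
  assumes V: "fd_module A V" and W: "fd_module A (W :: ('a, 'k::field) fdmod)"
  shows "fd_module A (mod_sum V W)"
proof -
  have hV: "act V \<in> ring_hom A (ring_mat TYPE('k) (mdim V) ())"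
    and hW: "act W \<in> ring_hom A (ring_mat TYPE('k) (mdim W) ())"
    and sV: "\<And>c. act V (scal A c) = c \<cdot>\<^sub>m 1\<^sub>m (mdim V)"
    and sW: "\<And>c. act W (scal A c) = c \<cdot>\<^sub>m 1\<^sub>m (mdim W)"
    using V W by (auto simp: fd_module_def)
  have carr: "act V a \<in> carrier_mat (mdim V) (mdim V)" "act W a \<in> carrier_mat (mdim W) (mdim W)"
    if "a \<in> carrier A" for a
    using that V W by (auto intro: fd_module_act_carrier)
  have mV: "act V (a \<otimes>\<^bsub>A\<^esub> b) = act V a * act V b" "act V (a \<oplus>\<^bsub>A\<^esub> b) = act V a + act V b"
    and mW: "act W (a \<otimes>\<^bsub>A\<^esub> b) = act W a * act W b" "act W (a \<oplus>\<^bsub>A\<^esub> b) = act W a + act W b"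
    if "a \<in> carrier A" "b \<in> carrier A" for a b
    using that ring_hom_mult[OF hV] ring_hom_mult[OF hW] ring_hom_add[OF hV] ring_hom_add[OF hW]
    by (auto simp: ring_mat_simps)
  have oV: "act V \<one>\<^bsub>A\<^esub> = 1\<^sub>m (mdim V)" and oW: "act W \<one>\<^bsub>A\<^esub> = 1\<^sub>m (mdim W)"
    using ring_hom_one[OF hV] ring_hom_one[OF hW] by (auto simp: ring_mat_simps)
  have "act (mod_sum V W) \<in> ring_hom A (ring_mat TYPE('k) (mdim V + mdim W) ())"
  proof (rule ring_hom_memI)
    fix a assume a: "a \<in> carrier A"
    show "act (mod_sum V W) a \<in> carrier (ring_mat TYPE('k) (mdim V + mdim W) ())"
      using carr[OF a] by (auto simp: mod_sum_def ring_mat_simps intro!: four_block_carrier_mat)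
    fix b assume b: "b \<in> carrier A"
    show "act (mod_sum V W) (a \<otimes>\<^bsub>A\<^esub> b) =
      act (mod_sum V W) a \<otimes>\<^bsub>ring_mat TYPE('k) (mdim V + mdim W) ()\<^esub> act (mod_sum V W) b"
      using carr[OF a] carr[OF b] a b
      by (auto simp: mod_sum_def ring_mat_simps mV mW mat_eq_iff_mop mop_four_block mop_mult
          mop_pushr dropl_mop)
    show "act (mod_sum V W) (a \<oplus>\<^bsub>A\<^esub> b) =
      act (mod_sum V W) a \<oplus>\<^bsub>ring_mat TYPE('k) (mdim V + mdim W) ()\<^esub> act (mod_sum V W) b"
      using carr[OF a] carr[OF b] a b
      by (auto simp: mod_sum_def ring_mat_simps mV mW mat_eq_iff_mop mop_four_block mop_add)
  next
    show "act (mod_sum V W) \<one>\<^bsub>A\<^esub> = \<one>\<^bsub>ring_mat TYPE('k) (mdim V + mdim W) ()\<^esub>"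
      by (simp add: mod_sum_def ring_mat_simps oV oW)
  qed
  moreover have "act (mod_sum V W) (scal A c) = c \<cdot>\<^sub>m 1\<^sub>m (mdim V + mdim W)" for c
    unfolding mod_sum_def by (auto simp: sV sW intro!: eq_matI)
  ultimately show ?thesis by (simp add: fd_module_def)
qed

definition pr1 :: "('a, 'k::field) fdmod \<Rightarrow> ('a, 'k) fdmod \<Rightarrow> 'k mat" where
  "pr1 V W = four_block_mat (1\<^sub>m (mdim V)) (0\<^sub>m (mdim V) (mdim W)) (0\<^sub>m 0 (mdim V)) (0\<^sub>m 0 (mdim W))"

definition pr2 :: "('a, 'k::field) fdmod \<Rightarrow> ('a, 'k) fdmod \<Rightarrow> 'k mat" where
  "pr2 V W = four_block_mat (0\<^sub>m (mdim W) (mdim V)) (1\<^sub>m (mdim W)) (0\<^sub>m 0 (mdim V)) (0\<^sub>m 0 (mdim W))"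

definition in1 :: "('a, 'k::field) fdmod \<Rightarrow> ('a, 'k) fdmod \<Rightarrow> 'k mat" where
  "in1 V W = four_block_mat (1\<^sub>m (mdim V)) (0\<^sub>m (mdim V) 0) (0\<^sub>m (mdim W) (mdim V)) (0\<^sub>m (mdim W) 0)"

definition in2 :: "('a, 'k::field) fdmod \<Rightarrow> ('a, 'k) fdmod \<Rightarrow> 'k mat" where
  "in2 V W = four_block_mat (0\<^sub>m (mdim V) 0) (0\<^sub>m (mdim V) (mdim W)) (0\<^sub>m (mdim W) 0) (1\<^sub>m (mdim W))"

lemma mop_pr_in [simp]:
  "mop (pr1 V W) x = restr (mdim V) x"
  "mop (pr2 V W) x = restr (mdim W) (dropl (mdim V) x)"
  "mop (in1 V W) x = restr (mdim V) x"
  "mop (in2 V W) x = pushr (mdim V) (restr (mdim W) x)"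
  by (simp_all add: pr1_def pr2_def in1_def in2_def mop_four_block)

lemma dim_pr_in [simp]:
  "dim_row (pr1 V W) = mdim V" "dim_col (pr1 V W) = mdim V + mdim W"
  "dim_row (pr2 V W) = mdim W" "dim_col (pr2 V W) = mdim V + mdim W"
  "dim_row (in1 V W) = mdim V + mdim W" "dim_col (in1 V W) = mdim V"
  "dim_row (in2 V W) = mdim V + mdim W" "dim_col (in2 V W) = mdim W"
  by (simp_all add: pr1_def pr2_def in1_def in2_def)

lemma mod_hom_pr_in:
  assumes V: "fd_module A V" and W: "fd_module A (W :: ('a, 'k::field) fdmod)"
  shows "pr1 V W \<in> mod_hom A (mod_sum V W) V" "pr2 V W \<in> mod_hom A (mod_sum V W) W"
    "in1 V W \<in> mod_hom A V (mod_sum V W)" "in2 V W \<in> mod_hom A W (mod_sum V W)"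
proof -
  have d: "dim_row (act V a) = mdim V" "dim_row (act W a) = mdim W"
     "dim_col (act V a) = mdim V" "dim_col (act W a) = mdim W" if "a \<in> carrier A" for a
    using that V W by (auto dest: fd_module_act_carrier)
  show "pr1 V W \<in> mod_hom A (mod_sum V W) V" "pr2 V W \<in> mod_hom A (mod_sum V W) W"
    "in1 V W \<in> mod_hom A V (mod_sum V W)" "in2 V W \<in> mod_hom A W (mod_sum V W)"
    using V W by (auto intro!: mod_homI fd_module_mod_sum simp: mop_act_mod_sum d restr_mop mop_restr
      mop_pushr dropl_mop)
qed

lemmas mod_hom_intros = mod_hom_add mod_hom_uminus mod_hom_zero mod_hom_one mod_hom_pr_in
  fd_module_mod_sum

text \<open>Chain maps bundled with the boundedness of source and target, so that one membership fact supplies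
all dimensions.\<close>

definition cpx_hom ::
    "('a, 'k::field) kalgebra \<Rightarrow> ('a, 'k) cpx \<Rightarrow> ('a, 'k) cpx \<Rightarrow> 'k cmap set" where
  "cpx_hom A X Y = {f \<in> chain_maps A X Y. bdd_complex A X \<and> bdd_complex A Y}"

lemma bdd_complex_fd: "bdd_complex A X \<Longrightarrow> fd_module A (ob X i)"
  by (simp add: bdd_complex_def)

lemma bdd_complex_df: "bdd_complex A X \<Longrightarrow> df X i \<in> mod_hom A (ob X i) (ob X (i + 1))"
  by (simp add: bdd_complex_def)

lemma bdd_complex_dims:
  assumes "bdd_complex A X"
  shows "dim_row (df X i) = cdim X (i + 1)" "dim_col (df X i) = cdim X i"
  using mod_hom_dims[OF bdd_complex_df[OF assms]] by auto

lemma mop_df_df: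
  assumes "bdd_complex A X"
  shows "mop (df X (i + 1)) (mop (df X i) x) = 0"
    "mop (df X i) (mop (df X (i - 1)) x) = 0"
    "mop (df X (i + 2)) (mop (df X (i + 1)) x) = 0"
proof -
  show *: "mop (df X (i + 1)) (mop (df X i) x) = 0" for i
    using assms mop_mult[of "df X (i + 1)" "df X i" x]
    by (simp add: bdd_complex_dims) (simp add: bdd_complex_def)
  show "mop (df X i) (mop (df X (i - 1)) x) = 0"
    using *[of "i - 1"] by simp
  show "mop (df X (i + 2)) (mop (df X (i + 1)) x) = 0"
    using *[of "i + 1"] by (simp add: add.assoc)
qed

lemma bdd_complexI:
  assumes "\<And>i. fd_module A (ob X i)" "\<And>i. df X i \<in> mod_hom A (ob X i) (ob X (i + 1))"
    and "\<And>i x. mop (df X (i + 1)) (mop (df X i) x) = 0" "finite {i. cdim X i \<noteq> 0}"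
  shows "bdd_complex A X"
proof -
  have d: "dim_row (df X i) = cdim X (i + 1)" "dim_col (df X i) = cdim X i" for i
    using mod_hom_dims[OF assms(2)] by auto
  have "df X (i + 1) * df X i = 0\<^sub>m (cdim X (i + 2)) (cdim X i)" for i
    by (simp add: mat_eq_iff_mop d mop_mult assms(3) add.assoc)
  then show ?thesis using assms by (simp add: bdd_complex_def)
qed

lemma cpx_homD:
  assumes "f \<in> cpx_hom A X Y"
  shows "bdd_complex A X" "bdd_complex A Y" "f \<in> chain_maps A X Y"
    "f i \<in> mod_hom A (ob X i) (ob Y i)" "dim_row (f i) = cdim Y i" "dim_col (f i) = cdim X i"
    "mop (f (i + 1)) (mop (df X i) x) = mop (df Y i) (mop (f i) x)"
    "mop (f i) (mop (df X (i - 1)) x) = mop (df Y (i - 1)) (mop (f (i - 1)) x)"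
    "mop (f (i + 2)) (mop (df X (i + 1)) x) = mop (df Y (i + 1)) (mop (f (i + 1)) x)"
proof -
  show X: "bdd_complex A X" and Y: "bdd_complex A Y" and "f \<in> chain_maps A X Y"
    and *: "\<And>i. f i \<in> mod_hom A (ob X i) (ob Y i)"
    using assms by (auto simp: cpx_hom_def chain_maps_def)
  show d: "dim_row (f i) = cdim Y i" "dim_col (f i) = cdim X i" for i
    using mod_hom_dims[OF *] by auto
  have e: "f (i + 1) * df X i = df Y i * f i" for i
    using assms by (auto simp: cpx_hom_def chain_maps_def)
  show **: "mop (f (i + 1)) (mop (df X i) x) = mop (df Y i) (mop (f i) x)" for i
    using arg_cong[OF e[of i], of "\<lambda>F. mop F x"] by (simp add: mop_mult bdd_complex_dims[OF X]
        bdd_complex_dims[OF Y] d)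
  show "mop (f i) (mop (df X (i - 1)) x) = mop (df Y (i - 1)) (mop (f (i - 1)) x)"
    using **[of "i - 1"] by simp
  show "mop (f (i + 2)) (mop (df X (i + 1)) x) = mop (df Y (i + 1)) (mop (f (i + 1)) x)"
    using **[of "i + 1"] by (simp add: add.assoc)
qed

lemma cpx_homI:
  assumes "bdd_complex A X" "bdd_complex A Y" "\<And>i. f i \<in> mod_hom A (ob X i) (ob Y i)"
    "\<And>i x. mop (f (i + 1)) (mop (df X i) x) = mop (df Y i) (mop (f i) x)"
  shows "f \<in> cpx_hom A X Y"
  using assms mod_hom_dims[OF assms(3)]
  by (auto simp: cpx_hom_def chain_maps_def mat_eq_iff_mop mop_mult bdd_complex_dims)

text \<open>The map \<open>dh + hd\<close> in degree \<open>i\<close>.\<close>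

abbreviation htpy_bd ::
    "('a, 'k::field) cpx \<Rightarrow> ('a, 'k) cpx \<Rightarrow> 'k cmap \<Rightarrow> int \<Rightarrow> 'k seqv \<Rightarrow> 'k seqv" where
  "htpy_bd X Y h i x \<equiv> mop (df Y (i - 1)) (mop (h i) x) + mop (h (i + 1)) (mop (df X i) x)"

lemma homotopic_maps_iff:
  assumes "f \<in> cpx_hom A X Y" "g \<in> cpx_hom A X Y"
  shows "homotopic_maps A X Y f g \<longleftrightarrow> (\<exists>h. \<forall>i. h i \<in> mod_hom A (ob X i) (ob Y (i - 1)) \<and>
    (\<forall>x. mop (f i) x = mop (g i) x + htpy_bd X Y h i x))"
proof -
  note [simp] = cpx_homD[OF assms(1)] cpx_homD[OF assms(2)]
  have "f i - g i = df Y (i - 1) * h i + h (i + 1) * df X i \<longleftrightarrow>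
      (\<forall>x. mop (f i) x = mop (g i) x + htpy_bd X Y h i x)"
    if "\<forall>i. h i \<in> mod_hom A (ob X i) (ob Y (i - 1))" for h i
  proof -
    have [simp]: "dim_row (h i) = cdim Y (i - 1)" "dim_col (h i) = cdim X i" for i
      using mod_hom_dims that by blast+
    show ?thesis
      using bdd_complex_dims[of A X] bdd_complex_dims[of A Y]
      by (simp add: mat_eq_iff_mop mop_minus mop_add mop_mult bdd_complex_dims algebra_simps)
  qed
  then show ?thesis
    unfolding homotopic_maps_def by (intro ex_cong1) blast
qed

lemma mod_hom_four_block:
  fixes V :: "('a, 'k::field) fdmod"
  assumes "fd_module A V" "fd_module A W" "fd_module A V'" "fd_module A W'"
    and "F \<in> mod_hom A V V'" "G \<in> mod_hom A W V'" "H \<in> mod_hom A V W'" "K \<in> mod_hom A W W'"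
  shows "four_block_mat F G H K \<in> mod_hom A (mod_sum V W) (mod_sum V' W')"
proof -
  note d = mod_hom_dims[OF assms(5)] mod_hom_dims[OF assms(6)] mod_hom_dims[OF assms(7)]
    mod_hom_dims[OF assms(8)]
  have c: "dim_row (act U a) = mdim U" "dim_col (act U a) = mdim U"
    if "fd_module A U" "a \<in> carrier A" for U :: "('a, 'k) fdmod" and a
    using fd_module_act_carrier[OF that] by auto
  show ?thesis
    using assms d
    by (intro mod_homI fd_module_mod_sum)
       (auto simp: mop_four_block mop_act_mod_sum c mod_hom_mop mop_pushr dropl_mop)
qed

section \<open>Homotopies\<close>

lemma homotopicI:
  assumes "f \<in> cpx_hom A X Y" "g \<in> cpx_hom A X Y"
    and "\<And>i. h i \<in> mod_hom A (ob X i) (ob Y (i - 1))"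
    and "\<And>i x. mop (f i) x = mop (g i) x + htpy_bd X Y h i x"
  shows "homotopic_maps A X Y f g"
  unfolding homotopic_maps_iff[OF assms(1,2)] using assms(3,4) by blast

lemma homotopicE:
  assumes "homotopic_maps A X Y f g" "f \<in> cpx_hom A X Y" "g \<in> cpx_hom A X Y"
  obtains h where "\<And>i. h i \<in> mod_hom A (ob X i) (ob Y (i - 1))"
    "\<And>i. dim_row (h i) = cdim Y (i - 1)" "\<And>i. dim_col (h i) = cdim X i"
    "\<And>i x. mop (f i) x = mop (g i) x + htpy_bd X Y h i x"
  using assms mod_hom_dims by (subst (asm) homotopic_maps_iff) force+

lemma homotopic_refl: 
  assumes "f \<in> cpx_hom A X Y" shows "homotopic_maps A X Y f f"
  using cpx_homD[OF assms]
  by (intro homotopicI[OF assms assms, where h = "\<lambda>i. 0\<^sub>m (cdim Y (i - 1)) (cdim X i)"])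
     (auto intro!: mod_hom_intros dest: bdd_complex_fd)

lemma homotopic_sym:
  assumes "homotopic_maps A X Y f g" "f \<in> cpx_hom A X Y" "g \<in> cpx_hom A X Y"
  shows "homotopic_maps A X Y g f"
proof -
  obtain h where h: "\<And>i. h i \<in> mod_hom A (ob X i) (ob Y (i - 1))"
    "\<And>i x. mop (f i) x = mop (g i) x + htpy_bd X Y h i x"
    using homotopicE[OF assms] by metis
  show ?thesis
    using h cpx_homD[OF assms(2)]
    by (intro homotopicI[OF assms(3,2), where h = "\<lambda>i. - h i"])
       (auto intro!: mod_hom_intros dest: bdd_complex_fd simp: algebra_simps)
qed

lemma homotopic_trans:
  assumes "homotopic_maps A X Y f g" "homotopic_maps A X Y g k"
    "f \<in> cpx_hom A X Y" "g \<in> cpx_hom A X Y" "k \<in> cpx_hom A X Y"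
  shows "homotopic_maps A X Y f k"
proof -
  obtain h where h: "\<And>i. h i \<in> mod_hom A (ob X i) (ob Y (i - 1))"
    "\<And>i. dim_row (h i) = cdim Y (i - 1)" "\<And>i. dim_col (h i) = cdim X i"
    "\<And>i x. mop (f i) x = mop (g i) x + htpy_bd X Y h i x"
    using homotopicE[OF assms(1,3,4)] by metis
  obtain l where l: "\<And>i. l i \<in> mod_hom A (ob X i) (ob Y (i - 1))"
    "\<And>i. dim_row (l i) = cdim Y (i - 1)" "\<And>i. dim_col (l i) = cdim X i"
    "\<And>i x. mop (g i) x = mop (k i) x + htpy_bd X Y l i x"
    using homotopicE[OF assms(2,4,5)] by metis
  show ?thesis
    using h l cpx_homD[OF assms(3)]
    by (intro homotopicI[OF assms(3,5), where h = "\<lambda>i. h i + l i"])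
       (auto intro!: mod_hom_intros dest: bdd_complex_fd simp: algebra_simps mop_add)
qed

lemma cmap_comp_in_cpx_hom:
  assumes "f \<in> cpx_hom A X Y" "g \<in> cpx_hom A Y Z"
  shows "cmap_comp g f \<in> cpx_hom A X Z"
  using cpx_homD[OF assms(1)] cpx_homD[OF assms(2)]
  by (intro cpx_homI) (auto simp: cmap_comp_def mop_mult bdd_complex_fd
      intro: mod_hom_times[OF cpx_homD(4)[OF assms(2)] cpx_homD(4)[OF assms(1)]])

lemma mop_cmap_comp:
  assumes "f \<in> cpx_hom A X Y" "g \<in> cpx_hom A Y Z"
  shows "mop (cmap_comp g f i) x = mop (g i) (mop (f i) x)"
  using cpx_homD[OF assms(1)] cpx_homD[OF assms(2)] by (simp add: cmap_comp_def mop_mult)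

lemma cmap_id_in_cpx_hom: "bdd_complex A X \<Longrightarrow> cmap_id X \<in> cpx_hom A X X"
  by (intro cpx_homI) (auto simp: cmap_id_def mop_restr restr_mop bdd_complex_dims
      intro: mod_hom_one dest: bdd_complex_fd)

lemma cmap_comp_assoc:
  assumes "f \<in> cpx_hom A X Y" "g \<in> cpx_hom A Y Z" "h \<in> cpx_hom A Z W"
  shows "cmap_comp h (cmap_comp g f) = cmap_comp (cmap_comp h g) f"
  using cpx_homD[OF assms(1)] cpx_homD[OF assms(2)] cpx_homD[OF assms(3)]
  by (auto simp: cmap_comp_def fun_eq_iff mat_eq_iff_mop mop_mult)

lemma cmap_comp_id [simp]:
  assumes "f \<in> cpx_hom A X Y"
  shows "cmap_comp f (cmap_id X) = f" "cmap_comp (cmap_id Y) f = f"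
  using cpx_homD[OF assms(1)]
  by (auto simp: cmap_comp_def cmap_id_def fun_eq_iff mat_eq_iff_mop mop_mult mop_restr restr_mop)

lemma homotopic_comp_left:
  assumes "homotopic_maps A X Y f f'" "f \<in> cpx_hom A X Y" "f' \<in> cpx_hom A X Y" "g \<in> cpx_hom A Y Z"
  shows "homotopic_maps A X Z (cmap_comp g f) (cmap_comp g f')"
proof -
  obtain h where h: "\<And>i. h i \<in> mod_hom A (ob X i) (ob Y (i - 1))"
    "\<And>i. dim_row (h i) = cdim Y (i - 1)" "\<And>i. dim_col (h i) = cdim X i"
    "\<And>i x. mop (f i) x = mop (f' i) x + htpy_bd X Y h i x"
    using homotopicE[OF assms(1-3)] by metis
  note g = cpx_homD[OF assms(4)]
  have X: "bdd_complex A X" using cpx_homD[OF assms(2)] by simp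
  show ?thesis
    using X g(1,2) h
    by (intro homotopicI[where h = "\<lambda>i. g (i - 1) * h i"] cmap_comp_in_cpx_hom[OF _ assms(4)] assms)
       (auto intro!: mod_hom_times[OF g(4)] 
        simp: mop_mult g mop_cmap_comp[OF _ assms(4)] mop_cmap_comp[OF assms(2,4)]
         mop_cmap_comp[OF assms(3,4)] bdd_complex_fd)
qed

lemma homotopic_comp_right:
  assumes "homotopic_maps A Y Z g g'" "g \<in> cpx_hom A Y Z" "g' \<in> cpx_hom A Y Z" "f \<in> cpx_hom A X Y"
  shows "homotopic_maps A X Z (cmap_comp g f) (cmap_comp g' f)"
proof -
  obtain h where h: "\<And>i. h i \<in> mod_hom A (ob Y i) (ob Z (i - 1))"
    "\<And>i. dim_row (h i) = cdim Z (i - 1)" "\<And>i. dim_col (h i) = cdim Y i"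
    "\<And>i x. mop (g i) x = mop (g' i) x + htpy_bd Y Z h i x"
    using homotopicE[OF assms(1-3)] by metis
  note f = cpx_homD[OF assms(4)]
  have Z: "bdd_complex A Z" using cpx_homD[OF assms(2)] by simp
  show ?thesis
    using Z f(1,2) h
    by (intro homotopicI[where h = "\<lambda>i. h i * f i"] cmap_comp_in_cpx_hom[OF assms(4)] assms)
       (auto intro!: mod_hom_times[OF _ f(4)] 
        simp: mop_mult f mop_cmap_comp[OF assms(4,2)]
         mop_cmap_comp[OF assms(4,3)] bdd_complex_fd)
qed

section \<open>Cohomology and quasi-isomorphisms\<close>

text \<open>The passage from vectors to sequences under which the given notions of cocycle and coboundary turn
into \<open>cocyc\<close> and \<open>cobnd\<close>.\<close>

definition pad :: "'k::zero vec \<Rightarrow> 'k seqv" where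
  "pad v = (\<lambda>i. if i < dim_vec v then v $ i else 0)"

lemma pad_vec: "pad (vec n x) = restr n x"
  by (auto simp: pad_def restr_def fun_eq_iff)

lemma vec_eq_iff_pad: "v = w \<longleftrightarrow> dim_vec v = dim_vec w \<and> pad v = pad w"
  by (auto simp: pad_def fun_eq_iff intro!: eq_vecI split: if_splits)

lemma restr_pad: "dim_vec v = n \<Longrightarrow> restr n (pad v) = pad v"
  by (auto simp: pad_def restr_def fun_eq_iff)

lemma pad_mult_mat_vec: "dim_col F = dim_vec v \<Longrightarrow> pad (F *\<^sub>v v) = mop F (pad v :: 'k::field seqv)"
  by (auto simp: pad_def mop_def fun_eq_iff scalar_prod_def atLeast0LessThan)

lemma pad_zero [simp]: "pad (0\<^sub>v n) = (0 :: 'k::field seqv)"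
  by (auto simp: pad_def fun_eq_iff)

lemma pad_minus: "dim_vec v = dim_vec w \<Longrightarrow> pad (v - w) = pad v - (pad w :: 'k::field seqv)"
  by (auto simp: pad_def fun_eq_iff)

definition cocyc :: "('a, 'k::field) cpx \<Rightarrow> int \<Rightarrow> 'k seqv set" where
  "cocyc X i = {x. restr (cdim X i) x = x \<and> mop (df X i) x = 0}"

definition cobnd :: "('a, 'k::field) cpx \<Rightarrow> int \<Rightarrow> 'k seqv set" where
  "cobnd X i = range (mop (df X (i - 1)))"

lemma pad_in_cocyc:
  assumes "bdd_complex A X" "v \<in> carrier_vec (cdim X i)"
  shows "pad v \<in> cocyc X i \<longleftrightarrow> v \<in> cocycles X i"
  using assms by (auto simp: cocyc_def cocycles_def restr_pad vec_eq_iff_pad pad_mult_mat_vec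
      bdd_complex_dims)

lemma pad_in_cobnd:
  assumes "bdd_complex A X" "v \<in> carrier_vec (cdim X i)"
  shows "pad v \<in> cobnd X i \<longleftrightarrow> v \<in> coboundaries X i"
proof
  assume "pad v \<in> cobnd X i"
  then obtain x where x: "pad v = mop (df X (i - 1)) x" by (auto simp: cobnd_def)
  then have "v = df X (i - 1) *\<^sub>v vec (cdim X (i - 1)) x"
    using assms by (auto simp: vec_eq_iff_pad pad_mult_mat_vec bdd_complex_dims pad_vec mop_restr)
  then show "v \<in> coboundaries X i"
    unfolding coboundaries_def by auto
next
  assume "v \<in> coboundaries X i"
  then show "pad v \<in> cobnd X i"
    using assms by (auto simp: coboundaries_def cobnd_def pad_mult_mat_vec bdd_complex_dims)
qed

lemma cocyc_pad:
  assumes "x \<in> cocyc X i"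
  obtains v where "v \<in> carrier_vec (cdim X i)" "x = pad v"
  using assms that[of "vec (cdim X i) x"] by (auto simp: cocyc_def pad_vec)

lemma quasi_iso_iff:
  assumes f: "f \<in> cpx_hom A X Y"
  shows "quasi_iso X Y f \<longleftrightarrow> (\<forall>i.
     (\<forall>x \<in> cocyc X i. mop (f i) x \<in> cobnd Y i \<longrightarrow> x \<in> cobnd X i) \<and>
     (\<forall>y \<in> cocyc Y i. \<exists>x \<in> cocyc X i. y - mop (f i) x \<in> cobnd Y i))"
proof -
  note f = cpx_homD[OF f]
  note X = f(1) and Y = f(2)
  have carr: "cocycles X i \<subseteq> carrier_vec (cdim X i)" "cocycles Y i \<subseteq> carrier_vec (cdim Y i)" for i
    by (auto simp: cocycles_def)
  have fc: "f i *\<^sub>v v \<in> carrier_vec (cdim Y i)" "pad (f i *\<^sub>v v) = mop (f i) (pad v)"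
    if "v \<in> carrier_vec (cdim X i)" for v i
    using that f by (auto intro!: carrier_vecI pad_mult_mat_vec)
  have 1: "(\<forall>x \<in> cocycles X i. f i *\<^sub>v x \<in> coboundaries Y i \<longrightarrow> x \<in> coboundaries X i) \<longleftrightarrow>
     (\<forall>x \<in> cocyc X i. mop (f i) x \<in> cobnd Y i \<longrightarrow> x \<in> cobnd X i)" (is "?L \<longleftrightarrow> ?R") for i
  proof
    assume L: ?L
    show ?R
    proof (intro ballI impI)
      fix x assume x: "x \<in> cocyc X i" "mop (f i) x \<in> cobnd Y i"
      from x(1) obtain v where v: "v \<in> carrier_vec (cdim X i)" "x = pad v" by (rule cocyc_pad)
      then show "x \<in> cobnd X i"
        using x L fc[OF v(1)] pad_in_cocyc[OF X v(1)] pad_in_cobnd[OF X v(1)]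
          pad_in_cobnd[OF Y fc(1)[OF v(1)]] by metis
    qed
  next
    assume R: ?R
    show ?L
    proof (intro ballI impI)
      fix v assume v': "v \<in> cocycles X i" "f i *\<^sub>v v \<in> coboundaries Y i"
      then have v: "v \<in> carrier_vec (cdim X i)" using carr by auto
      then show "v \<in> coboundaries X i"
        using v' R fc[OF v] pad_in_cocyc[OF X v] pad_in_cobnd[OF X v]
          pad_in_cobnd[OF Y fc(1)[OF v]] by metis
    qed
  qed
  have minus: "y - f i *\<^sub>v v \<in> coboundaries Y i \<longleftrightarrow> pad y - mop (f i) (pad v) \<in> cobnd Y i"
    if "v \<in> carrier_vec (cdim X i)" "y \<in> carrier_vec (cdim Y i)" for v y i
    using pad_in_cobnd[OF Y, of "y - f i *\<^sub>v v" i] fc[OF that(1)] that f(5)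
    by (simp add: pad_minus carrier_vecD)
  have 2: "(\<forall>y \<in> cocycles Y i. \<exists>x \<in> cocycles X i. y - f i *\<^sub>v x \<in> coboundaries Y i) \<longleftrightarrow>
     (\<forall>y \<in> cocyc Y i. \<exists>x \<in> cocyc X i. y - mop (f i) x \<in> cobnd Y i)" (is "?L \<longleftrightarrow> ?R") for i
  proof
    assume L: ?L
    show ?R
    proof
      fix y assume y: "y \<in> cocyc Y i"
      then obtain v where v: "v \<in> carrier_vec (cdim Y i)" "y = pad v" by (rule cocyc_pad)
      then have "v \<in> cocycles Y i" using y pad_in_cocyc[OF Y v(1)] by simp
      then obtain x where x: "x \<in> cocycles X i" "v - f i *\<^sub>v x \<in> coboundaries Y i" using L by blast
      then show "\<exists>x \<in> cocyc X i. y - mop (f i) x \<in> cobnd Y i"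
        using v carr minus[of x i v] pad_in_cocyc[OF X, of x i] by auto
    qed
  next
    assume R: ?R
    show ?L
    proof
      fix y assume y: "y \<in> cocycles Y i"
      then have yc: "y \<in> carrier_vec (cdim Y i)" using carr by auto
      then obtain x where x: "x \<in> cocyc X i" "pad y - mop (f i) x \<in> cobnd Y i"
        using R y pad_in_cocyc[OF Y yc] by auto
      then obtain v where v: "v \<in> carrier_vec (cdim X i)" "x = pad v" by (metis cocyc_pad)
      then show "\<exists>x \<in> cocycles X i. y - f i *\<^sub>v x \<in> coboundaries Y i"
        using x yc minus[of v i y] pad_in_cocyc[OF X v(1)] by auto
    qed
  qed
  show ?thesis unfolding quasi_iso_def using 1 2 by simp
qed

section \<open>Mapping cones\<close>

lemma ob_cone [simp]: "ob (cone X Y f) i = mod_sum (ob X (i + 1)) (ob Y i)"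
  by (simp add: cone_def)

lemma mop_df_cone:
  assumes f: "f \<in> cpx_hom A X Y"
  shows "mop (df (cone X Y f) i) x = - mop (df X (i + 1)) x +
    pushr (cdim X (i + 2)) (mop (f (i + 1)) x + mop (df Y i) (dropl (cdim X (i + 1)) x))"
  using cpx_homD[OF f] bdd_complex_dims[of A X] bdd_complex_dims[of A Y]
  by (simp add: cone_def mop_four_block add.assoc)

lemma bdd_complex_cone:
  assumes f: "f \<in> cpx_hom A X Y"
  shows "bdd_complex A (cone X Y f)"
proof (rule bdd_complexI)
  note [simp] = cpx_homD[OF f] bdd_complex_fd[of A X] bdd_complex_fd[of A Y]
  have 2: "i + 1 + 1 = i + 2" for i :: int by simp
  show "fd_module A (ob (cone X Y f) i)" for i
    by (simp add: fd_module_mod_sum)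
  show "df (cone X Y f) i \<in> mod_hom A (ob (cone X Y f) i) (ob (cone X Y f) (i + 1))" for i
    using bdd_complex_df[OF cpx_homD(1)[OF f], of "i + 1"] bdd_complex_df[OF cpx_homD(2)[OF f], of i]
      cpx_homD(4)[OF f, of "i + 1"] mod_hom_zero[of A "ob Y i" "ob X (i + 2)"]
    unfolding ob_cone 2 by (simp add: cone_def mod_hom_four_block mod_hom_uminus)
  show "mop (df (cone X Y f) (i + 1)) (mop (df (cone X Y f) i) x) = 0" for i x
    unfolding mop_df_cone[OF f] 2
    by (simp add: mop_df_df[of A X] mop_df_df[of A Y] mop_pushr dropl_mop bdd_complex_dims[of A X] add.assoc)
  have "{i. cdim (cone X Y f) i \<noteq> 0} \<subseteq> (\<lambda>i. i - 1) ` {i. cdim X i \<noteq> 0} \<union> {i. cdim Y i \<noteq> 0}"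
  proof
    fix i assume "i \<in> {i. cdim (cone X Y f) i \<noteq> 0}"
    then show "i \<in> (\<lambda>i. i - 1) ` {i. cdim X i \<noteq> 0} \<union> {i. cdim Y i \<noteq> 0}"
      by (cases "cdim Y i = 0") (auto intro!: image_eqI[of _ _ "i + 1"])
  qed
  then show "finite {i. cdim (cone X Y f) i \<noteq> 0}"
    using cpx_homD(1,2)[OF f] finite_subset by (fastforce simp: bdd_complex_def)
qed

lemma cone_in_in2: "cone_in X Y i = in2 (ob X (i + 1)) (ob Y i)"
  by (simp add: cone_in_def in2_def)

lemma cone_out_pr1: "cone_out X Y i = pr1 (ob X (i + 1)) (ob Y i)"
  by (simp add: cone_out_def pr1_def)

lemma ob_shift [simp]: "ob (cpx_shift X) i = ob X (i + 1)"
  and df_shift [simp]: "df (cpx_shift X) i = - df X (i + 1)"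
  by (simp_all add: cpx_shift_def)

lemma bdd_complex_shift_imp:
  assumes "bdd_complex A X"
  shows "bdd_complex A (cpx_shift X)"
proof (rule bdd_complexI)
  have 2: "i + 1 + 1 = i + 2" for i :: int by simp
  show "fd_module A (ob (cpx_shift X) i)" for i using assms by (simp add: bdd_complex_fd)
  show "df (cpx_shift X) i \<in> mod_hom A (ob (cpx_shift X) i) (ob (cpx_shift X) (i + 1))" for i
    using assms bdd_complex_df[OF assms, of "i + 1"] by (simp add: mod_hom_uminus bdd_complex_fd)
  show "mop (df (cpx_shift X) (i + 1)) (mop (df (cpx_shift X) i) x) = 0" for i x
    using mop_df_df(3)[OF assms, of i x] by (simp add: 2)
  have "{i. cdim (cpx_shift X) i \<noteq> 0} = (\<lambda>i. i - 1) ` {i. cdim X i \<noteq> 0}"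
    by (force intro: image_eqI[of _ _ "_ + 1"])
  then show "finite {i. cdim (cpx_shift X) i \<noteq> 0}"
    using assms by (simp add: bdd_complex_def)
qed

lemma cone_in_hom:
  assumes f: "f \<in> cpx_hom A X Y"
  shows "cone_in X Y \<in> cpx_hom A Y (cone X Y f)"
proof (rule cpx_homI)
  note [simp] = cpx_homD[OF f] bdd_complex_fd[of A X] bdd_complex_fd[of A Y]
  have 2: "i + 1 + 1 = i + 2" for i :: int by simp
  show "cone_in X Y i \<in> mod_hom A (ob Y i) (ob (cone X Y f) i)" for i
    by (simp add: cone_in_in2 mod_hom_pr_in)
  show "mop (cone_in X Y (i + 1)) (mop (df Y i) x) = mop (df (cone X Y f) i) (mop (cone_in X Y i) x)"
    for i x
    by (simp add: cone_in_in2 mop_df_cone[OF f] mop_pushr bdd_complex_dims[of A X] 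
       bdd_complex_dims[of A Y] restr_mop mop_restr 2)
qed (use bdd_complex_cone[OF f] cpx_homD[OF f] in auto)

lemma cone_out_hom:
  assumes f: "f \<in> cpx_hom A X Y"
  shows "cone_out X Y \<in> cpx_hom A (cone X Y f) (cpx_shift X)"
proof (rule cpx_homI)
  note [simp] = cpx_homD[OF f] bdd_complex_fd[of A X] bdd_complex_fd[of A Y]
  have 2: "i + 1 + 1 = i + 2" for i :: int by simp
  show "cone_out X Y i \<in> mod_hom A (ob (cone X Y f) i) (ob (cpx_shift X) i)" for i
    by (simp add: cone_out_pr1 mod_hom_pr_in)
  show "mop (cone_out X Y (i + 1)) (mop (df (cone X Y f) i) x) =
      mop (df (cpx_shift X) i) (mop (cone_out X Y i) x)" for i x
    by (simp add: cone_out_pr1 mop_df_cone[OF f] bdd_complex_dims[of A X] restr_mop mop_restr 2)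
qed (use bdd_complex_cone[OF f] cpx_homD[OF f] bdd_complex_shift_imp in auto)

definition zero_map :: "('a, 'k::field) cpx \<Rightarrow> ('a, 'k) cpx \<Rightarrow> 'k cmap" where
  "zero_map X Y = (\<lambda>i. 0\<^sub>m (cdim Y i) (cdim X i))"

lemma mop_zero_map [simp]: "mop (zero_map X Y i) x = 0"
  by (simp add: zero_map_def)

lemma zero_map_hom: "bdd_complex A X \<Longrightarrow> bdd_complex A Y \<Longrightarrow> zero_map X Y \<in> cpx_hom A X Y"
  by (intro cpx_homI) (auto simp: zero_map_def bdd_complex_fd intro!: mod_hom_zero)

lemma zero_map_comp:
  assumes "f \<in> cpx_hom A X Y" "bdd_complex A W"
  shows "cmap_comp (zero_map Y W) f = zero_map X W" "cmap_comp f (zero_map W X) = zero_map W Y"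
  using cpx_homD[OF assms(1)]
  by (auto simp: cmap_comp_def zero_map_def fun_eq_iff mat_eq_iff_mop mop_mult)

lemma cmap_eqI:
  assumes "f \<in> cpx_hom A X Y" "g \<in> cpx_hom A X Y" "\<And>i x. mop (f i) x = mop (g i) x"
  shows "f = g"
  using cpx_homD[OF assms(1)] cpx_homD[OF assms(2)] assms(3) by (auto simp: fun_eq_iff mat_eq_iff_mop)

text \<open>The source of \<open>s\<close> is a weak kernel of \<open>Z \<rightarrow> cone s\<close> in the homotopy category: a null-homotopy of
\<open>W \<rightarrow> Z \<rightarrow> cone s\<close> has components \<open>W\<^sup>i \<rightarrow> Y\<^sup>i\<close> and \<open>W\<^sup>i \<rightarrow> Z\<^sup>i\<^sup>-\<^sup>1\<close>. The first is a chain map \<open>a\<close>, the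
second a homotopy from \<open>w\<close> to \<open>s \<circ> a\<close>.\<close>

lemma factor_through_cone_source:
  assumes s: "s \<in> cpx_hom A Y Z" and w: "w \<in> cpx_hom A W Z"
    and null: "homotopic_maps A W (cone Y Z s) (cmap_comp (cone_in Y Z) w) (zero_map W (cone Y Z s))"
  obtains a where "a \<in> cpx_hom A W Y" "homotopic_maps A W Z w (cmap_comp s a)"
proof -
  let ?C = "cone Y Z s"
  note [simp] = cpx_homD[OF s] cpx_homD[OF w] bdd_complex_fd[of A Y] bdd_complex_fd[of A Z] 
    bdd_complex_fd[of A W] bdd_complex_dims[of A Y] bdd_complex_dims[of A Z] bdd_complex_dims[of A W]
  have C: "bdd_complex A ?C" by (rule bdd_complex_cone[OF s])
  obtain h where h: "\<And>i. h i \<in> mod_hom A (ob W i) (ob ?C (i - 1))"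
    "\<And>i. dim_row (h i) = cdim ?C (i - 1)" "\<And>i. dim_col (h i) = cdim W i"
    "\<And>i x. mop (cmap_comp (cone_in Y Z) w i) x = mop (zero_map W ?C i) x +
      htpy_bd W ?C h i x"
    using homotopicE[OF null cmap_comp_in_cpx_hom[OF w cone_in_hom[OF s]] zero_map_hom[OF _ C]] by auto
  have [simp]: "dim_row (h i) = cdim Y i + cdim Z (i - 1)" "dim_col (h i) = cdim W i" for i
    using h(2,3)[of i] by simp_all
  \<comment> \<open>The \<open>Y\<close>- and \<open>Z\<close>-components of this equation are the chain map property of \<open>a\<close> and the homotopy.\<close>
  have 1: "i - 1 + 2 = i + 1" for i :: int by simp
  have eq: "pushr (cdim Y (i + 1)) (mop (w i) x) = - mop (df Y i) (mop (h i) x) +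
       pushr (cdim Y (i + 1)) (mop (s i) (mop (h i) x) + mop (df Z (i - 1)) (dropl (cdim Y i) (mop (h i) x)))
       + mop (h (i + 1)) (mop (df W i) x)" for i x
    using h(4)[of i x] by (simp add: mop_cmap_comp[OF w cone_in_hom[OF s]] cone_in_in2 mop_df_cone[OF s] restr_mop 1)
  define a where "a = (\<lambda>i. pr1 (ob Y i) (ob Z (i - 1)) * h i)"
  have h': "h i \<in> mod_hom A (ob W i) (mod_sum (ob Y i) (ob Z (i - 1)))" for i
    using h(1)[of i] by simp
  have mop_a: "mop (a i) x = restr (cdim Y i) (mop (h i) x)" for i x
    by (simp add: a_def mop_mult)
  have a: "a \<in> cpx_hom A W Y"
  proof (rule cpx_homI)
    show "a i \<in> mod_hom A (ob W i) (ob Y i)" for i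
      unfolding a_def by (rule mod_hom_times[OF mod_hom_pr_in(1) h']) (simp_all add: fd_module_mod_sum)
    fix i x
    have "0 = - mop (df Y i) (mop (h i) x) + restr (cdim Y (i + 1)) (mop (h (i + 1)) (mop (df W i) x))"
      using arg_cong[OF eq[of i x], of "restr (cdim Y (i + 1))"] by (simp add: restr_mop)
    then have "restr (cdim Y (i + 1)) (mop (h (i + 1)) (mop (df W i) x)) = mop (df Y i) (mop (h i) x)"
      by (simp add: algebra_simps)
    then show "mop (a (i + 1)) (mop (df W i) x) = mop (df Y i) (mop (a i) x)"
      by (simp add: mop_a mop_restr)
  qed simp_all
  have "homotopic_maps A W Z w (cmap_comp s a)"
  proof (rule homotopicI[OF w cmap_comp_in_cpx_hom[OF a s], where h = "\<lambda>i. pr2 (ob Y i) (ob Z (i - 1)) * h i"])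
    show "pr2 (ob Y i) (ob Z (i - 1)) * h i \<in> mod_hom A (ob W i) (ob Z (i - 1))" for i
      by (rule mod_hom_times[OF mod_hom_pr_in(2) h']) (simp_all add: fd_module_mod_sum)
    show "mop (w i) x = mop (cmap_comp s a i) x + (mop (df Z (i - 1)) (mop (pr2 (ob Y i) (ob Z (i - 1)) * h i) x) +
       mop (pr2 (ob Y (i + 1)) (ob Z (i + 1 - 1)) * h (i + 1)) (mop (df W i) x))" for i x
      using arg_cong[OF eq[of i x], of "\<lambda>t. restr (cdim Z i) (dropl (cdim Y (i + 1)) t)"]
      by (simp add: mop_cmap_comp[OF a s] mop_a mop_restr restr_mop mop_mult dropl_mop add.assoc)
  qed
  with a show ?thesis by (rule that)
qed

text \<open>The cone is a weak cokernel: a null-homotopy of \<open>g \<circ> q\<close> is exactly what is needed to extend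
\<open>g\<close> over the summand \<open>P\<^sup>i\<^sup>+\<^sup>1\<close> of the cone.\<close>

lemma extend_over_cone:
  assumes q: "q \<in> cpx_hom A P W" and g: "g \<in> cpx_hom A W T"
    and null: "homotopic_maps A P T (cmap_comp g q) (zero_map P T)"
  obtains G where "G \<in> cpx_hom A (cone P W q) T" "cmap_comp G (cone_in P W) = g"
proof -
  let ?C = "cone P W q"
  note [simp] = cpx_homD[OF q] cpx_homD[OF g] bdd_complex_fd[of A P] bdd_complex_fd[of A T] 
    bdd_complex_fd[of A W] bdd_complex_dims[of A P] bdd_complex_dims[of A T] bdd_complex_dims[of A W]
  have C: "bdd_complex A ?C" by (rule bdd_complex_cone[OF q])
  have 2: "i + 1 + 1 = i + 2" for i :: int by simp
  obtain h where h: "\<And>i. h i \<in> mod_hom A (ob P i) (ob T (i - 1))"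
    "\<And>i. dim_row (h i) = cdim T (i - 1)" "\<And>i. dim_col (h i) = cdim P i"
    "\<And>i x. mop (cmap_comp g q i) x = mop (zero_map P T i) x +
      htpy_bd P T h i x"
    using homotopicE[OF null cmap_comp_in_cpx_hom[OF q g] zero_map_hom] by auto
  have eq: "mop (h (i + 2)) (mop (df P (i + 1)) x) =
      mop (g (i + 1)) (mop (q (i + 1)) x) - mop (df T i) (mop (h (i + 1)) x)" for i x
    using h(4)[of "i + 1" x] by (simp add: mop_cmap_comp[OF q g] 2)
  have h': "h (i + 1) \<in> mod_hom A (ob P (i + 1)) (ob T i)" for i
    using h(1)[of "i + 1"] by simp
  define G where "G = (\<lambda>i. h (i + 1) * pr1 (ob P (i + 1)) (ob W i) + g i * pr2 (ob P (i + 1)) (ob W i))"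
  have mop_G: "mop (G i) x = mop (h (i + 1)) x + mop (g i) (dropl (cdim P (i + 1)) x)" for i x
    by (simp add: G_def mop_mult mop_add h mop_restr)
  have G: "G \<in> cpx_hom A ?C T"
  proof (rule cpx_homI)
    show "G i \<in> mod_hom A (ob ?C i) (ob T i)" for i
      unfolding G_def ob_cone
      by (intro mod_hom_add mod_hom_times[OF h' mod_hom_pr_in(1)] mod_hom_times[OF cpx_homD(4)[OF g] mod_hom_pr_in(2)])
         (simp_all add: fd_module_mod_sum)
    show "mop (G (i + 1)) (mop (df ?C i) x) = mop (df T i) (mop (G i) x)" for i x
      by (simp add: mop_G mop_df_cone[OF q] 2 eq mop_pushr dropl_mop h(2,3))
  qed (simp_all add: C)
  moreover have "cmap_comp G (cone_in P W) = g"
    by (rule cmap_eqI[OF cmap_comp_in_cpx_hom[OF cone_in_hom[OF q] G] g])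
       (simp add: mop_cmap_comp[OF cone_in_hom[OF q] G] mop_G cone_in_in2 mop_pushr h(3) mop_restr)
  ultimately show ?thesis by (rule that)
qed

text \<open>A square that commutes up to a homotopy \<open>h\<close> induces a map of cones, whose off-diagonal entry is \<open>h\<close>.\<close>

lemma cone_map:
  assumes f: "f \<in> cpx_hom A X Y" and q: "q \<in> cpx_hom A P W" and p: "p \<in> cpx_hom A P X"
    and s: "s \<in> cpx_hom A W Y"
    and h: "\<And>i. h i \<in> mod_hom A (ob P i) (ob Y (i - 1))"
    and eq: "\<And>i x. mop (cmap_comp s q i) x = mop (cmap_comp f p i) x +
      htpy_bd P Y h i x"
  defines "\<phi> \<equiv> \<lambda>i. four_block_mat (p (i + 1)) (0\<^sub>m (cdim X (i + 1)) (cdim W i)) (h (i + 1)) (s i)"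
  shows "\<phi> \<in> cpx_hom A (cone P W q) (cone X Y f)"
    "\<And>i x. mop (\<phi> i) x = mop (p (i + 1)) x + pushr (cdim X (i + 1)) (mop (h (i + 1)) x + mop (s i) (dropl (cdim P (i + 1)) x))"
    "cmap_comp \<phi> (cone_in P W) = cmap_comp (cone_in X Y) s"
proof -
  note [simp] = cpx_homD[OF q] cpx_homD[OF p] cpx_homD[OF f] cpx_homD[OF s]
     bdd_complex_fd[of A P] bdd_complex_fd[of A X] bdd_complex_fd[of A Y]
    bdd_complex_fd[of A W] bdd_complex_dims[of A P] bdd_complex_dims[of A X] bdd_complex_dims[of A Y] bdd_complex_dims[of A W]
  have 2: "i + 1 + 1 = i + 2" for i :: int by simp
  have h': "h (i + 1) \<in> mod_hom A (ob P (i + 1)) (ob Y i)" for i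
    using h[of "i + 1"] by simp
  have [simp]: "dim_row (h i) = cdim Y (i - 1)" "dim_col (h i) = cdim P i" for i
    using mod_hom_dims[OF h] by auto
  have eq': "mop (h (i + 2)) (mop (df P (i + 1)) x) = mop (s (i + 1)) (mop (q (i + 1)) x)
     - mop (f (i + 1)) (mop (p (i + 1)) x) - mop (df Y i) (mop (h (i + 1)) x)" for i x
    using eq[of "i + 1" x] by (simp add: mop_cmap_comp[OF q s] mop_cmap_comp[OF p f] 2)
  show mop_phi: "mop (\<phi> i) x = mop (p (i + 1)) x + pushr (cdim X (i + 1)) (mop (h (i + 1)) x + mop (s i) (dropl (cdim P (i + 1)) x))" for i x
    by (simp add: \<phi>_def mop_four_block)
  show \<phi>: "\<phi> \<in> cpx_hom A (cone P W q) (cone X Y f)"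
  proof (rule cpx_homI)
    show "\<phi> i \<in> mod_hom A (ob (cone P W q) i) (ob (cone X Y f) i)" for i
      unfolding \<phi>_def ob_cone by (intro mod_hom_four_block h' mod_hom_zero) simp_all
    show "mop (\<phi> (i + 1)) (mop (df (cone P W q) i) x) = mop (df (cone X Y f) i) (mop (\<phi> i) x)" for i x
      unfolding mop_phi mop_df_cone[OF q] mop_df_cone[OF f] 2
      by (simp add: eq' mop_pushr dropl_mop 2)
  qed (simp_all add: bdd_complex_cone[OF f] bdd_complex_cone[OF q])
  show "cmap_comp \<phi> (cone_in P W) = cmap_comp (cone_in X Y) s"
    by (rule cmap_eqI[OF cmap_comp_in_cpx_hom[OF cone_in_hom[OF q] \<phi>] cmap_comp_in_cpx_hom[OF s cone_in_hom[OF f]]])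
       (simp add: mop_cmap_comp[OF cone_in_hom[OF q] \<phi>] mop_cmap_comp[OF s cone_in_hom[OF f]] mop_phi cone_in_in2 mop_pushr
          mop_restr restr_mop)
qed

section \<open>The cohomology of mapping cones\<close>

lemma cobnd_zero [simp]: "0 \<in> cobnd X i"
  unfolding cobnd_def by (rule range_eqI[of _ _ 0]) simp

lemma cobnd_add: "x \<in> cobnd X i \<Longrightarrow> y \<in> cobnd X i \<Longrightarrow> x + y \<in> cobnd X i"
  unfolding cobnd_def by (metis (no_types, lifting) mop_additive(1) rangeE rangeI)

lemma cobnd_minus: "x \<in> cobnd X i \<Longrightarrow> y \<in> cobnd X i \<Longrightarrow> x - y \<in> cobnd X i"
  unfolding cobnd_def by (metis (no_types, lifting) mop_additive(2) rangeE rangeI)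

lemma cobnd_diff_iff: "x - y \<in> cobnd X i \<Longrightarrow> x \<in> cobnd X i \<longleftrightarrow> y \<in> cobnd X i"
  using cobnd_add[of "x - y" X i y] cobnd_minus[of x X i "x - y"] by auto

lemma cobndI: "mop (df X (i - 1)) x \<in> cobnd X i" "mop (df X i) x \<in> cobnd X (i + 1)"
  by (auto simp: cobnd_def)

lemma cocyc_minus: "x \<in> cocyc X i \<Longrightarrow> y \<in> cocyc X i \<Longrightarrow> x - y \<in> cocyc X i"
  by (auto simp: cocyc_def)

lemma cpx_hom_cocyc:
  assumes "f \<in> cpx_hom A X Y" "x \<in> cocyc X i" shows "mop (f i) x \<in> cocyc Y i"
  using assms(2) cpx_homD[OF assms(1)] cpx_homD(7)[OF assms(1), of i x, symmetric]
  by (auto simp: cocyc_def restr_mop)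

lemma cpx_hom_cobnd:
  assumes "f \<in> cpx_hom A X Y" "x \<in> cobnd X i" shows "mop (f i) x \<in> cobnd Y i"
  using assms(2) cpx_homD[OF assms(1)] by (auto simp: cobnd_def)

lemma quasi_isoI:
  assumes "f \<in> cpx_hom A X Y"
    "\<And>i x. x \<in> cocyc X i \<Longrightarrow> mop (f i) x \<in> cobnd Y i \<Longrightarrow> x \<in> cobnd X i"
    "\<And>i y. y \<in> cocyc Y i \<Longrightarrow> \<exists>x \<in> cocyc X i. y - mop (f i) x \<in> cobnd Y i"
  shows "quasi_iso X Y f"
  unfolding quasi_iso_iff[OF assms(1)] using assms(2,3) by blast

lemma quasi_isoD:
  assumes "quasi_iso X Y f" "f \<in> cpx_hom A X Y"
  shows "x \<in> cocyc X i \<Longrightarrow> mop (f i) x \<in> cobnd Y i \<Longrightarrow> x \<in> cobnd X i"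
    "y \<in> cocyc Y i \<Longrightarrow> \<exists>x \<in> cocyc X i. y - mop (f i) x \<in> cobnd Y i"
  using assms quasi_iso_iff[OF assms(2)] by blast+

lemma quasi_iso_homotopic:
  assumes "homotopic_maps A X Y f g" and f: "f \<in> cpx_hom A X Y" and g: "g \<in> cpx_hom A X Y"
  shows "quasi_iso X Y f \<longleftrightarrow> quasi_iso X Y g"
proof -
  obtain h where h: 
    "\<And>i x. mop (f i) x = mop (g i) x + htpy_bd X Y h i x"
    using homotopicE[OF assms] by metis
  have d: "mop (f i) x - mop (g i) x \<in> cobnd Y i" if "x \<in> cocyc X i" for x i
    using that by (auto simp: h cocyc_def cobndI)
  have 1: "mop (f i) x \<in> cobnd Y i \<longleftrightarrow> mop (g i) x \<in> cobnd Y i" if "x \<in> cocyc X i" for x i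
    using cobnd_diff_iff[OF d[OF that]] .
  have 2: "y - mop (f i) x \<in> cobnd Y i \<longleftrightarrow> y - mop (g i) x \<in> cobnd Y i" if "x \<in> cocyc X i" for x y i
    using cobnd_diff_iff[of "y - mop (g i) x" "y - mop (f i) x" Y i] d[OF that] by auto
  show ?thesis unfolding quasi_iso_iff[OF f] quasi_iso_iff[OF g]
    using 1 2 by (meson)
qed

text \<open>Closure under composition and one half of the two-out-of-three property.\<close>

lemma quasi_iso_comp_iff:
  assumes f: "f \<in> cpx_hom A X Y" and g: "g \<in> cpx_hom A Y Z" and qg: "quasi_iso Y Z g"
  shows "quasi_iso X Z (cmap_comp g f) \<longleftrightarrow> quasi_iso X Y f"
proof -
  note gf = cmap_comp_in_cpx_hom[OF f g]
  have cob: "mop (cmap_comp g f i) x \<in> cobnd Z i \<longleftrightarrow> mop (f i) x \<in> cobnd Y i" if "x \<in> cocyc X i" for i x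
    unfolding mop_cmap_comp[OF f g]
    using quasi_isoD(1)[OF qg g cpx_hom_cocyc[OF f that]] cpx_hom_cobnd[OF g] by blast
  have sur: "(\<forall>y \<in> cocyc Z i. \<exists>x \<in> cocyc X i. y - mop (cmap_comp g f i) x \<in> cobnd Z i) \<longleftrightarrow>
    (\<forall>y \<in> cocyc Y i. \<exists>x \<in> cocyc X i. y - mop (f i) x \<in> cobnd Y i)" (is "?L \<longleftrightarrow> ?R") for i
  proof
    assume L: ?L
    show ?R
    proof
      fix y assume y: "y \<in> cocyc Y i"
      then obtain x where x: "x \<in> cocyc X i" "mop (g i) y - mop (cmap_comp g f i) x \<in> cobnd Z i"
        using L cpx_hom_cocyc[OF g y] by blast
      then have "mop (g i) (y - mop (f i) x) \<in> cobnd Z i" by (simp add: mop_cmap_comp[OF f g])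
      then have "y - mop (f i) x \<in> cobnd Y i"
        using quasi_isoD(1)[OF qg g] cocyc_minus[OF y cpx_hom_cocyc[OF f x(1)]] by blast
      then show "\<exists>x \<in> cocyc X i. y - mop (f i) x \<in> cobnd Y i" using x by blast
    qed
  next
    assume R: ?R
    show ?L
    proof
      fix z assume "z \<in> cocyc Z i"
      then obtain y where y: "y \<in> cocyc Y i" "z - mop (g i) y \<in> cobnd Z i"
        using quasi_isoD(2)[OF qg g] by blast
      then obtain x where x: "x \<in> cocyc X i" "y - mop (f i) x \<in> cobnd Y i" using R by blast
      then have "(z - mop (g i) y) + mop (g i) (y - mop (f i) x) \<in> cobnd Z i"
        using y cpx_hom_cobnd[OF g] cobnd_add by blast
      then have "z - mop (cmap_comp g f i) x \<in> cobnd Z i" by (simp add: mop_cmap_comp[OF f g])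
      then show "\<exists>x \<in> cocyc X i. z - mop (cmap_comp g f i) x \<in> cobnd Z i" using x by blast
    qed
  qed
  show ?thesis unfolding quasi_iso_iff[OF f] quasi_iso_iff[OF gf]
    using cob sur by (meson)
qed

lemma quasi_iso_id: 
  assumes "bdd_complex A X" shows "quasi_iso X X (cmap_id X)"
proof (rule quasi_isoI[OF cmap_id_in_cpx_hom[OF assms]])
  have *: "mop (cmap_id X i) x = x" if "x \<in> cocyc X i" for x i
    using that by (simp add: cmap_id_def cocyc_def)
  then show "x \<in> cobnd X i" if "x \<in> cocyc X i" "mop (cmap_id X i) x \<in> cobnd X i" for x i
    using that by simp
  show "\<exists>x \<in> cocyc X i. y - mop (cmap_id X i) x \<in> cobnd X i" if "y \<in> cocyc X i" for y i
    using that * by (intro bexI[of _ y]) auto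
qed

text \<open>Cocycles and coboundaries of a cone in terms of their two blocks; a cochain of the cone in degree
\<open>i\<close> has the form \<open>a + pushr n b\<close> with \<open>a\<close> in \<open>X\<^sup>i\<^sup>+\<^sup>1\<close>, \<open>b\<close> in \<open>Y\<^sup>i\<close> and \<open>n\<close> the dimension of \<open>X\<^sup>i\<^sup>+\<^sup>1\<close>.\<close>

lemma cone_cobnd:
  assumes f: "f \<in> cpx_hom A X Y" and "restr (cdim X (i + 1)) a = a"
  shows "a + pushr (cdim X (i + 1)) b \<in> cobnd (cone X Y f) i \<longleftrightarrow>
    (\<exists>a' b'. a = - mop (df X i) a' \<and> b = mop (f i) a' + mop (df Y (i - 1)) b')"
proof -
  note [simp] = cpx_homD[OF f] bdd_complex_dims[of A X] bdd_complex_dims[of A Y]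
  have 1: "i - 1 + 2 = i + 1" by simp
  show ?thesis
  proof
    assume "a + pushr (cdim X (i + 1)) b \<in> cobnd (cone X Y f) i"
    then obtain z where z: "a + pushr (cdim X (i + 1)) b = - mop (df X i) z +
      pushr (cdim X (i + 1)) (mop (f i) z + mop (df Y (i - 1)) (dropl (cdim X i) z))"
      by (auto simp: cobnd_def mop_df_cone[OF f] 1)
    have "a = - mop (df X i) z"
      using arg_cong[OF z, of "restr (cdim X (i + 1))"] assms(2) by (simp add: restr_mop)
    moreover have "dropl (cdim X (i + 1)) a = 0"
      using restr_pushr_dropl(3)[of "cdim X (i + 1)" a] assms(2) by simp
    then have "b = mop (f i) z + mop (df Y (i - 1)) (dropl (cdim X i) z)"
      using arg_cong[OF z, of "dropl (cdim X (i + 1))"] by (simp add: dropl_mop)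
    ultimately show "\<exists>a' b'. a = - mop (df X i) a' \<and> b = mop (f i) a' + mop (df Y (i - 1)) b'"
      by blast
  next
    assume "\<exists>a' b'. a = - mop (df X i) a' \<and> b = mop (f i) a' + mop (df Y (i - 1)) b'"
    then obtain a' b' where *: "a = - mop (df X i) a'" "b = mop (f i) a' + mop (df Y (i - 1)) b'"
      by blast
    have "a + pushr (cdim X (i + 1)) b = mop (df (cone X Y f) (i - 1))
        (restr (cdim X i) a' + pushr (cdim X i) b')"
      by (simp add: mop_df_cone[OF f] * 1 mop_restr mop_pushr)
    then show "a + pushr (cdim X (i + 1)) b \<in> cobnd (cone X Y f) i"
      using cobndI(1) by metis
  qed
qed

lemma cone_cocyc:
  assumes f: "f \<in> cpx_hom A X Y" and "restr (cdim X (i + 1)) a = a" "restr (cdim Y i) b = b"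
  shows "a + pushr (cdim X (i + 1)) b \<in> cocyc (cone X Y f) i \<longleftrightarrow>
    a \<in> cocyc X (i + 1) \<and> mop (f (i + 1)) a + mop (df Y i) b = 0"
proof -
  note [simp] = cpx_homD[OF f] bdd_complex_dims[of A X] bdd_complex_dims[of A Y]
  have 2: "i + 1 + 1 = i + 2" for i :: int by simp
  have r: "restr (cdim X (i + 1) + cdim Y i) (a + pushr (cdim X (i + 1)) b) = a + pushr (cdim X (i + 1)) b"
    using assms(2,3) by (metis restr_additive(1) restr_pushr_dropl(5,6))
  have da: "dropl (cdim X (i + 1)) a = 0"
    using restr_pushr_dropl(3)[of "cdim X (i + 1)" a] assms(2) by simp
  let ?c = "mop (f (i + 1)) a + mop (df Y i) b"
  have e: "mop (df (cone X Y f) i) (a + pushr (cdim X (i + 1)) b) =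
    - mop (df X (i + 1)) a + pushr (cdim X (i + 2)) ?c"
    by (simp add: mop_df_cone[OF f] mop_pushr da)
  have "- mop (df X (i + 1)) a + pushr (cdim X (i + 2)) ?c = 0 \<longleftrightarrow> mop (df X (i + 1)) a = 0 \<and> ?c = 0"
    (is "?l = 0 \<longleftrightarrow> ?r")
  proof
    assume l: "?l = 0"
    have "mop (df X (i + 1)) a = 0"
      using arg_cong[OF l, of "restr (cdim X (i + 2))"] by (simp add: restr_mop 2)
    moreover have "?c = 0"
      using arg_cong[OF l, of "dropl (cdim X (i + 2))"] by (simp add: dropl_mop 2)
    ultimately show ?r by simp
  next
    assume ?r
    then show "?l = 0" by (simp only: pushr_additive) simp
  qed
  then show ?thesis using r assms(2) unfolding cocyc_def by (simp only: mem_Collect_eq e) simp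
qed

lemma cone_cocycE:
  assumes f: "f \<in> cpx_hom A X Y" and x: "x \<in> cocyc (cone X Y f) i"
  obtains a b where "x = a + pushr (cdim X (i + 1)) b" "restr (cdim X (i + 1)) a = a" "restr (cdim Y i) b = b"
    "a \<in> cocyc X (i + 1)" "mop (f (i + 1)) a + mop (df Y i) b = 0"
proof -
  let ?n = "cdim X (i + 1)"
  let ?a = "restr ?n x" and ?b = "restr (cdim Y i) (dropl ?n x)"
  have e: "x = ?a + pushr ?n ?b"
    using x restr_add[of ?n "cdim Y i" x] by (simp add: cocyc_def)
  have r: "restr ?n ?a = ?a" "restr (cdim Y i) ?b = ?b" by simp_all
  have "?a + pushr ?n ?b \<in> cocyc (cone X Y f) i" using x e by simp
  then show ?thesis using that[OF e r] cone_cocyc[OF f r] by blast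
qed

definition acyclic_cpx :: "('a, 'k::field) cpx \<Rightarrow> bool" where
  "acyclic_cpx X \<longleftrightarrow> (\<forall>i. cocyc X i \<subseteq> cobnd X i)"

text \<open>If \<open>(a, b)\<close> is a cocycle, then \<open>f a = - d b\<close> is a coboundary, so \<open>a = d a\<^sub>0\<close> by injectivity on
cohomology. Now \<open>b + f a\<^sub>0\<close> is a cocycle of \<open>Y\<close>, and surjectivity corrects \<open>a\<^sub>0\<close> by a cocycle \<open>c\<close> of
\<open>X\<close> such that \<open>(a, b)\<close> is the coboundary of an element with first block \<open>c - a\<^sub>0\<close>.\<close>

lemma acyclic_cone:
  assumes f: "f \<in> cpx_hom A X Y" and q: "quasi_iso X Y f"
  shows "acyclic_cpx (cone X Y f)"
  unfolding acyclic_cpx_def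
proof (intro allI subsetI)
  note [simp] = cpx_homD[OF f] bdd_complex_dims[of A X] bdd_complex_dims[of A Y]
  fix i x assume "x \<in> cocyc (cone X Y f) i"
  then obtain a b where x: "x = a + pushr (cdim X (i + 1)) b" and ra: "restr (cdim X (i + 1)) a = a"
    and rb: "restr (cdim Y i) b = b" and a: "a \<in> cocyc X (i + 1)" 
    and ab: "mop (f (i + 1)) a + mop (df Y i) b = 0" by (rule cone_cocycE[OF f])
  have "mop (f (i + 1)) a = mop (df Y i) (- b)" using ab by (simp add: eq_neg_iff_add_eq_0)
  then have "a \<in> cobnd X (i + 1)" using quasi_isoD(1)[OF q f a] by (simp add: cobndI del: mop_additive)
  then obtain a0 where a0: "a = mop (df X i) a0" by (auto simp: cobnd_def)
  have "b + mop (f i) a0 \<in> cocyc Y i"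
    using ab cpx_homD(7)[OF f, of i a0] by (simp add: cocyc_def rb restr_mop a0 add.commute)
  then obtain c where c: "c \<in> cocyc X i" "b + mop (f i) a0 - mop (f i) c \<in> cobnd Y i"
    using quasi_isoD(2)[OF q f] by blast
  then obtain e where "b + mop (f i) a0 - mop (f i) c = mop (df Y (i - 1)) e" by (auto simp: cobnd_def)
  then have "a = - mop (df X i) (c - a0) \<and> b = mop (f i) (c - a0) + mop (df Y (i - 1)) e"
    using c(1) by (simp add: a0 cocyc_def algebra_simps)
  then show "x \<in> cobnd (cone X Y f) i"
    unfolding x cone_cobnd[OF f ra] by blast
qed

lemma cocyc_shift: "cocyc (cpx_shift X) i = cocyc X (i + 1)"
  by (auto simp: cocyc_def)

lemma cobnd_shift: "cobnd (cpx_shift X) i = cobnd X (i + 1)"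
proof -
  have "- mop (df X i) x = mop (df X i) (- x)" "mop (df X i) x = - mop (df X i) (- x)" for x
    by simp_all
  then have "range (\<lambda>x. - mop (df X i) x) = range (mop (df X i))"
    by (metis (no_types, lifting) image_subset_iff rangeI subset_antisym)
  then show ?thesis by (simp add: cobnd_def)
qed

text \<open>Adding an acyclic complex to \<open>X\<close> by a twisted differential does not change cohomology; likewise
for \<open>cone_in\<close> in the next lemma.\<close>

lemma quasi_iso_cone_out:
  assumes c: "c \<in> cpx_hom A X C" and C: "acyclic_cpx C"
  shows "quasi_iso (cone X C c) (cpx_shift X) (cone_out X C)"
proof (rule quasi_isoI[OF cone_out_hom[OF c]])
  note [simp] = cpx_homD[OF c] bdd_complex_dims[of A X] bdd_complex_dims[of A C]
  fix i 
  {
    fix x assume "x \<in> cocyc (cone X C c) i" and out: "mop (cone_out X C i) x \<in> cobnd (cpx_shift X) i"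
    then obtain a b where x: "x = a + pushr (cdim X (i + 1)) b" and ra: "restr (cdim X (i + 1)) a = a"
      and rb: "restr (cdim C i) b = b" and a: "a \<in> cocyc X (i + 1)" 
      and ab: "mop (c (i + 1)) a + mop (df C i) b = 0" using cone_cocycE[OF c] by metis
    have "a \<in> cobnd X (i + 1)" using out ra by (simp add: cobnd_shift cone_out_pr1 x)
    then obtain a0 where a0: "a = mop (df X i) a0" by (auto simp: cobnd_def)
    have "b + mop (c i) a0 \<in> cocyc C i"
      using ab cpx_homD(7)[OF c, of i a0] by (simp add: cocyc_def rb restr_mop a0 add.commute)
    then obtain e where "b + mop (c i) a0 = mop (df C (i - 1)) e" 
      using C by (auto simp: cobnd_def acyclic_cpx_def)
    then have "a = - mop (df X i) (- a0) \<and> b = mop (c i) (- a0) + mop (df C (i - 1)) e"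
      by (simp add: a0 algebra_simps)
    then show "x \<in> cobnd (cone X C c) i"
      unfolding x cone_cobnd[OF c ra] by blast
  next
    fix a assume "a \<in> cocyc (cpx_shift X) i"
    then have a: "a \<in> cocyc X (i + 1)" by (simp add: cocyc_shift)
    then have ra: "restr (cdim X (i + 1)) a = a" by (simp add: cocyc_def)
    have "mop (c (i + 1)) a \<in> cobnd C (i + 1)"
      using cpx_hom_cocyc[OF c a] C by (auto simp: acyclic_cpx_def)
    then obtain e where e: "mop (c (i + 1)) a = mop (df C i) e" by (auto simp: cobnd_def)
    have "a + pushr (cdim X (i + 1)) (- restr (cdim C i) e) \<in> cocyc (cone X C c) i"
      using a by (subst cone_cocyc[OF c ra]) (simp_all add: e mop_restr)
    moreover have "mop (cone_out X C i) (a + pushr (cdim X (i + 1)) (- restr (cdim C i) e)) = a"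
      using ra by (simp add: cone_out_pr1)
    ultimately show "\<exists>x\<in>cocyc (cone X C c) i. a - mop (cone_out X C i) x \<in> cobnd (cpx_shift X) i"
      by (metis cobnd_zero diff_self)
  }
qed

lemma quasi_iso_cone_in:
  fixes X :: "('a, 'k::field) cpx"
  assumes f: "f \<in> cpx_hom A Z X" and Z: "acyclic_cpx Z"
  shows "quasi_iso X (cone Z X f) (cone_in Z X)"
proof (rule quasi_isoI[OF cone_in_hom[OF f]])
  note [simp] = cpx_homD[OF f] bdd_complex_dims[of A X] bdd_complex_dims[of A Z]
  fix i 
  have mop_in: "mop (cone_in Z X i) x = 0 + pushr (cdim Z (i + 1)) x" if "restr (cdim X i) x = x" for x
    using that by (simp add: cone_in_in2)
  have r0: "restr (cdim Z (i + 1)) 0 = (0 :: 'k seqv)" by simp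
  {
    fix x assume x: "x \<in> cocyc X i" and "mop (cone_in Z X i) x \<in> cobnd (cone Z X f) i"
    then obtain a b where ab: "0 = - mop (df Z i) a" "x = mop (f i) a + mop (df X (i - 1)) b"
      using cone_cobnd[OF f r0, of x] mop_in[of x] unfolding cocyc_def by auto
    then have "restr (cdim Z i) a \<in> cocyc Z i" by (simp add: cocyc_def mop_restr)
    then obtain e where e: "restr (cdim Z i) a = mop (df Z (i - 1)) e" 
      using Z by (auto simp: cobnd_def acyclic_cpx_def)
    have "x = mop (df X (i - 1)) (mop (f (i - 1)) e + b)"
      using ab(2) mop_restr[of "f i" "cdim Z i" a] by (simp add: e)
    then show "x \<in> cobnd X i" using cobndI(1) by metis
  next
    fix y assume "y \<in> cocyc (cone Z X f) i"
    then obtain a b where y: "y = a + pushr (cdim Z (i + 1)) b" and ra: "restr (cdim Z (i + 1)) a = a"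
      and rb: "restr (cdim X i) b = b" and a: "a \<in> cocyc Z (i + 1)" 
      and ab: "mop (f (i + 1)) a + mop (df X i) b = 0" by (rule cone_cocycE[OF f])
    obtain a0 where a0: "a = mop (df Z i) a0" using a Z by (fastforce simp: cobnd_def acyclic_cpx_def)
    have c: "b + mop (f i) a0 \<in> cocyc X i"
      using ab cpx_homD(7)[OF f, of i a0] by (simp add: cocyc_def rb restr_mop a0 add.commute)
    have "y - mop (cone_in Z X i) (b + mop (f i) a0) = a + pushr (cdim Z (i + 1)) (- mop (f i) a0)"
      using c mop_in[of "b + mop (f i) a0"] unfolding cocyc_def by (simp add: y)
    moreover have "a = - mop (df Z i) (- a0) \<and> - mop (f i) a0 = mop (f i) (- a0) + mop (df X (i - 1)) 0"
      by (simp add: a0)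
    ultimately have "y - mop (cone_in Z X i) (b + mop (f i) a0) \<in> cobnd (cone Z X f) i"
      using cone_cobnd[OF f ra] by metis
    then show "\<exists>x\<in>cocyc X i. y - mop (cone_in Z X i) x \<in> cobnd (cone Z X f) i"
      using c by blast
  }
qed

text \<open>The five lemma for the long exact cohomology sequences of the two cones. It is proved by the diagram
chase itself, in which the homotopy \<open>h\<close> of the square enters as a correction term.\<close>

lemma quasi_iso_cone_map:
  assumes f: "f \<in> cpx_hom A X Y" and q: "q \<in> cpx_hom A P W" and p: "p \<in> cpx_hom A P X"
    and s: "s \<in> cpx_hom A W Y" and qp: "quasi_iso P X p" and qs: "quasi_iso W Y s"
    and hty: "homotopic_maps A P Y (cmap_comp s q) (cmap_comp f p)"
  obtains \<phi> where "\<phi> \<in> cpx_hom A (cone P W q) (cone X Y f)" "quasi_iso (cone P W q) (cone X Y f) \<phi>"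
    "cmap_comp \<phi> (cone_in P W) = cmap_comp (cone_in X Y) s"
proof -
  note [simp] = cpx_homD[OF q] cpx_homD[OF p] cpx_homD[OF f] cpx_homD[OF s]
     bdd_complex_dims[of A P] bdd_complex_dims[of A X] bdd_complex_dims[of A Y] bdd_complex_dims[of A W]
  obtain h where h: "\<And>i. h i \<in> mod_hom A (ob P i) (ob Y (i - 1))"
    "\<And>i. dim_row (h i) = cdim Y (i - 1)" "\<And>i. dim_col (h i) = cdim P i"
    "\<And>i x. mop (cmap_comp s q i) x = mop (cmap_comp f p i) x +
      htpy_bd P Y h i x"
    using homotopicE[OF hty cmap_comp_in_cpx_hom[OF q s] cmap_comp_in_cpx_hom[OF p f]] by auto
  have sq: "mop (s i) (mop (q i) x) = mop (f i) (mop (p i) x) +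
      htpy_bd P Y h i x" for i x
    using h(4)[of i x] by (simp add: mop_cmap_comp[OF q s] mop_cmap_comp[OF p f])
  obtain \<phi> where \<phi>: "\<phi> \<in> cpx_hom A (cone P W q) (cone X Y f)"
    and mop_phi: "\<And>i x. mop (\<phi> i) x = mop (p (i + 1)) x + pushr (cdim X (i + 1)) (mop (h (i + 1)) x + mop (s i) (dropl (cdim P (i + 1)) x))"
    and in_phi: "cmap_comp \<phi> (cone_in P W) = cmap_comp (cone_in X Y) s"
    by (rule that[OF cone_map[OF f q p s h(1) h(4)]])
  have phi_ab: "mop (\<phi> i) (a + pushr (cdim P (i + 1)) b) = mop (p (i + 1)) a +
      pushr (cdim X (i + 1)) (mop (h (i + 1)) a + mop (s i) b)" if "restr (cdim P (i + 1)) a = a" for i a b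
  proof -
    have da: "dropl (cdim P (i + 1)) a = 0"
      using restr_pushr_dropl(3)[of "cdim P (i + 1)" a] that by simp
    show ?thesis by (simp add: mop_phi mop_pushr da h)
  qed
  have rp: "restr (cdim X i) (mop (p i) a) = mop (p i) a" for i a by (simp add: restr_mop)
  have "quasi_iso (cone P W q) (cone X Y f) \<phi>"
  proof (rule quasi_isoI[OF \<phi>])
    fix i x assume "x \<in> cocyc (cone P W q) i" and out: "mop (\<phi> i) x \<in> cobnd (cone X Y f) i"
    then obtain a b where x: "x = a + pushr (cdim P (i + 1)) b" and ra: "restr (cdim P (i + 1)) a = a"
      and rb: "restr (cdim W i) b = b" and a: "a \<in> cocyc P (i + 1)" 
      and ab: "mop (q (i + 1)) a + mop (df W i) b = 0" using cone_cocycE[OF q] by metis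
    obtain a1 b1 where a1: "mop (p (i + 1)) a = - mop (df X i) a1"
      and b1: "mop (h (i + 1)) a + mop (s i) b = mop (f i) a1 + mop (df Y (i - 1)) b1"
      using out unfolding x phi_ab[OF ra] cone_cobnd[OF f rp] by blast
    have "mop (p (i + 1)) a = mop (df X i) (- a1)" using a1 by simp
    then have "mop (p (i + 1)) a \<in> cobnd X (i + 1)" by (metis cobndI(2))
    then have "a \<in> cobnd P (i + 1)" using quasi_isoD(1)[OF qp p a] by simp
    then obtain z where z: "a = mop (df P i) z" by (auto simp: cobnd_def)
    have pz: "mop (p (i + 1)) a = mop (df X i) (mop (p i) z)" unfolding z by simp
    \<comment> \<open>Both \<open>a1\<close> and \<open>- p z\<close> bound \<open>- p a\<close>, so their difference is a cocycle, cohomologous to some \<open>p z'\<close>.\<close>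
    define x2 where "x2 = restr (cdim X i) (a1 + mop (p i) z)"
    have "x2 \<in> cocyc X i" using a1 pz by (simp add: x2_def cocyc_def mop_restr)
    then obtain z' where z': "z' \<in> cocyc P i" "x2 - mop (p i) z' \<in> cobnd X i"
      using quasi_isoD(2)[OF qp p] by blast
    then obtain w' where w': "x2 - mop (p i) z' = mop (df X (i - 1)) w'" by (auto simp: cobnd_def)
    have fx2: "mop (f i) x2 = mop (f i) (mop (p i) z') + mop (df Y (i - 1)) (mop (f (i - 1)) w')"
      using arg_cong[OF w', of "mop (f i)"] by (simp add: algebra_simps)
    have "mop (f i) x2 = mop (f i) a1 + mop (f i) (mop (p i) z)"
      by (simp add: x2_def mop_restr)
    then have fa1: "mop (f i) a1 = mop (f i) x2 - mop (f i) (mop (p i) z)"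
      by (simp add: eq_diff_eq)
    have sb: "mop (s i) b = mop (f i) a1 + mop (df Y (i - 1)) b1 - mop (h (i + 1)) a"
      using b1 by (simp add: eq_diff_eq add.commute)
    have sz': "mop (s i) (mop (q i) z') = mop (f i) (mop (p i) z') + mop (df Y (i - 1)) (mop (h i) z')"
      using sq[of i z'] z'(1) by (simp add: cocyc_def)
    have sz: "mop (s i) (mop (q i) z) = mop (f i) (mop (p i) z) + mop (df Y (i - 1)) (mop (h i) z) + mop (h (i + 1)) a"
      using sq[of i z] by (simp add: z add.assoc)
    have e: "mop (s i) (b + mop (q i) z - mop (q i) z') = 
       mop (df Y (i - 1)) (b1 + mop (f (i - 1)) w' + mop (h i) z - mop (h i) z')"
      by (simp add: sb fa1 fx2 sz sz' algebra_simps)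
    have "mop (df W i) b + mop (df W i) (mop (q i) z) = 0"
      using ab cpx_homD(7)[OF q, of i z] by (simp add: z add.commute)
    moreover have "mop (df W i) (mop (q i) z') = 0"
      using cpx_hom_cocyc[OF q z'(1)] by (simp add: cocyc_def)
    ultimately have "b + mop (q i) z - mop (q i) z' \<in> cocyc W i"
      using rb by (simp add: cocyc_def restr_mop)
    moreover have "mop (s i) (b + mop (q i) z - mop (q i) z') \<in> cobnd Y i"
      unfolding e by (rule cobndI)
    ultimately have "b + mop (q i) z - mop (q i) z' \<in> cobnd W i" using quasi_isoD(1)[OF qs s] by blast
    then obtain y2 where y2: "b + mop (q i) z - mop (q i) z' = mop (df W (i - 1)) y2"
      by (auto simp: cobnd_def)
    have "a = - mop (df P i) (z' - z) \<and> b = mop (q i) (z' - z) + mop (df W (i - 1)) y2"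
      using z'(1) by (simp add: z cocyc_def y2[symmetric])
    then show "x \<in> cobnd (cone P W q) i" unfolding x cone_cobnd[OF q ra] by blast
  next
    fix i y assume "y \<in> cocyc (cone X Y f) i"
    then obtain a b where y: "y = a + pushr (cdim X (i + 1)) b" and ra: "restr (cdim X (i + 1)) a = a"
      and rb: "restr (cdim Y i) b = b" and a: "a \<in> cocyc X (i + 1)" 
      and ab: "mop (f (i + 1)) a + mop (df Y i) b = 0" using cone_cocycE[OF f] by metis
    obtain c where c: "c \<in> cocyc P (i + 1)" "a - mop (p (i + 1)) c \<in> cobnd X (i + 1)"
      using quasi_isoD(2)[OF qp p a] by blast
    then obtain w where w: "a - mop (p (i + 1)) c = mop (df X i) w" by (auto simp: cobnd_def)
    have rc: "restr (cdim P (i + 1)) c = c" and dc: "mop (df P (i + 1)) c = 0"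
      using c(1) by (auto simp: cocyc_def)
    have fa: "mop (f (i + 1)) a = mop (df Y i) (mop (f i) w) + mop (f (i + 1)) (mop (p (i + 1)) c)"
      using arg_cong[OF w, of "mop (f (i + 1))"] by (simp add: diff_eq_eq)
    have sqc: "mop (s (i + 1)) (mop (q (i + 1)) c) = mop (df Y i) (mop (h (i + 1)) c - mop (f i) w - b)"
      using sq[of "i + 1" c] fa ab dc by (simp add: algebra_simps)
    then have "mop (s (i + 1)) (mop (q (i + 1)) c) \<in> cobnd Y (i + 1)" by (metis cobndI(2))
    then have "mop (q (i + 1)) c \<in> cobnd W (i + 1)"
      using quasi_isoD(1)[OF qs s cpx_hom_cocyc[OF q c(1)]] by simp
    then obtain e where e: "mop (q (i + 1)) c = mop (df W i) e" by (auto simp: cobnd_def)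
    \<comment> \<open>The failure of \<open>(c, - e)\<close> to be a preimage of \<open>(a, b)\<close> up to coboundaries; lifting the cocycle \<open>v\<close>
along \<open>s\<close> repairs it.\<close>
    define v where "v = b + mop (f i) w - mop (h (i + 1)) c + mop (s i) e"
    have "mop (df Y i) (mop (s i) e) = mop (df Y i) (mop (h (i + 1)) c - mop (f i) w - b)"
      using sqc cpx_homD(7)[OF s, of i e] unfolding e by simp
    then have "v \<in> cocyc Y i"
      using rb h(2)[of "i + 1"] by (simp add: cocyc_def v_def restr_mop)
    then obtain g where g: "g \<in> cocyc W i" "v - mop (s i) g \<in> cobnd Y i"
      using quasi_isoD(2)[OF qs s] by blast
    then obtain t where t: "v - mop (s i) g = mop (df Y (i - 1)) t" by (auto simp: cobnd_def)
    define b' where "b' = g - restr (cdim W i) e"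
    have rb': "restr (cdim W i) b' = b'" using g(1) by (simp add: b'_def cocyc_def)
    have xc: "c + pushr (cdim P (i + 1)) b' \<in> cocyc (cone P W q) i"
      using c(1) g(1) by (subst cone_cocyc[OF q rc rb']) (simp add: b'_def e mop_restr cocyc_def)
    have "y - mop (\<phi> i) (c + pushr (cdim P (i + 1)) b') = (a - mop (p (i + 1)) c) +
       pushr (cdim X (i + 1)) (b - mop (h (i + 1)) c - mop (s i) b')"
      unfolding y phi_ab[OF rc] by (simp add: algebra_simps)
    moreover have "restr (cdim X (i + 1)) (a - mop (p (i + 1)) c) = a - mop (p (i + 1)) c"
      using ra rp by simp
    moreover have "a - mop (p (i + 1)) c = - mop (df X i) (- w) \<and>
      b - mop (h (i + 1)) c - mop (s i) b' = mop (f i) (- w) + mop (df Y (i - 1)) t"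
      unfolding w t[symmetric] by (simp add: b'_def v_def mop_restr algebra_simps)
    ultimately have "y - mop (\<phi> i) (c + pushr (cdim P (i + 1)) b') \<in> cobnd (cone X Y f) i"
      using cone_cobnd[OF f, of i "a - mop (p (i + 1)) c" "b - mop (h (i + 1)) c - mop (s i) b'"]
      by metis
    then show "\<exists>x\<in>cocyc (cone P W q) i. y - mop (\<phi> i) x \<in> cobnd (cone X Y f) i"
      using xc by blast
  qed
  then show ?thesis using \<phi> in_phi that by blast
qed

section \<open>The suspension\<close>

text \<open>The complex of zero spaces supplies the zero object of the derived category.\<close>

definition zero_cpx :: "('a, 'k::field) cpx" where
  "zero_cpx = \<lparr>ob = (\<lambda>i. \<lparr>mdim = 0, act = (\<lambda>a. 0\<^sub>m 0 0)\<rparr>), df = (\<lambda>i. 0\<^sub>m 0 0)\<rparr>"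

lemma bdd_complex_zero: "bdd_complex A (zero_cpx :: ('a, 'k::field) cpx)"
proof -
  have "fd_module A \<lparr>mdim = 0, act = (\<lambda>a. 0\<^sub>m 0 0 :: 'k mat)\<rparr>"
    by (auto simp: fd_module_def ring_mat_simps intro!: ring_hom_memI eq_matI)
  then show ?thesis
    by (intro bdd_complexI) (auto simp: zero_cpx_def intro!: mod_homI)
qed

lemma acyclic_zero: "acyclic_cpx zero_cpx"
  by (auto simp: acyclic_cpx_def cocyc_def zero_cpx_def)

text \<open>The shift of complexes is strictly invertible, because the sign change of the differential is an
involution. The suspension of the derived category is therefore an automorphism, not just an
equivalence.\<close>

definition cpx_unshift :: "('a, 'k::field) cpx \<Rightarrow> ('a, 'k) cpx" where
  "cpx_unshift X = \<lparr>ob = (\<lambda>i. ob X (i - 1)), df = (\<lambda>i. - df X (i - 1))\<rparr>"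

definition cmap_unshift :: "'k cmap \<Rightarrow> 'k cmap" where
  "cmap_unshift f = (\<lambda>i. f (i - 1))"

lemma ob_unshift [simp]: "ob (cpx_unshift X) i = ob X (i - 1)"
  and df_unshift [simp]: "df (cpx_unshift X) i = - df X (i - 1)"
  by (simp_all add: cpx_unshift_def)

lemma shift_unshift [simp]:
  "cpx_shift (cpx_unshift X) = X" "cpx_unshift (cpx_shift X) = X"
  "cmap_shift (cmap_unshift f) = f" "cmap_unshift (cmap_shift f) = f"
  by (cases X, simp add: cpx_shift_def cpx_unshift_def)+
     (simp_all add: cmap_shift_def cmap_unshift_def)

lemma cmap_shift_simps: "cmap_shift (cmap_comp g f) = cmap_comp (cmap_shift g) (cmap_shift f)"
  "cmap_shift (cmap_id X) = cmap_id (cpx_shift X)" "cmap_shift f i = f (i + 1)"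
  by (simp_all add: cmap_shift_def cmap_comp_def cmap_id_def)

lemma bdd_complex_shift [simp]: "bdd_complex A (cpx_shift X) \<longleftrightarrow> bdd_complex A X"
proof
  have *: "bdd_complex A (cpx_unshift X)" if X: "bdd_complex A X" for X
  proof (rule bdd_complexI)
    show "fd_module A (ob (cpx_unshift X) i)" for i using X by (simp add: bdd_complex_fd)
    show "df (cpx_unshift X) i \<in> mod_hom A (ob (cpx_unshift X) i) (ob (cpx_unshift X) (i + 1))" for i
      using X bdd_complex_df[OF X, of "i - 1"] by (simp add: mod_hom_uminus bdd_complex_fd)
    show "mop (df (cpx_unshift X) (i + 1)) (mop (df (cpx_unshift X) i) x) = 0" for i x
      using mop_df_df(2)[OF X, of i x] by simp
    have "{i. cdim (cpx_unshift X) i \<noteq> 0} = (\<lambda>i. i + 1) ` {i. cdim X i \<noteq> 0}"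
      by (force intro: image_eqI[of _ _ "_ - 1"])
    then show "finite {i. cdim (cpx_unshift X) i \<noteq> 0}"
      using X by (simp add: bdd_complex_def)
  qed
  show "bdd_complex A X" if "bdd_complex A (cpx_shift X)" using *[OF that] by simp
qed (rule bdd_complex_shift_imp)

lemma bdd_complex_unshift [simp]: "bdd_complex A (cpx_unshift X) \<longleftrightarrow> bdd_complex A X"
  using bdd_complex_shift[of A "cpx_unshift X"] by simp

lemma all_int_shift: "(\<forall>i::int. P (i + 1)) \<longleftrightarrow> (\<forall>i. P i)"
  by (metis diff_add_cancel)

lemma cpx_hom_shift [simp]:
  "cmap_shift f \<in> cpx_hom A (cpx_shift X) (cpx_shift Y) \<longleftrightarrow> f \<in> cpx_hom A X Y"
proof
  assume f: "f \<in> cpx_hom A X Y"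
  show "cmap_shift f \<in> cpx_hom A (cpx_shift X) (cpx_shift Y)"
    using cpx_homD[OF f]
    by (intro cpx_homI) (simp_all add: cmap_shift_def add.assoc)
next
  assume f: "cmap_shift f \<in> cpx_hom A (cpx_shift X) (cpx_shift Y)"
  show "f \<in> cpx_hom A X Y"
  proof (rule cpx_homI)
    show "bdd_complex A X" "bdd_complex A Y" using cpx_homD(1,2)[OF f] by auto
    show "f i \<in> mod_hom A (ob X i) (ob Y i)" for i
      using cpx_homD(4)[OF f, of "i - 1"] by (simp add: cmap_shift_def)
    show "mop (f (i + 1)) (mop (df X i) x) = mop (df Y i) (mop (f i) x)" for i x
      using cpx_homD(7)[OF f, of "i - 1" x] by (simp add: cmap_shift_def)
  qed
qed

lemma quasi_iso_shift [simp]: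
  assumes f: "f \<in> cpx_hom A X Y"
  shows "quasi_iso (cpx_shift X) (cpx_shift Y) (cmap_shift f) \<longleftrightarrow> quasi_iso X Y f"
proof -
  have f': "cmap_shift f \<in> cpx_hom A (cpx_shift X) (cpx_shift Y)" using f by simp
  show ?thesis
    unfolding quasi_iso_iff[OF f] quasi_iso_iff[OF f'] cocyc_shift cobnd_shift
    unfolding cmap_shift_def by (rule all_int_shift)
qed

lemma homotopic_shift:
  assumes f: "f \<in> cpx_hom A X Y" and g: "g \<in> cpx_hom A X Y"
  shows "homotopic_maps A (cpx_shift X) (cpx_shift Y) (cmap_shift f) (cmap_shift g) \<longleftrightarrow>
    homotopic_maps A X Y f g"
proof
  note [simp] = cpx_homD[OF f] bdd_complex_fd[of A X] bdd_complex_fd[of A Y]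
  have f': "cmap_shift f \<in> cpx_hom A (cpx_shift X) (cpx_shift Y)"
    and g': "cmap_shift g \<in> cpx_hom A (cpx_shift X) (cpx_shift Y)" using f g by simp_all
  {
    assume "homotopic_maps A X Y f g"
    then obtain h where h: "\<And>i. h i \<in> mod_hom A (ob X i) (ob Y (i - 1))"
      "\<And>i x. mop (f i) x = mop (g i) x + htpy_bd X Y h i x"
      using homotopicE[OF _ f g] by metis
    show "homotopic_maps A (cpx_shift X) (cpx_shift Y) (cmap_shift f) (cmap_shift g)"
    proof (rule homotopicI[OF f' g', where h = "\<lambda>i. - h (i + 1)"])
      show "- h (i + 1) \<in> mod_hom A (ob (cpx_shift X) i) (ob (cpx_shift Y) (i - 1))" for i
        using h(1)[of "i + 1"] by (simp add: mod_hom_uminus)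
      show "mop (cmap_shift f i) x = mop (cmap_shift g i) x +
          (mop (df (cpx_shift Y) (i - 1)) (mop (- h (i + 1)) x) +
           mop (- h (i + 1 + 1)) (mop (df (cpx_shift X) i) x))" for i x
        using h(2)[of "i + 1" x] by (simp add: cmap_shift_def)
    qed
  }
  {
    assume "homotopic_maps A (cpx_shift X) (cpx_shift Y) (cmap_shift f) (cmap_shift g)"
    then obtain h where h: "\<And>i. h i \<in> mod_hom A (ob (cpx_shift X) i) (ob (cpx_shift Y) (i - 1))"
      "\<And>i x. mop (cmap_shift f i) x = mop (cmap_shift g i) x + (mop (df (cpx_shift Y) (i - 1)) (mop (h i) x)
         + mop (h (i + 1)) (mop (df (cpx_shift X) i) x))"
      using homotopicE[OF _ f' g'] by metis
    show "homotopic_maps A X Y f g"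
    proof (rule homotopicI[OF f g, where h = "\<lambda>i. - h (i - 1)"])
      show "- h (i - 1) \<in> mod_hom A (ob X i) (ob Y (i - 1))" for i
        using h(1)[of "i - 1"] by (simp add: mod_hom_uminus)
      show "mop (f i) x = mop (g i) x +
          (mop (df Y (i - 1)) (mop (- h (i - 1)) x) + mop (- h (i + 1 - 1)) (mop (df X i) x))" for i x
        using h(2)[of "i - 1" x] by (simp add: cmap_shift_def)
    qed
  }
qed

section \<open>The Ore condition and cancellation\<close>

text \<open>The cocone \<open>\<Sigma>\<inverse>cone c\<close> of a map into an acyclic complex is quasi-isomorphic to \<open>X\<close>, and
\<open>c\<close> becomes null-homotopic on it. All refinements of apexes below arise in this way.\<close>

lemma cocone:
  assumes c: "c \<in> cpx_hom A X C" and C: "acyclic_cpx C"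
  obtains P t where "t \<in> cpx_hom A P X" "quasi_iso P X t"
    "homotopic_maps A P C (cmap_comp c t) (zero_map P C)"
proof -
  note [simp] = cpx_homD[OF c] bdd_complex_fd[of A X] bdd_complex_fd[of A C]
    bdd_complex_dims[of A X] bdd_complex_dims[of A C]
  let ?K = "cone X C c"
  define P where "P = cpx_unshift ?K"
  define t where "t = cmap_unshift (cone_out X C)"
  have t: "t \<in> cpx_hom A P X"
    using cone_out_hom[OF c] cpx_hom_shift[of t A P X] by (simp add: t_def P_def)
  have q: "quasi_iso P X t"
    using quasi_iso_cone_out[OF c C] quasi_iso_shift[OF t] by (simp add: t_def P_def)
  have P: "bdd_complex A P" using cpx_homD(1)[OF t] .
  have 1: "i - 1 + 2 = i + 1" for i :: int by simp
  \<comment> \<open>The null-homotopy is the projection to \<open>C\<close>; its sign comes from the sign in the unshifted differential.\<close>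
  have "homotopic_maps A P C (cmap_comp c t) (zero_map P C)"
  proof (rule homotopicI[OF cmap_comp_in_cpx_hom[OF t c] zero_map_hom[OF P],
        where h = "\<lambda>i. - pr2 (ob X i) (ob C (i - 1))"])
    show "- pr2 (ob X i) (ob C (i - 1)) \<in> mod_hom A (ob P i) (ob C (i - 1))" for i
      by (simp add: P_def mod_hom_uminus mod_hom_pr_in fd_module_mod_sum)
    show "mop (cmap_comp c t i) x = mop (zero_map P C i) x +
       (mop (df C (i - 1)) (mop (- pr2 (ob X i) (ob C (i - 1))) x) +
        mop (- pr2 (ob X (i + 1)) (ob C (i + 1 - 1))) (mop (df P i) x))" for i x
      unfolding mop_cmap_comp[OF t c]
      by (simp add: P_def t_def cmap_unshift_def cone_out_pr1 mop_df_cone[OF c] 1 mop_restr restr_mop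
          dropl_mop)
  qed simp
  then show ?thesis using t q that by blast
qed

text \<open>The map \<open>X \<rightarrow> Z \<rightarrow> cone s\<close> has acyclic target, so it is null-homotopic after a refinement
\<open>t\<close> of \<open>X\<close>. Then \<open>f \<circ> t\<close> factors through \<open>s\<close> since \<open>Y\<close> is a weak kernel.\<close>

lemma ore:
  assumes f: "f \<in> cpx_hom A X Z" and s: "s \<in> cpx_hom A Y Z" and q: "quasi_iso Y Z s"
  obtains P t g where "t \<in> cpx_hom A P X" "quasi_iso P X t" "g \<in> cpx_hom A P Y"
    "homotopic_maps A P Z (cmap_comp f t) (cmap_comp s g)"
proof -
  let ?C = "cone Y Z s"
  have c: "cmap_comp (cone_in Y Z) f \<in> cpx_hom A X ?C"
    by (rule cmap_comp_in_cpx_hom[OF f cone_in_hom[OF s]])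
  obtain P t where t: "t \<in> cpx_hom A P X" "quasi_iso P X t"
    and "homotopic_maps A P ?C (cmap_comp (cmap_comp (cone_in Y Z) f) t) (zero_map P ?C)"
    by (rule cocone[OF c acyclic_cone[OF s q]])
  then have "homotopic_maps A P ?C (cmap_comp (cone_in Y Z) (cmap_comp f t)) (zero_map P ?C)"
    using cmap_comp_assoc[OF t(1) f cone_in_hom[OF s]] by simp
  then obtain g where "g \<in> cpx_hom A P Y" "homotopic_maps A P Z (cmap_comp f t) (cmap_comp s g)"
    by (rule factor_through_cone_source[OF s cmap_comp_in_cpx_hom[OF t(1) f]])
  then show ?thesis using t that by blast
qed

text \<open>A homotopy between \<open>s \<circ> u\<close> and \<open>s \<circ> v\<close> lifts \<open>u - v\<close> to the cocone \<open>E\<close> of \<open>s\<close>. Since \<open>E\<close> is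
acyclic, the lift becomes null-homotopic on a refinement of \<open>X\<close>, and hence so does \<open>u - v\<close>.\<close>

lemma cancel_quasi_iso:
  assumes u: "u \<in> cpx_hom A X Y" and v: "v \<in> cpx_hom A X Y" and s: "s \<in> cpx_hom A Y Z"
    and q: "quasi_iso Y Z s" and hty: "homotopic_maps A X Z (cmap_comp s u) (cmap_comp s v)"
  obtains P t where "t \<in> cpx_hom A P X" "quasi_iso P X t"
    "homotopic_maps A P Y (cmap_comp u t) (cmap_comp v t)"
proof -
  note [simp] = cpx_homD[OF u] cpx_homD[OF v] cpx_homD[OF s] bdd_complex_fd[of A X] bdd_complex_fd[of A Y]
    bdd_complex_fd[of A Z] bdd_complex_dims[of A X] bdd_complex_dims[of A Y] bdd_complex_dims[of A Z]
  have 1: "i - 1 + 2 = i + 1" for i :: int by simp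
  obtain h where h: "\<And>i. h i \<in> mod_hom A (ob X i) (ob Z (i - 1))"
    "\<And>i. dim_row (h i) = cdim Z (i - 1)" "\<And>i. dim_col (h i) = cdim X i"
    "\<And>i x. mop (cmap_comp s u i) x = mop (cmap_comp s v i) x +
      htpy_bd X Z h i x"
    using homotopicE[OF hty cmap_comp_in_cpx_hom[OF u s] cmap_comp_in_cpx_hom[OF v s]] by auto
  have eq: "mop (h (i + 1)) (mop (df X i) x) = mop (s i) (mop (u i) x) - mop (s i) (mop (v i) x)
      - mop (df Z (i - 1)) (mop (h i) x)" for i x
    using h(4)[of i x] by (simp add: mop_cmap_comp[OF u s] mop_cmap_comp[OF v s])
  define E where "E = cpx_unshift (cone Y Z s)"
  have "acyclic_cpx (cpx_shift E)" using acyclic_cone[OF s q] by (simp add: E_def)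
  then have E: "acyclic_cpx E"
    unfolding acyclic_cpx_def cocyc_shift cobnd_shift
    using all_int_shift[of "\<lambda>i. cocyc E i \<subseteq> cobnd E i"] by simp
  have bE: "bdd_complex A E" by (simp add: E_def bdd_complex_cone[OF s])
  define w where "w = (\<lambda>i. u i + - v i)"
  have w: "w i \<in> mod_hom A (ob X i) (ob Y i)" for i
    unfolding w_def by (intro mod_hom_add mod_hom_uminus) simp_all
  have mop_w: "mop (w i) x = mop (u i) x - mop (v i) x" for i x
    by (simp add: w_def mop_add)
  have [simp]: "dim_row (w i) = cdim Y i" "dim_col (w i) = cdim X i" for i
    using mod_hom_dims[OF w] by auto
  \<comment> \<open>The lift of \<open>w = u - v\<close>; the sign of \<open>h\<close> makes it compatible with the unshifted differential.\<close>
  define b where "b = (\<lambda>i. in1 (ob Y i) (ob Z (i - 1)) * w i + - (in2 (ob Y i) (ob Z (i - 1)) * h i))"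
  have mop_b: "mop (b i) x = mop (w i) x - pushr (cdim Y i) (mop (h i) x)" for i x
    by (simp add: b_def mop_add mop_mult h restr_mop)
  have b: "b \<in> cpx_hom A X E"
  proof (rule cpx_homI)
    show "b i \<in> mod_hom A (ob X i) (ob E i)" for i
      unfolding b_def E_def
      by (simp add: mod_hom_add mod_hom_uminus mod_hom_times[OF mod_hom_pr_in(3) w]
          mod_hom_times[OF mod_hom_pr_in(4) h(1)] fd_module_mod_sum)
    show "mop (b (i + 1)) (mop (df X i) x) = mop (df E i) (mop (b i) x)" for i x
      by (simp add: mop_b E_def mop_df_cone[OF s] 1 eq mop_w mop_pushr dropl_mop)
  qed (simp_all add: bE)
  obtain P t where t: "t \<in> cpx_hom A P X" "quasi_iso P X t"
    and n: "homotopic_maps A P E (cmap_comp b t) (zero_map P E)"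
    by (rule cocone[OF b E])
  have P: "bdd_complex A P" using cpx_homD(1)[OF t(1)] .
  obtain l where l: "\<And>i. l i \<in> mod_hom A (ob P i) (ob E (i - 1))"
    "\<And>i. dim_row (l i) = cdim E (i - 1)" "\<And>i. dim_col (l i) = cdim P i"
    "\<And>i x. mop (cmap_comp b t i) x = mop (zero_map P E i) x +
      htpy_bd P E l i x"
    using homotopicE[OF n cmap_comp_in_cpx_hom[OF t(1) b] zero_map_hom[OF P bE]] by auto
  have l': "l i \<in> mod_hom A (ob P i) (mod_sum (ob Y (i - 1)) (ob Z (i - 1 - 1)))" for i
    using l(1)[of i] by (simp add: E_def)
  have [simp]: "dim_row (l i) = cdim Y (i - 1) + cdim Z (i - 1 - 1)" "dim_col (l i) = cdim P i" for i
    using mod_hom_dims[OF l'[of i]] by simp_all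
  have "homotopic_maps A P Y (cmap_comp u t) (cmap_comp v t)"
  proof (rule homotopicI[OF cmap_comp_in_cpx_hom[OF t(1) u] cmap_comp_in_cpx_hom[OF t(1) v],
        where h = "\<lambda>i. pr1 (ob Y (i - 1)) (ob Z (i - 1 - 1)) * l i"])
    show "pr1 (ob Y (i - 1)) (ob Z (i - 1 - 1)) * l i \<in> mod_hom A (ob P i) (ob Y (i - 1))" for i
      by (rule mod_hom_times[OF mod_hom_pr_in(1) l']) (simp_all add: fd_module_mod_sum bdd_complex_fd[OF P])
    fix i x
    have "mop (w i) (mop (t i) x) = mop (df Y (i - 1)) (mop (l i) x) +
      restr (cdim Y i) (mop (l (i + 1)) (mop (df P i) x))"
      using arg_cong[OF l(4)[of i x], of "restr (cdim Y i)"] mop_df_cone[OF s, of "i - 1 - 1"]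
      by (simp add: mop_cmap_comp[OF t(1) b] mop_b E_def restr_mop)
    then show "mop (cmap_comp u t i) x = mop (cmap_comp v t i) x +
       (mop (df Y (i - 1)) (mop (pr1 (ob Y (i - 1)) (ob Z (i - 1 - 1)) * l i) x) +
        mop (pr1 (ob Y (i + 1 - 1)) (ob Z (i + 1 - 1 - 1)) * l (i + 1)) (mop (df P i) x))"
      by (simp add: mop_cmap_comp[OF t(1) u] mop_cmap_comp[OF t(1) v] mop_w mop_mult mop_restr
          diff_eq_eq add.commute)
  qed
  then show ?thesis using t that by blast
qed

section \<open>Right fractions\<close>

text \<open>A category with a class \<open>Q\<close> of arrows admitting a calculus of right fractions. Composition is
associative for all arguments, which holds when the composite of non-composable arrows is a dummy
value; equational reasoning then has no typing conditions.\<close>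

locale right_fractions =
  fixes Ob :: "'o set" and Hm :: "'o \<Rightarrow> 'o \<Rightarrow> 'm set" and cp :: "'m \<Rightarrow> 'm \<Rightarrow> 'm" (infixr "\<odot>" 70)
    and I :: "'o \<Rightarrow> 'm" and Q :: "'m set"
  assumes assoc: "(h \<odot> g) \<odot> f = h \<odot> (g \<odot> f)"
    and comp_Hm: "f \<in> Hm X Y \<Longrightarrow> g \<in> Hm Y Z \<Longrightarrow> g \<odot> f \<in> Hm X Z"
    and Hm_Ob: "f \<in> Hm X Y \<Longrightarrow> X \<in> Ob \<and> Y \<in> Ob"
    and I_Hm: "X \<in> Ob \<Longrightarrow> I X \<in> Hm X X" and I_Q: "X \<in> Ob \<Longrightarrow> I X \<in> Q"
    and comp_I: "f \<in> Hm X Y \<Longrightarrow> f \<odot> I X = f \<and> I Y \<odot> f = f"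
    and Q_comp: "f \<in> Hm X Y \<Longrightarrow> g \<in> Hm Y Z \<Longrightarrow> g \<in> Q \<Longrightarrow> g \<odot> f \<in> Q \<longleftrightarrow> f \<in> Q"
    and ore: "f \<in> Hm X Z \<Longrightarrow> s \<in> Hm Y Z \<Longrightarrow> s \<in> Q \<Longrightarrow>
      \<exists>P. \<exists>t \<in> Hm P X \<inter> Q. \<exists>g \<in> Hm P Y. f \<odot> t = s \<odot> g"
    and cancel: "u \<in> Hm X Y \<Longrightarrow> v \<in> Hm X Y \<Longrightarrow> s \<in> Hm Y Z \<Longrightarrow> s \<in> Q \<Longrightarrow> s \<odot> u = s \<odot> v \<Longrightarrow>
      \<exists>P. \<exists>t \<in> Hm P X \<inter> Q. u \<odot> t = v \<odot> t"
begin

text \<open>The triple \<open>(W, s, f)\<close> is the fraction \<open>f s\<inverse>\<close> from \<open>X\<close> to \<open>Y\<close> with apex \<open>W\<close>.\<close>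

definition frac :: "'o \<Rightarrow> 'o \<Rightarrow> ('o \<times> 'm \<times> 'm) \<Rightarrow> bool" where
  "frac X Y = (\<lambda>(W, s, f). s \<in> Hm W X \<and> s \<in> Q \<and> f \<in> Hm W Y)"

definition frac_eq :: "('o \<times> 'm \<times> 'm) \<Rightarrow> ('o \<times> 'm \<times> 'm) \<Rightarrow> bool" where
  "frac_eq = (\<lambda>(W, s, f) (W', s', f'). \<exists>V. \<exists>u \<in> Hm V W. \<exists>v \<in> Hm V W'.
     s \<odot> u \<in> Q \<and> s \<odot> u = s' \<odot> v \<and> f \<odot> u = f' \<odot> v)"

lemma frac_eqE:
  assumes "frac_eq (W, s, f) (W', s', f')" "frac X Y (W, s, f)" "frac X Y (W', s', f')"
  obtains V u v where "u \<in> Hm V W" "v \<in> Hm V W'" "u \<in> Q" "v \<in> Q" "s \<odot> u = s' \<odot> v" "f \<odot> u = f' \<odot> v"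
proof -
  obtain V u v where *: "u \<in> Hm V W" "v \<in> Hm V W'" "s \<odot> u \<in> Q" "s \<odot> u = s' \<odot> v" "f \<odot> u = f' \<odot> v"
    using assms(1) unfolding frac_eq_def by auto
  have "s \<in> Hm W X" "s \<in> Q" "s' \<in> Hm W' X" "s' \<in> Q" using assms(2,3) unfolding frac_def by auto
  then have "u \<in> Q" "v \<in> Q" using Q_comp[OF *(1)] Q_comp[OF *(2)] *(3,4) by metis+
  then show ?thesis using that * by blast
qed

lemma frac_eqI:
  assumes "frac X Y (W, s, f)" "u \<in> Hm V W" "v \<in> Hm V W'" "u \<in> Q" "s \<odot> u = s' \<odot> v" "f \<odot> u = f' \<odot> v"
  shows "frac_eq (W, s, f) (W', s', f')"
proof -
  have "s \<odot> u \<in> Q" using assms(1,2,4) Q_comp[of u V W s X] unfolding frac_def by auto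
  then show ?thesis using assms(2,3,5,6) unfolding frac_eq_def case_prod_conv by blast
qed

lemma frac_eq_refl: 
  assumes "frac X Y a" shows "frac_eq a a"
proof -
  obtain W s f where a: "a = (W, s, f)" by (cases a)
  have "W \<in> Ob" using assms Hm_Ob unfolding a frac_def by auto
  then show ?thesis using frac_eqI[of X Y W s f "I W" W "I W" W s f] assms I_Hm I_Q unfolding a by auto
qed

lemma frac_eq_sym: "frac_eq a b \<Longrightarrow> frac_eq b a"
  unfolding frac_eq_def by auto metis

text \<open>The two common refinements are refined once more by the Ore condition over the middle apex.\<close>

lemma frac_eq_trans:
  assumes "frac_eq a b" "frac_eq b c" "frac X Y a" "frac X Y b" "frac X Y c"
  shows "frac_eq a c"
proof -
  obtain W s f where a: "a = (W, s, f)" by (cases a)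
  obtain W' s' f' where b: "b = (W', s', f')" by (cases b)
  obtain W'' s'' f'' where c: "c = (W'', s'', f'')" by (cases c)
  obtain V u v where uv: "u \<in> Hm V W" "v \<in> Hm V W'" "u \<in> Q" "v \<in> Q" "s \<odot> u = s' \<odot> v" "f \<odot> u = f' \<odot> v"
    using frac_eqE assms(1,3,4) unfolding a b by metis
  obtain V' u' v' where uv': "u' \<in> Hm V' W'" "v' \<in> Hm V' W''" "u' \<in> Q" "v' \<in> Q" "s' \<odot> u' = s'' \<odot> v'"
    "f' \<odot> u' = f'' \<odot> v'"
    using frac_eqE assms(2,4,5) unfolding b c by metis
  obtain P t g where P: "t \<in> Hm P V" "t \<in> Q" "g \<in> Hm P V'" "v \<odot> t = u' \<odot> g"
    using ore[OF uv(2) uv'(1,3)] by blast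
  show ?thesis unfolding a c
  proof (rule frac_eqI)
    show "frac X Y (W, s, f)" using assms(3) a by simp
    show "u \<odot> t \<in> Hm P W" "v' \<odot> g \<in> Hm P W''" using comp_Hm P uv uv' by blast+
    show "u \<odot> t \<in> Q" using Q_comp[OF P(1) uv(1,3)] P(2) by simp
    show "s \<odot> u \<odot> t = s'' \<odot> v' \<odot> g" "f \<odot> u \<odot> t = f'' \<odot> v' \<odot> g"
      using P(4) uv(5,6) uv'(5,6) assoc by metis+
  qed
qed

lemma frac_comp:
  assumes "frac X Y (W, s, f)" "frac Y Z (V, t, g)" "p \<in> Hm U W" "p \<in> Q" "q \<in> Hm U V"
  shows "frac X Z (U, s \<odot> p, g \<odot> q)"
  using assms(1,2) comp_Hm[OF assms(3)] comp_Hm[OF assms(5)] Q_comp[OF assms(3)] assms(4)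
  unfolding frac_def by auto

text \<open>Two composites formed from equivalent fractions with arbitrary choices of Ore squares are
equivalent. Both are first pulled back to a common refinement \<open>S\<close> of their apexes. The resulting maps
to \<open>V\<close> and \<open>V'\<close> agree after composition with \<open>t\<close> and \<open>t'\<close>; the Ore condition and cancellation make
them agree on a further refinement.\<close>

lemma frac_comp_well_defined:
  assumes a: "frac X Y (W, s, f)" and b: "frac Y Z (V, t, g)"
    and a': "frac X Y (W', s', f')" and b': "frac Y Z (V', t', g')"
    and p: "p \<in> Hm U W" "p \<in> Q" "q \<in> Hm U V" "f \<odot> p = t \<odot> q"
    and p': "p' \<in> Hm U' W'" "p' \<in> Q" "q' \<in> Hm U' V'" "f' \<odot> p' = t' \<odot> q'"
    and aa: "frac_eq (W, s, f) (W', s', f')" and bb: "frac_eq (V, t, g) (V', t', g')"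
  shows "frac_eq (U, s \<odot> p, g \<odot> q) (U', s' \<odot> p', g' \<odot> q')"
proof -
  obtain K u u' where u: "u \<in> Hm K W" "u' \<in> Hm K W'" "u \<in> Q" "u' \<in> Q" "s \<odot> u = s' \<odot> u'" "f \<odot> u = f' \<odot> u'"
    using frac_eqE[OF aa a a'] by metis
  obtain L v v' where v: "v \<in> Hm L V" "v' \<in> Hm L V'" "v \<in> Q" "v' \<in> Q" "t \<odot> v = t' \<odot> v'" "g \<odot> v = g' \<odot> v'"
    using frac_eqE[OF bb b b'] by metis
  obtain S0 s0 c0 where S0: "s0 \<in> Hm S0 K" "s0 \<in> Q" "c0 \<in> Hm S0 U" "u \<odot> s0 = p \<odot> c0"
    using ore[OF u(1) p(1,2)] by blast
  obtain S r c' where S: "r \<in> Hm S S0" "r \<in> Q" "c' \<in> Hm S U'" "(u' \<odot> s0) \<odot> r = p' \<odot> c'"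
    using ore[OF comp_Hm[OF S0(1) u(2)] p'(1,2)] by blast
  define c where "c = c0 \<odot> r"
  define z where "z = s0 \<odot> r"
  have c: "c \<in> Hm S U" and z: "z \<in> Hm S K" "z \<in> Q"
    using S0 S comp_Hm Q_comp unfolding c_def z_def by blast+
  have pc: "p \<odot> c = u \<odot> z" "p' \<odot> c' = u' \<odot> z"
    using S0 S unfolding c_def z_def by (metis assoc)+
  have cQ: "c \<in> Q" "c' \<in> Q"
    using Q_comp[OF c p(1,2)] Q_comp[OF S(3) p'(1,2)] Q_comp[OF z(1) u(1,3)] Q_comp[OF z(1) u(2,4)] pc z(2)
    by auto
  have tq: "t \<odot> (q \<odot> c) = t' \<odot> (q' \<odot> c')"
  proof -
    have "t \<odot> (q \<odot> c) = f \<odot> (p \<odot> c)" using p(4) assoc by metis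
    also have "\<dots> = f' \<odot> (p' \<odot> c')" unfolding pc using u(6) assoc by metis
    also have "\<dots> = t' \<odot> (q' \<odot> c')" using p'(4) assoc by metis
    finally show ?thesis .
  qed
  have t: "t \<in> Hm V Y" "t \<in> Q" and t': "t' \<in> Hm V' Y" "t' \<in> Q" and s: "s \<in> Hm W X"
    using a b b' unfolding frac_def by auto
  obtain T m w where T: "m \<in> Hm T S" "m \<in> Q" "w \<in> Hm T L" "(q \<odot> c) \<odot> m = v \<odot> w"
    using ore[OF comp_Hm[OF c p(3)] v(1,3)] by blast
  have "t' \<odot> (v' \<odot> w) = t' \<odot> ((q' \<odot> c') \<odot> m)"
    using tq T(4) v(5) assoc by metis
  then obtain T' n where n: "n \<in> Hm T' T" "n \<in> Q" "(v' \<odot> w) \<odot> n = ((q' \<odot> c') \<odot> m) \<odot> n"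
    using cancel[OF comp_Hm[OF T(3) v(2)] comp_Hm[OF T(1) comp_Hm[OF S(3) p'(3)]] t'] by blast
  have k: "m \<odot> n \<in> Hm T' S" "m \<odot> n \<in> Q" using comp_Hm[OF n(1) T(1)] Q_comp[OF n(1) T(1,2)] n(2) by auto
  show ?thesis
  proof (rule frac_eqI)
    show "frac X Z (U, s \<odot> p, g \<odot> q)" by (rule frac_comp[OF a b p(1-3)])
    show "c \<odot> m \<odot> n \<in> Hm T' U" "c' \<odot> m \<odot> n \<in> Hm T' U'" using comp_Hm[OF k(1)] c S(3) by blast+
    show "c \<odot> m \<odot> n \<in> Q" using Q_comp[OF k(1) c cQ(1)] k(2) by simp
    show "(s \<odot> p) \<odot> c \<odot> m \<odot> n = (s' \<odot> p') \<odot> c' \<odot> m \<odot> n"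
    proof -
      have "s \<odot> (p \<odot> c) = s' \<odot> (p' \<odot> c')" unfolding pc using u(5) assoc by metis
      then show ?thesis by (metis assoc)
    qed
    show "(g \<odot> q) \<odot> c \<odot> m \<odot> n = (g' \<odot> q') \<odot> c' \<odot> m \<odot> n"
    proof -
      have "(g \<odot> q) \<odot> c \<odot> m \<odot> n = g \<odot> ((q \<odot> c) \<odot> m) \<odot> n" by (simp add: assoc)
      also have "\<dots> = (g \<odot> v) \<odot> (w \<odot> n)" unfolding T(4) by (simp add: assoc)
      also have "\<dots> = g' \<odot> ((v' \<odot> w) \<odot> n)" unfolding v(6) by (simp add: assoc)
      also have "\<dots> = (g' \<odot> q') \<odot> c' \<odot> m \<odot> n" unfolding n(3) by (simp add: assoc)
      finally show ?thesis .
    qed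
  qed
qed

lemma frac_eq_refine:
  assumes "frac X Y (W, s, f)" "p \<in> Hm U W" "p \<in> Q"
  shows "frac_eq (W, s, f) (U, s \<odot> p, f \<odot> p)"
proof (rule frac_eqI[OF assms(1,2) _ assms(3)])
  show "I U \<in> Hm U U" using I_Hm Hm_Ob assms(2) by blast
  show "s \<odot> p = (s \<odot> p) \<odot> I U" "f \<odot> p = (f \<odot> p) \<odot> I U"
    using comp_I[OF assms(2)] by (simp_all add: assoc)
qed

end

section \<open>Morphisms of the derived category as fractions\<close>

text \<open>Arrows of the homotopy category are homotopy classes tagged with source and target. The composite
of sets that do not match is empty, so that composition is associative without conditions.\<close>

definition hclass :: "('a, 'k::field) kalgebra \<Rightarrow> ('a, 'k) cpx \<Rightarrow> ('a, 'k) cpx \<Rightarrow> 'k cmap \<Rightarrow>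
    (('a, 'k) cpx \<times> 'k cmap \<times> ('a, 'k) cpx) set" where
  "hclass A X Y f = {(X, k, Y) | k. k \<in> cpx_hom A X Y \<and> homotopic_maps A X Y f k}"

definition hhom :: "('a, 'k::field) kalgebra \<Rightarrow> ('a, 'k) cpx \<Rightarrow> ('a, 'k) cpx \<Rightarrow>
    (('a, 'k) cpx \<times> 'k cmap \<times> ('a, 'k) cpx) set set" where
  "hhom A X Y = hclass A X Y ` cpx_hom A X Y"

definition hcomp :: "('a, 'k::field) kalgebra \<Rightarrow> (('a, 'k) cpx \<times> 'k cmap \<times> ('a, 'k) cpx) set \<Rightarrow>
    (('a, 'k) cpx \<times> 'k cmap \<times> ('a, 'k) cpx) set \<Rightarrow> (('a, 'k) cpx \<times> 'k cmap \<times> ('a, 'k) cpx) set" where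
  "hcomp A G F = {(X, k, Z). k \<in> cpx_hom A X Z \<and> (\<exists>Y f g. (X, f, Y) \<in> F \<and> (Y, g, Z) \<in> G \<and>
     f \<in> cpx_hom A X Y \<and> g \<in> cpx_hom A Y Z \<and> homotopic_maps A X Z (cmap_comp g f) k)}"

definition hqis :: "('a, 'k::field) kalgebra \<Rightarrow> (('a, 'k) cpx \<times> 'k cmap \<times> ('a, 'k) cpx) set set" where
  "hqis A = {hclass A X Y f | X Y f. f \<in> cpx_hom A X Y \<and> quasi_iso X Y f}"

lemma hclass_self: "f \<in> cpx_hom A X Y \<Longrightarrow> (X, f, Y) \<in> hclass A X Y f"
  by (auto simp: hclass_def homotopic_refl)

lemma hclass_eq_iff:
  assumes f: "f \<in> cpx_hom A X Y" and g: "g \<in> cpx_hom A X Y"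
  shows "hclass A X Y f = hclass A X Y g \<longleftrightarrow> homotopic_maps A X Y f g"
proof
  assume "hclass A X Y f = hclass A X Y g"
  then have "(X, g, Y) \<in> hclass A X Y f" using hclass_self[OF g] by simp
  then show "homotopic_maps A X Y f g" by (simp add: hclass_def)
next
  assume "homotopic_maps A X Y f g"
  then show "hclass A X Y f = hclass A X Y g"
    unfolding hclass_def using homotopic_trans homotopic_sym f g by blast
qed

lemma hclass_eqD:
  assumes "hclass A X Y f = hclass A X' Y' g" "f \<in> cpx_hom A X Y"
  shows "X' = X" "Y' = Y"
proof -
  have "(X, f, Y) \<in> hclass A X' Y' g" using hclass_self[OF assms(2)] assms(1) by simp
  then show "X' = X" "Y' = Y" by (auto simp: hclass_def)
qed

lemma hcompI:
  assumes "(X, f, Y) \<in> F" "(Y, g, Z) \<in> G" "f \<in> cpx_hom A X Y" "g \<in> cpx_hom A Y Z"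
    "k \<in> cpx_hom A X Z" "homotopic_maps A X Z (cmap_comp g f) k"
  shows "(X, k, Z) \<in> hcomp A G F"
  using assms unfolding hcomp_def by blast

lemma hcomp_hclass:
  assumes f: "f \<in> cpx_hom A X Y" and g: "g \<in> cpx_hom A Y Z"
  shows "hcomp A (hclass A Y Z g) (hclass A X Y f) = hclass A X Z (cmap_comp g f)"
proof (intro Set.set_eqI iffI)
  note gf = cmap_comp_in_cpx_hom[OF f g]
  fix x assume "x \<in> hcomp A (hclass A Y Z g) (hclass A X Y f)"
  then obtain k f' g' where x: "x = (X, k, Z)" "k \<in> cpx_hom A X Z" "f' \<in> cpx_hom A X Y" "g' \<in> cpx_hom A Y Z"
    "homotopic_maps A X Y f f'" "homotopic_maps A Y Z g g'" "homotopic_maps A X Z (cmap_comp g' f') k"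
    by (auto simp: hcomp_def hclass_def)
  have "homotopic_maps A X Z (cmap_comp g f) (cmap_comp g f')"
    using homotopic_comp_left[OF x(5) f x(3) g] .
  moreover have "homotopic_maps A X Z (cmap_comp g f') (cmap_comp g' f')"
    using homotopic_comp_right[OF x(6) g x(4) x(3)] .
  ultimately have "homotopic_maps A X Z (cmap_comp g f) k"
    using homotopic_trans[OF homotopic_trans x(7)] gf x(2) cmap_comp_in_cpx_hom[OF x(3) g]
      cmap_comp_in_cpx_hom[OF x(3,4)] by blast
  then show "x \<in> hclass A X Z (cmap_comp g f)" using x by (auto simp: hclass_def)
next
  fix x assume "x \<in> hclass A X Z (cmap_comp g f)"
  then obtain k where k: "x = (X, k, Z)" "k \<in> cpx_hom A X Z" "homotopic_maps A X Z (cmap_comp g f) k"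
    by (auto simp: hclass_def)
  show "x \<in> hcomp A (hclass A Y Z g) (hclass A X Y f)"
    unfolding k(1) by (rule hcompI[OF hclass_self[OF f] hclass_self[OF g] f g k(2,3)])
qed

lemma hcomp_assoc: "hcomp A (hcomp A H G) F = hcomp A H (hcomp A G F)"
proof (intro Set.set_eqI iffI)
  fix x assume "x \<in> hcomp A (hcomp A H G) F"
  then obtain X k W Y f l Z g h where x: "x = (X, k, W)" "k \<in> cpx_hom A X W" "(X, f, Y) \<in> F" "f \<in> cpx_hom A X Y"
    "l \<in> cpx_hom A Y W" "homotopic_maps A X W (cmap_comp l f) k" "(Y, g, Z) \<in> G" "(Z, h, W) \<in> H"
    "g \<in> cpx_hom A Y Z" "h \<in> cpx_hom A Z W" "homotopic_maps A Y W (cmap_comp h g) l"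
    by (auto simp: hcomp_def)
  note gf = cmap_comp_in_cpx_hom[OF x(4,9)] and hg = cmap_comp_in_cpx_hom[OF x(9,10)]
  have "homotopic_maps A X W (cmap_comp (cmap_comp h g) f) k"
    using homotopic_trans[OF homotopic_comp_right[OF x(11) hg x(5,4)] x(6)]
      cmap_comp_in_cpx_hom[OF x(4) hg] cmap_comp_in_cpx_hom[OF x(4,5)] x(2) by blast
  then have "homotopic_maps A X W (cmap_comp h (cmap_comp g f)) k"
    using cmap_comp_assoc[OF x(4,9,10)] by simp
  moreover have "(X, cmap_comp g f, Z) \<in> hcomp A G F"
    using hcompI[OF x(3,7,4,9) gf homotopic_refl[OF gf]] .
  ultimately show "x \<in> hcomp A H (hcomp A G F)"
    unfolding x(1) using hcompI[OF _ x(8) gf x(10,2)] by blast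
next
  fix x assume "x \<in> hcomp A H (hcomp A G F)"
  then obtain X k W Y f l Z g h where x: "x = (X, k, W)" "k \<in> cpx_hom A X W" "(X, f, Y) \<in> F" "f \<in> cpx_hom A X Y"
    "l \<in> cpx_hom A X Z" "homotopic_maps A X W (cmap_comp h l) k" "(Y, g, Z) \<in> G" "(Z, h, W) \<in> H"
    "g \<in> cpx_hom A Y Z" "h \<in> cpx_hom A Z W" "homotopic_maps A X Z (cmap_comp g f) l"
    by (auto simp: hcomp_def)
  note gf = cmap_comp_in_cpx_hom[OF x(4,9)] and hg = cmap_comp_in_cpx_hom[OF x(9,10)]
  have "homotopic_maps A X W (cmap_comp h (cmap_comp g f)) k"
    using homotopic_trans[OF homotopic_comp_left[OF x(11) gf x(5,10)] x(6)]
      cmap_comp_in_cpx_hom[OF gf x(10)] cmap_comp_in_cpx_hom[OF x(5,10)] x(2) by blast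
  then have "homotopic_maps A X W (cmap_comp (cmap_comp h g) f) k"
    using cmap_comp_assoc[OF x(4,9,10)] by simp
  moreover have "(Y, cmap_comp h g, W) \<in> hcomp A H G"
    using hcompI[OF x(7,8,9,10) hg homotopic_refl[OF hg]] .
  ultimately show "x \<in> hcomp A (hcomp A H G) F"
    unfolding x(1) using hcompI[OF x(3) _ x(4) hg x(2)] by blast
qed

lemma hclass_in_hqis:
  assumes f: "f \<in> cpx_hom A X Y"
  shows "hclass A X Y f \<in> hqis A \<longleftrightarrow> quasi_iso X Y f"
proof
  assume "hclass A X Y f \<in> hqis A"
  then obtain X' Y' g where g: "hclass A X Y f = hclass A X' Y' g" "g \<in> cpx_hom A X' Y'" "quasi_iso X' Y' g"
    by (auto simp: hqis_def)
  have [simp]: "X' = X" "Y' = Y" using hclass_eqD[OF g(1) f] by auto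
  have "homotopic_maps A X Y f g" using g(1,2) hclass_eq_iff[OF f, of g] by simp
  then show "quasi_iso X Y f" using quasi_iso_homotopic[OF _ f] g by simp
qed (use f in \<open>auto simp: hqis_def\<close>)

lemma hhomE:
  assumes "F \<in> hhom A X Y" obtains f where "f \<in> cpx_hom A X Y" "F = hclass A X Y f"
  using assms by (auto simp: hhom_def)

lemma hclass_in_hhom: 
  assumes "f \<in> cpx_hom A X Y"
  shows "hclass A X Y f \<in> hhom A X Y"
  using assms by (auto simp: hhom_def)

text \<open>The homotopy category with its quasi-isomorphisms is an instance: \<open>ore\<close> and \<open>cancel_quasi_iso\<close>
are the two substantial axioms.\<close>

lemma right_fractions_homotopy:
  "right_fractions {X. bdd_complex A X} (hhom A) (hcomp A) (\<lambda>X. hclass A X X (cmap_id X)) (hqis A)"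
proof
  fix X Y Z :: "('a, 'b) cpx"
  show "hcomp A (hcomp A h g) f = hcomp A h (hcomp A g f)" for f g h by (rule hcomp_assoc)
  show "f \<in> hhom A X Y \<Longrightarrow> g \<in> hhom A Y Z \<Longrightarrow> hcomp A g f \<in> hhom A X Z" for f g
    by (elim hhomE) (simp add: hcomp_hclass cmap_comp_in_cpx_hom hclass_in_hhom)
  show "f \<in> hhom A X Y \<Longrightarrow> X \<in> {X. bdd_complex A X} \<and> Y \<in> {X. bdd_complex A X}" for f
    by (auto elim!: hhomE simp: cpx_hom_def)
  show "X \<in> {X. bdd_complex A X} \<Longrightarrow> hclass A X X (cmap_id X) \<in> hhom A X X"
    by (simp add: hclass_in_hhom cmap_id_in_cpx_hom)
  show "X \<in> {X. bdd_complex A X} \<Longrightarrow> hclass A X X (cmap_id X) \<in> hqis A"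
    by (simp add: hclass_in_hqis cmap_id_in_cpx_hom quasi_iso_id)
  show "f \<in> hhom A X Y \<Longrightarrow> hcomp A f (hclass A X X (cmap_id X)) = f \<and> hcomp A (hclass A Y Y (cmap_id Y)) f = f" for f
    by (elim hhomE, frule cpx_homD(1), frule cpx_homD(2)) (simp add: hcomp_hclass cmap_id_in_cpx_hom)
  show "f \<in> hhom A X Y \<Longrightarrow> g \<in> hhom A Y Z \<Longrightarrow> g \<in> hqis A \<Longrightarrow> (hcomp A g f \<in> hqis A) = (f \<in> hqis A)" for f g
    by (elim hhomE) (simp add: hcomp_hclass hclass_in_hqis cmap_comp_in_cpx_hom quasi_iso_comp_iff)
  show "\<exists>P. \<exists>t\<in>hhom A P X \<inter> hqis A. \<exists>g\<in>hhom A P Y. hcomp A f t = hcomp A s g"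
    if f: "f \<in> hhom A X Z" and s: "s \<in> hhom A Y Z" and q: "s \<in> hqis A" for f s
  proof -
    obtain f0 where f0: "f0 \<in> cpx_hom A X Z" "f = hclass A X Z f0" using f by (rule hhomE)
    obtain s0 where s0: "s0 \<in> cpx_hom A Y Z" "s = hclass A Y Z s0" using s by (rule hhomE)
    have "quasi_iso Y Z s0" using q s0 hclass_in_hqis by metis
    then obtain P t g where t: "t \<in> cpx_hom A P X" "quasi_iso P X t" and g: "g \<in> cpx_hom A P Y"
      and e: "homotopic_maps A P Z (cmap_comp f0 t) (cmap_comp s0 g)"
      using ore[OF f0(1) s0(1)] by metis
    have "hclass A P X t \<in> hhom A P X \<inter> hqis A" "hclass A P Y g \<in> hhom A P Y"
      using t g by (auto simp: hclass_in_hhom hclass_in_hqis)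
    moreover have "hcomp A f (hclass A P X t) = hcomp A s (hclass A P Y g)"
      using f0 s0 t g e by (simp add: hcomp_hclass hclass_eq_iff cmap_comp_in_cpx_hom)
    ultimately show ?thesis by blast
  qed
  show "\<exists>P. \<exists>t\<in>hhom A P X \<inter> hqis A. hcomp A u t = hcomp A v t"
    if u: "u \<in> hhom A X Y" and v: "v \<in> hhom A X Y" and s: "s \<in> hhom A Y Z" and q: "s \<in> hqis A"
      and eq: "hcomp A s u = hcomp A s v" for u v s
  proof -
    obtain u0 where u0: "u0 \<in> cpx_hom A X Y" "u = hclass A X Y u0" using u by (rule hhomE)
    obtain v0 where v0: "v0 \<in> cpx_hom A X Y" "v = hclass A X Y v0" using v by (rule hhomE)
    obtain s0 where s0: "s0 \<in> cpx_hom A Y Z" "s = hclass A Y Z s0" using s by (rule hhomE)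
    have qs: "quasi_iso Y Z s0" using q s0 hclass_in_hqis by metis
    have "homotopic_maps A X Z (cmap_comp s0 u0) (cmap_comp s0 v0)"
      using eq u0 v0 s0 by (simp add: hcomp_hclass hclass_eq_iff cmap_comp_in_cpx_hom)
    then obtain P t where t: "t \<in> cpx_hom A P X" "quasi_iso P X t"
      and e: "homotopic_maps A P Y (cmap_comp u0 t) (cmap_comp v0 t)"
      using cancel_quasi_iso[OF u0(1) v0(1) s0(1) qs] by metis
    have "hclass A P X t \<in> hhom A P X \<inter> hqis A" using t by (auto simp: hclass_in_hhom hclass_in_hqis)
    moreover have "hcomp A u (hclass A P X t) = hcomp A v (hclass A P X t)"
      using u0 v0 t e by (simp add: hcomp_hclass hclass_eq_iff cmap_comp_in_cpx_hom)
    ultimately show ?thesis by blast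
  qed
qed

interpretation K: right_fractions "{X. bdd_complex A X}" "hhom A" "hcomp A" "\<lambda>X. hclass A X X (cmap_id X)" "hqis A"
  for A :: "('a, 'k::field) kalgebra"
  by (rule right_fractions_homotopy)

text \<open>The dictionary between roofs and fractions; it identifies equivalence of roofs with that of fractions.\<close>

definition frac_of :: "('a, 'k::field) kalgebra \<Rightarrow> ('a, 'k) roof \<Rightarrow> _" where
  "frac_of A \<rho> = (apex \<rho>, hclass A (apex \<rho>) (src \<rho>) (bleg \<rho>), hclass A (apex \<rho>) (tgt \<rho>) (fleg \<rho>))"

lemma is_roof_iff:
  "is_roof A \<rho> \<longleftrightarrow> bleg \<rho> \<in> cpx_hom A (apex \<rho>) (src \<rho>) \<and> quasi_iso (apex \<rho>) (src \<rho>) (bleg \<rho>) \<and>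
     fleg \<rho> \<in> cpx_hom A (apex \<rho>) (tgt \<rho>)"
  by (auto simp: is_roof_def cpx_hom_def)

lemma frac_frac_of: "is_roof A \<rho> \<Longrightarrow> K.frac A (src \<rho>) (tgt \<rho>) (frac_of A \<rho>)"
  by (simp add: K.frac_def frac_of_def is_roof_iff hclass_in_hqis hclass_in_hhom)

lemma roof_equiv_cpx_hom:
  assumes "is_roof A \<rho>" "is_roof A \<sigma>"
  shows "roof_equiv A \<rho> \<sigma> \<longleftrightarrow> src \<rho> = src \<sigma> \<and> tgt \<rho> = tgt \<sigma> \<and>
     (\<exists>W. \<exists>u \<in> cpx_hom A W (apex \<rho>). \<exists>v \<in> cpx_hom A W (apex \<sigma>).
        quasi_iso W (src \<rho>) (cmap_comp (bleg \<rho>) u) \<and>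
        homotopic_maps A W (src \<rho>) (cmap_comp (bleg \<rho>) u) (cmap_comp (bleg \<sigma>) v) \<and>
        homotopic_maps A W (tgt \<rho>) (cmap_comp (fleg \<rho>) u) (cmap_comp (fleg \<sigma>) v))"
proof -
  have "bdd_complex A (apex \<rho>)" "bdd_complex A (apex \<sigma>)"
    using assms by (simp_all add: is_roof_def)
  then show ?thesis by (simp add: roof_equiv_def cpx_hom_def Bex_def) blast
qed

lemma roof_equiv_iff:
  assumes "is_roof A \<rho>" "is_roof A \<sigma>"
  shows "roof_equiv A \<rho> \<sigma> \<longleftrightarrow> src \<rho> = src \<sigma> \<and> tgt \<rho> = tgt \<sigma> \<and> K.frac_eq A (frac_of A \<rho>) (frac_of A \<sigma>)"
proof (cases "src \<rho> = src \<sigma> \<and> tgt \<rho> = tgt \<sigma>")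
  case True
  note r = assms(1)[unfolded is_roof_iff] and s = assms(2)[unfolded is_roof_iff]
  have "roof_equiv A \<rho> \<sigma> \<longleftrightarrow> (\<exists>W. \<exists>u \<in> cpx_hom A W (apex \<rho>). \<exists>v \<in> cpx_hom A W (apex \<sigma>).
        quasi_iso W (src \<rho>) (cmap_comp (bleg \<rho>) u) \<and>
        homotopic_maps A W (src \<rho>) (cmap_comp (bleg \<rho>) u) (cmap_comp (bleg \<sigma>) v) \<and>
        homotopic_maps A W (tgt \<rho>) (cmap_comp (fleg \<rho>) u) (cmap_comp (fleg \<sigma>) v))"
    using True roof_equiv_cpx_hom[OF assms] by simp
  also have "\<dots> \<longleftrightarrow> (\<exists>W. \<exists>u \<in> cpx_hom A W (apex \<rho>). \<exists>v \<in> cpx_hom A W (apex \<sigma>).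
        hcomp A (hclass A (apex \<rho>) (src \<rho>) (bleg \<rho>)) (hclass A W (apex \<rho>) u) \<in> hqis A \<and>
        hcomp A (hclass A (apex \<rho>) (src \<rho>) (bleg \<rho>)) (hclass A W (apex \<rho>) u) =
        hcomp A (hclass A (apex \<sigma>) (src \<sigma>) (bleg \<sigma>)) (hclass A W (apex \<sigma>) v) \<and>
        hcomp A (hclass A (apex \<rho>) (tgt \<rho>) (fleg \<rho>)) (hclass A W (apex \<rho>) u) =
        hcomp A (hclass A (apex \<sigma>) (tgt \<sigma>) (fleg \<sigma>)) (hclass A W (apex \<sigma>) v))"
    using r s True
    by (intro ex_cong1 bex_cong refl) (simp add: hcomp_hclass hclass_in_hqis hclass_eq_iff cmap_comp_in_cpx_hom)
  also have "\<dots> \<longleftrightarrow> K.frac_eq A (frac_of A \<rho>) (frac_of A \<sigma>)"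
    by (simp add: K.frac_eq_def frac_of_def hhom_def)
  finally show ?thesis using True by simp
qed (auto simp: roof_equiv_def)

lemma roof_equiv_refl: "is_roof A \<rho> \<Longrightarrow> roof_equiv A \<rho> \<rho>"
  using roof_equiv_iff[of A \<rho> \<rho>] K.frac_eq_refl[OF frac_frac_of] by blast

lemma roof_equiv_sym:
  assumes "roof_equiv A \<rho> \<sigma>" "is_roof A \<rho>" "is_roof A \<sigma>"
  shows "roof_equiv A \<sigma> \<rho>"
  using assms(1) roof_equiv_iff[OF assms(2,3)] roof_equiv_iff[OF assms(3,2)]
    K.frac_eq_sym[of A "frac_of A \<rho>" "frac_of A \<sigma>"] by simp

lemma roof_equiv_trans:
  assumes "roof_equiv A \<rho> \<sigma>" "roof_equiv A \<sigma> \<tau>" "is_roof A \<rho>" "is_roof A \<sigma>" "is_roof A \<tau>"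
  shows "roof_equiv A \<rho> \<tau>"
proof -
  have s: "src \<sigma> = src \<rho>" "tgt \<sigma> = tgt \<rho>" "src \<tau> = src \<rho>" "tgt \<tau> = tgt \<rho>"
    and "K.frac_eq A (frac_of A \<rho>) (frac_of A \<sigma>)" "K.frac_eq A (frac_of A \<sigma>) (frac_of A \<tau>)"
    using assms(1,2) roof_equiv_iff[OF assms(3,4)] roof_equiv_iff[OF assms(4,5)] by simp_all
  then have "K.frac_eq A (frac_of A \<rho>) (frac_of A \<tau>)"
    using K.frac_eq_trans frac_frac_of[OF assms(3)] frac_frac_of[OF assms(4)] frac_frac_of[OF assms(5)]
    by (simp only: s) blast
  then show ?thesis using s roof_equiv_iff[OF assms(3,5)] by simp
qed

lemma roof_class_eq_iff:
  assumes "is_roof A \<rho>" "is_roof A \<sigma>"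
  shows "roof_class A \<rho> = roof_class A \<sigma> \<longleftrightarrow> roof_equiv A \<rho> \<sigma>"
proof
  assume "roof_class A \<rho> = roof_class A \<sigma>"
  moreover have "\<sigma> \<in> roof_class A \<sigma>"
    using assms(2) roof_equiv_refl[OF assms(2)] by (simp add: roof_class_def)
  ultimately have "\<sigma> \<in> roof_class A \<rho>" by simp
  then show "roof_equiv A \<rho> \<sigma>" by (simp add: roof_class_def)
next
  assume e: "roof_equiv A \<rho> \<sigma>"
  have "roof_equiv A \<rho> \<tau> \<longleftrightarrow> roof_equiv A \<sigma> \<tau>" if "is_roof A \<tau>" for \<tau>
    using roof_equiv_trans[OF e _ assms that]
      roof_equiv_trans[OF roof_equiv_sym[OF e assms] _ assms(2,1) that] by blast
  then show "roof_class A \<rho> = roof_class A \<sigma>"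
    unfolding roof_class_def by blast
qed

text \<open>Every morphism of the derived category has the form \<open>frc A X Y W s f\<close>, the class of a roof
\<open>X \<leftarrow> W \<rightarrow> Y\<close>. All later statements about morphisms are phrased with such representatives.\<close>

definition frc :: "('a, 'k::field) kalgebra \<Rightarrow> ('a, 'k) cpx \<Rightarrow> ('a, 'k) cpx \<Rightarrow> ('a, 'k) cpx \<Rightarrow>
    'k cmap \<Rightarrow> 'k cmap \<Rightarrow> ('a, 'k) roof set" where
  "frc A X Y W s f = roof_class A \<lparr>src = X, apex = W, tgt = Y, bleg = s, fleg = f\<rparr>"

lemma der_homE:
  assumes "\<phi> \<in> der_hom A X Y"
  obtains W s f where "s \<in> cpx_hom A W X" "quasi_iso W X s" "f \<in> cpx_hom A W Y" "\<phi> = frc A X Y W s f"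
proof -
  obtain \<rho> where \<rho>: "\<phi> = roof_class A \<rho>" "is_roof A \<rho>" "src \<rho> = X" "tgt \<rho> = Y"
    using assms by (auto simp: der_hom_def)
  have e: "\<rho> = \<lparr>src = X, apex = apex \<rho>, tgt = Y, bleg = bleg \<rho>, fleg = fleg \<rho>\<rparr>"
    using \<rho>(3,4) by (cases \<rho>) auto
  have *: "\<phi> = frc A X Y (apex \<rho>) (bleg \<rho>) (fleg \<rho>)"
    unfolding frc_def e[symmetric] by (rule \<rho>(1))
  show ?thesis
    by (rule that[OF _ _ _ *]) (use \<rho>(2-) in \<open>simp_all add: is_roof_iff\<close>)
qed

lemma frc_in_der_hom:
  "s \<in> cpx_hom A W X \<Longrightarrow> quasi_iso W X s \<Longrightarrow> f \<in> cpx_hom A W Y \<Longrightarrow> frc A X Y W s f \<in> der_hom A X Y"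
  unfolding der_hom_def frc_def
  by (rule CollectI, rule exI[of _ "\<lparr>src = X, apex = W, tgt = Y, bleg = s, fleg = f\<rparr>"])
     (simp add: is_roof_iff)

lemma frc_eq_iff:
  assumes "s \<in> cpx_hom A W X" "quasi_iso W X s" "f \<in> cpx_hom A W Y"
    and "s' \<in> cpx_hom A W' X" "quasi_iso W' X s'" "f' \<in> cpx_hom A W' Y"
  shows "frc A X Y W s f = frc A X Y W' s' f' \<longleftrightarrow>
    K.frac_eq A (W, hclass A W X s, hclass A W Y f) (W', hclass A W' X s', hclass A W' Y f')"
  using assms by (simp add: frc_def roof_class_eq_iff roof_equiv_iff is_roof_iff frac_of_def)

lemma frc_refine:
  assumes "s \<in> cpx_hom A W X" "quasi_iso W X s" "f \<in> cpx_hom A W Y"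
    and "t \<in> cpx_hom A V W" "quasi_iso V W t"
  shows "frc A X Y W s f = frc A X Y V (cmap_comp s t) (cmap_comp f t)"
proof -
  have "K.frac_eq A (W, hclass A W X s, hclass A W Y f) (V, hcomp A (hclass A W X s) (hclass A V W t), hcomp A (hclass A W Y f) (hclass A V W t))"
    by (rule K.frac_eq_refine[where X = X and Y = Y])
       (use assms in \<open>auto simp: K.frac_def hclass_in_hqis hclass_in_hhom\<close>)
  then show ?thesis
    using frc_eq_iff[OF assms(1-3) cmap_comp_in_cpx_hom[OF assms(4,1)] _ cmap_comp_in_cpx_hom[OF assms(4,3)]]
      quasi_iso_comp_iff[OF assms(4,1,2)] assms(5) hcomp_hclass[OF assms(4,1)] hcomp_hclass[OF assms(4,3)]
    by simp
qed

text \<open>The composite, defined as a union over all representatives and all Ore squares, is a single class that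
any one choice computes.\<close>

lemma der_comp_frc:
  assumes s: "s \<in> cpx_hom A W X" "quasi_iso W X s" and f: "f \<in> cpx_hom A W Y"
    and t: "t \<in> cpx_hom A V Y" "quasi_iso V Y t" and g: "g \<in> cpx_hom A V Z"
    and p: "p \<in> cpx_hom A U W" "quasi_iso U W p" and q: "q \<in> cpx_hom A U V"
    and e: "homotopic_maps A U Y (cmap_comp f p) (cmap_comp t q)"
  shows "der_comp A (frc A Y Z V t g) (frc A X Y W s f) = frc A X Z U (cmap_comp s p) (cmap_comp g q)"
proof (intro Set.set_eqI iffI)
  let ?\<rho> = "\<lparr>src = X, apex = W, tgt = Y, bleg = s, fleg = f\<rparr>"
  let ?\<sigma> = "\<lparr>src = Y, apex = V, tgt = Z, bleg = t, fleg = g\<rparr>"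
  let ?\<upsilon> = "\<lparr>src = X, apex = U, tgt = Z, bleg = cmap_comp s p, fleg = cmap_comp g q\<rparr>"
  have r: "is_roof A ?\<rho>" "is_roof A ?\<sigma>" "is_roof A ?\<upsilon>"
    using assms cmap_comp_in_cpx_hom[OF p(1) s(1)] cmap_comp_in_cpx_hom[OF q g]
      quasi_iso_comp_iff[OF p(1) s] by (simp_all add: is_roof_iff)
  {
    fix \<tau> assume "\<tau> \<in> frc A X Z U (cmap_comp s p) (cmap_comp g q)"
    moreover have "?\<rho> \<in> frc A X Y W s f" "?\<sigma> \<in> frc A Y Z V t g"
      using r roof_equiv_refl by (auto simp: frc_def roof_class_def)
    ultimately show "\<tau> \<in> der_comp A (frc A Y Z V t g) (frc A X Y W s f)"
      unfolding der_comp_def frc_def using p q e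
      by (intro CollectI bexI[of _ ?\<rho>] bexI[of _ ?\<sigma>] exI[of _ U] exI[of _ p] exI[of _ q])
         (auto simp: cpx_hom_def)
  }
  {
    fix \<tau> assume "\<tau> \<in> der_comp A (frc A Y Z V t g) (frc A X Y W s f)"
    then obtain \<rho>' \<sigma>' U' p' q' where \<rho>': "\<rho>' \<in> frc A X Y W s f" and \<sigma>': "\<sigma>' \<in> frc A Y Z V t g"
      and U': "bdd_complex A U'" and p': "p' \<in> chain_maps A U' (apex \<rho>')" "quasi_iso U' (apex \<rho>') p'"
      and q': "q' \<in> chain_maps A U' (apex \<sigma>')"
      and e': "homotopic_maps A U' (tgt \<rho>') (cmap_comp (fleg \<rho>') p') (cmap_comp (bleg \<sigma>') q')"
      and \<tau>: "\<tau> \<in> roof_class A \<lparr>src = src \<rho>', apex = U', tgt = tgt \<sigma>',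
           bleg = cmap_comp (bleg \<rho>') p', fleg = cmap_comp (fleg \<sigma>') q'\<rparr>" (is "_ \<in> roof_class A ?\<upsilon>'")
      unfolding der_comp_def by blast
    have r\<rho>: "is_roof A \<rho>'" "roof_equiv A ?\<rho> \<rho>'" and r\<sigma>: "is_roof A \<sigma>'" "roof_equiv A ?\<sigma> \<sigma>'"
      using \<rho>' \<sigma>' by (auto simp: frc_def roof_class_def)
    have sr: "src \<rho>' = X" "tgt \<rho>' = Y" "src \<sigma>' = Y" "tgt \<sigma>' = Z"
      using r\<rho>(2) r\<sigma>(2) by (auto simp: roof_equiv_def)
    note i = r\<rho>(1)[unfolded is_roof_iff sr] and j = r\<sigma>(1)[unfolded is_roof_iff sr]
    have p'': "p' \<in> cpx_hom A U' (apex \<rho>')" and q'': "q' \<in> cpx_hom A U' (apex \<sigma>')"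
      using U' p' q' i j by (auto simp: cpx_hom_def)
    have "is_roof A ?\<upsilon>'"
      using i j p'(2) sr cmap_comp_in_cpx_hom[OF p''] cmap_comp_in_cpx_hom[OF q'']
        quasi_iso_comp_iff[OF p''] by (simp add: is_roof_iff)
    moreover have "roof_equiv A ?\<upsilon> ?\<upsilon>'"
    proof -
      have 1: "K.frac A X Y (W, hclass A W X s, hclass A W Y f)" "K.frac A Y Z (V, hclass A V Y t, hclass A V Z g)"
        "K.frac A X Y (apex \<rho>', hclass A (apex \<rho>') X (bleg \<rho>'), hclass A (apex \<rho>') Y (fleg \<rho>'))"
        "K.frac A Y Z (apex \<sigma>', hclass A (apex \<sigma>') Y (bleg \<sigma>'), hclass A (apex \<sigma>') Z (fleg \<sigma>'))"
        using frac_frac_of[OF r(1)] frac_frac_of[OF r(2)] frac_frac_of[OF r\<rho>(1)] frac_frac_of[OF r\<sigma>(1)]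
        by (simp_all add: frac_of_def sr)
      have 2: "K.frac_eq A (W, hclass A W X s, hclass A W Y f) (apex \<rho>', hclass A (apex \<rho>') X (bleg \<rho>'), hclass A (apex \<rho>') Y (fleg \<rho>'))"
        "K.frac_eq A (V, hclass A V Y t, hclass A V Z g) (apex \<sigma>', hclass A (apex \<sigma>') Y (bleg \<sigma>'), hclass A (apex \<sigma>') Z (fleg \<sigma>'))"
        using r\<rho>(2) r\<sigma>(2) roof_equiv_iff[OF r(1) r\<rho>(1)] roof_equiv_iff[OF r(2) r\<sigma>(1)]
        by (simp_all add: frac_of_def sr)
      have "K.frac_eq A (U, hcomp A (hclass A W X s) (hclass A U W p), hcomp A (hclass A V Z g) (hclass A U V q))
        (U', hcomp A (hclass A (apex \<rho>') X (bleg \<rho>')) (hclass A U' (apex \<rho>') p'),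
           hcomp A (hclass A (apex \<sigma>') Z (fleg \<sigma>')) (hclass A U' (apex \<sigma>') q'))"
        by (rule K.frac_comp_well_defined[OF 1(1,2,3,4) _ _ _ _ _ _ _ _ 2])
           (use assms i j p'' p'(2) q'' e' sr in \<open>auto simp: hclass_in_hhom hclass_in_hqis hcomp_hclass hclass_eq_iff cmap_comp_in_cpx_hom\<close>)
      then show ?thesis
        using assms i j p'' q'' sr
        by (subst roof_equiv_iff[OF r(3) \<open>is_roof A ?\<upsilon>'\<close>]) (simp add: frac_of_def hcomp_hclass)
    qed
    ultimately have "roof_class A ?\<upsilon> = roof_class A ?\<upsilon>'"
      using roof_class_eq_iff[OF r(3)] by blast
    then show "\<tau> \<in> frc A X Z U (cmap_comp s p) (cmap_comp g q)"
      using \<tau> unfolding frc_def by simp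
  }
qed

lemma der_comp_frcE:
  assumes s: "s \<in> cpx_hom A W X" "quasi_iso W X s" and f: "f \<in> cpx_hom A W Y"
    and t: "t \<in> cpx_hom A V Y" "quasi_iso V Y t" and g: "g \<in> cpx_hom A V Z"
  obtains U p q where "p \<in> cpx_hom A U W" "quasi_iso U W p" "q \<in> cpx_hom A U V"
    "homotopic_maps A U Y (cmap_comp f p) (cmap_comp t q)"
    "der_comp A (frc A Y Z V t g) (frc A X Y W s f) = frc A X Z U (cmap_comp s p) (cmap_comp g q)"
proof -
  obtain U p q where *: "p \<in> cpx_hom A U W" "quasi_iso U W p" "q \<in> cpx_hom A U V"
    "homotopic_maps A U Y (cmap_comp f p) (cmap_comp t q)"
    by (rule ore[OF f t])
  then show ?thesis using that der_comp_frc[OF s f t g *] by blast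
qed

section \<open>Two-term silting subcategories and silting pairs\<close>

text \<open>Consequences of a zero object and of a suspension that is an automorphism, for the notions defined
from \<open>Hom\<close>-sets alone. Triangles come in with the next locale.\<close>

locale shifted_category =
  fixes D :: "('o, 'm) tricat"
  assumes homs_objs: "f \<in> homs D X Y \<Longrightarrow> X \<in> objs D \<and> Y \<in> objs D"
    and cmp_in: "f \<in> homs D X Y \<Longrightarrow> g \<in> homs D Y Z \<Longrightarrow> cmp D g f \<in> homs D X Z"
    and cmp_assoc: "f \<in> homs D X Y \<Longrightarrow> g \<in> homs D Y Z \<Longrightarrow> h \<in> homs D Z W \<Longrightarrow>
      cmp D (cmp D h g) f = cmp D h (cmp D g f)"
    and idt_in: "X \<in> objs D \<Longrightarrow> idt D X \<in> homs D X X"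
    and cmp_idt: "f \<in> homs D X Y \<Longrightarrow> cmp D f (idt D X) = f"
    and idt_cmp: "f \<in> homs D X Y \<Longrightarrow> cmp D (idt D Y) f = f"
    and sus_bij: "bij_betw (sus D) (objs D) (objs D)"
    and susm_bij: "X \<in> objs D \<Longrightarrow> Y \<in> objs D \<Longrightarrow> bij_betw (susm D) (homs D X Y) (homs D (sus D X) (sus D Y))"
    and susm_cmp: "f \<in> homs D X Y \<Longrightarrow> g \<in> homs D Y Z \<Longrightarrow> susm D (cmp D g f) = cmp D (susm D g) (susm D f)"
    and susm_idt: "X \<in> objs D \<Longrightarrow> susm D (idt D X) = idt D (sus D X)"
    and zero_ex: "\<exists>Z. zero_object D Z"
begin

lemma hom_zeroI:
  "f \<in> homs D X Y \<Longrightarrow> (\<And>g. g \<in> homs D X Y \<Longrightarrow> g = f) \<Longrightarrow> hom_zero D X Y"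
  unfolding hom_zero_def by (rule is_singletonI') auto

lemma hom_zeroD: "hom_zero D X Y \<Longrightarrow> f \<in> homs D X Y \<Longrightarrow> g \<in> homs D X Y \<Longrightarrow> f = g"
  by (auto simp: hom_zero_def is_singleton_def)

lemma hom_zero_nonempty: "hom_zero D X Y \<Longrightarrow> \<exists>f. f \<in> homs D X Y"
  by (auto simp: hom_zero_def is_singleton_def)

lemma hom_zero_objs: "hom_zero D X Y \<Longrightarrow> X \<in> objs D \<and> Y \<in> objs D"
  using hom_zero_nonempty homs_objs by blast

lemma isomorphicE:
  assumes "isomorphic D X Y"
  obtains f g where "f \<in> homs D X Y" "g \<in> homs D Y X" "cmp D g f = idt D X" "cmp D f g = idt D Y"
  using assms unfolding isomorphic_def is_iso_def by blast

lemma isomorphic_sym: "isomorphic D X Y \<Longrightarrow> isomorphic D Y X"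
  by (elim isomorphicE) (auto simp: isomorphic_def is_iso_def)

lemma isomorphic_trans:
  assumes "isomorphic D X Y" "isomorphic D Y Z" shows "isomorphic D X Z"
proof -
  obtain a b where ab: "a \<in> homs D X Y" "b \<in> homs D Y X" "cmp D b a = idt D X" "cmp D a b = idt D Y"
    using assms(1) by (rule isomorphicE)
  obtain c d where cd: "c \<in> homs D Y Z" "d \<in> homs D Z Y" "cmp D d c = idt D Y" "cmp D c d = idt D Z"
    using assms(2) by (rule isomorphicE)
  have "cmp D (cmp D b d) (cmp D c a) = idt D X"
    using cmp_assoc[OF cmp_in[OF ab(1) cd(1)] cd(2) ab(2)] cmp_assoc[OF ab(1) cd(1,2)] cd(3)
      idt_cmp[OF ab(1)] ab(3) by simp
  moreover have "cmp D (cmp D c a) (cmp D b d) = idt D Z"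
    using cmp_assoc[OF cmp_in[OF cd(2) ab(2)] ab(1) cd(1)] cmp_assoc[OF cd(2) ab(2,1)] ab(4)
      idt_cmp[OF cd(2)] cd(4) by simp
  ultimately show ?thesis
    using cmp_in[OF ab(1) cd(1)] cmp_in[OF cd(2) ab(2)] unfolding isomorphic_def is_iso_def by blast
qed

lemma hom_zero_iso_from:
  assumes "isomorphic D X X'" "hom_zero D X T" shows "hom_zero D X' T"
proof -
  obtain a b where ab: "a \<in> homs D X X'" "b \<in> homs D X' X" "cmp D b a = idt D X" "cmp D a b = idt D X'"
    using assms(1) by (rule isomorphicE)
  obtain f0 where f0: "f0 \<in> homs D X T" using hom_zero_nonempty[OF assms(2)] by blast
  have "f = cmp D f0 b" if f: "f \<in> homs D X' T" for f
  proof -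
    have "cmp D f a = f0" using hom_zeroD[OF assms(2) cmp_in[OF ab(1) f] f0] .
    then show ?thesis using cmp_assoc[OF ab(2,1) f] ab(4) cmp_idt[OF f] by simp
  qed
  then show ?thesis using hom_zeroI cmp_in[OF ab(2) f0] by metis
qed

lemma hom_zero_iso_to:
  assumes "isomorphic D X X'" "hom_zero D T X" shows "hom_zero D T X'"
proof -
  obtain a b where ab: "a \<in> homs D X X'" "b \<in> homs D X' X" "cmp D b a = idt D X" "cmp D a b = idt D X'"
    using assms(1) by (rule isomorphicE)
  obtain f0 where f0: "f0 \<in> homs D T X" using hom_zero_nonempty[OF assms(2)] by blast
  have "f = cmp D a f0" if f: "f \<in> homs D T X'" for f
  proof -
    have "cmp D b f = f0" using hom_zeroD[OF assms(2) cmp_in[OF f ab(2)] f0] .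
    then show ?thesis using cmp_assoc[OF f ab(2,1)] ab(4) idt_cmp[OF f] by simp
  qed
  then show ?thesis using hom_zeroI cmp_in[OF f0 ab(1)] by metis
qed

lemma zero_objectD:
  assumes "zero_object D Z" "X \<in> objs D"
  shows "Z \<in> objs D" "hom_zero D Z X" "hom_zero D X Z"
  using assms by (auto simp: zero_object_def hom_zero_def)

lemma homs_nonempty: "X \<in> objs D \<Longrightarrow> Y \<in> objs D \<Longrightarrow> \<exists>f. f \<in> homs D X Y"
proof -
  assume XY: "X \<in> objs D" "Y \<in> objs D"
  obtain Z where Z: "zero_object D Z" using zero_ex by blast
  obtain f where "f \<in> homs D X Z" using hom_zero_nonempty[OF zero_objectD(3)[OF Z XY(1)]] by blast
  moreover obtain g where "g \<in> homs D Z Y" using hom_zero_nonempty[OF zero_objectD(2)[OF Z XY(2)]] by blast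
  ultimately show ?thesis using cmp_in by blast
qed

text \<open>If \<open>Hom(X, X)\<close> is trivial, the identity of \<open>X\<close> factors through a zero object, and so does every
morphism from or to \<open>X\<close>.\<close>

lemma zero_object_iff: "zero_object D X \<longleftrightarrow> hom_zero D X X"
proof
  assume X: "hom_zero D X X"
  then have XO: "X \<in> objs D" using hom_zero_objs by blast
  obtain Z where Z: "zero_object D Z" using zero_ex by blast
  obtain p i where p: "p \<in> homs D X Z" and i: "i \<in> homs D Z X"
    using hom_zero_nonempty[OF zero_objectD(2)[OF Z XO]] hom_zero_nonempty[OF zero_objectD(3)[OF Z XO]]
    by blast
  have ip: "cmp D i p = idt D X" using hom_zeroD[OF X cmp_in[OF p i] idt_in[OF XO]] .
  have "hom_zero D X Y \<and> hom_zero D Y X" if Y: "Y \<in> objs D" for Y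
  proof
    obtain f where f: "f \<in> homs D X Y" using homs_nonempty[OF XO Y] by blast
    have "g = f" if g: "g \<in> homs D X Y" for g
    proof -
      have "cmp D g i = cmp D f i" using hom_zeroD[OF zero_objectD(2)[OF Z Y] cmp_in[OF i g] cmp_in[OF i f]] .
      then show ?thesis using cmp_assoc[OF p i f] cmp_assoc[OF p i g] ip cmp_idt f g by metis
    qed
    then show "hom_zero D X Y" using hom_zeroI[OF f] by blast
    obtain f where f: "f \<in> homs D Y X" using homs_nonempty[OF Y XO] by blast
    have "g = f" if g: "g \<in> homs D Y X" for g
    proof -
      have "cmp D p g = cmp D p f" using hom_zeroD[OF zero_objectD(3)[OF Z Y] cmp_in[OF g p] cmp_in[OF f p]] .
      then show ?thesis using cmp_assoc[OF f p i] cmp_assoc[OF g p i] ip idt_cmp f g by metis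
    qed
    then show "hom_zero D Y X" using hom_zeroI[OF f] by blast
  qed
  then show "zero_object D X" using XO by (simp add: zero_object_def hom_zero_def)
next
  assume X: "zero_object D X"
  then have "X \<in> objs D" by (simp add: zero_object_def)
  then show "hom_zero D X X" by (rule zero_objectD(2)[OF X])
qed

lemma zero_object_iso: "zero_object D X \<Longrightarrow> isomorphic D X Y \<Longrightarrow> zero_object D Y"
  using hom_zero_iso_from hom_zero_iso_to zero_object_iff by metis

text \<open>The coproduct property split into existence and uniqueness, so that both can be used separately.\<close>

lemma direct_sumE:
  assumes "direct_sum D X Y S"
  obtains i j where "X \<in> objs D" "Y \<in> objs D" "S \<in> objs D" "i \<in> homs D X S" "j \<in> homs D Y S"
    "\<forall>T. \<forall>f \<in> homs D X T. \<forall>g \<in> homs D Y T. \<exists>h \<in> homs D S T. cmp D h i = f \<and> cmp D h j = g"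
    "\<forall>T. \<forall>h \<in> homs D S T. \<forall>h' \<in> homs D S T. cmp D h i = cmp D h' i \<longrightarrow> cmp D h j = cmp D h' j \<longrightarrow> h = h'"
proof -
  have o: "X \<in> objs D" "Y \<in> objs D" "S \<in> objs D" using assms by (simp_all add: direct_sum_def)
  obtain i j where ij: "i \<in> homs D X S" "j \<in> homs D Y S"
    and u: "\<forall>T \<in> objs D. \<forall>f \<in> homs D X T. \<forall>g \<in> homs D Y T.
        \<exists>!h. h \<in> homs D S T \<and> cmp D h i = f \<and> cmp D h j = g"
    using assms unfolding direct_sum_def by (elim conjE bexE)
  have u': "\<exists>!h. h \<in> homs D S T \<and> cmp D h i = f \<and> cmp D h j = g"
    if "f \<in> homs D X T" "g \<in> homs D Y T" for T f g
    using u that homs_objs[OF that(1)] by blast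
  show ?thesis
  proof (rule that[OF o ij])
    have "\<exists>h \<in> homs D S T. cmp D h i = f \<and> cmp D h j = g" if "f \<in> homs D X T" "g \<in> homs D Y T" for T f g
      using ex1_implies_ex[rule_format, OF u'[OF that]] by blast
    then show "\<forall>T. \<forall>f \<in> homs D X T. \<forall>g \<in> homs D Y T. \<exists>h \<in> homs D S T. cmp D h i = f \<and> cmp D h j = g" by blast
    have "h = h'" if "h \<in> homs D S T" "h' \<in> homs D S T" "cmp D h i = cmp D h' i" "cmp D h j = cmp D h' j"
      for T h h'
      using u'[OF cmp_in[OF ij(1) that(2)] cmp_in[OF ij(2) that(2)]] that by blast
    then show "\<forall>T. \<forall>h \<in> homs D S T. \<forall>h' \<in> homs D S T. cmp D h i = cmp D h' i \<longrightarrow> cmp D h j = cmp D h' j \<longrightarrow> h = h'" by blast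
  qed
qed

abbreviation zeros :: "'o set" where "zeros \<equiv> {Z. zero_object D Z}"

lemma zeros_direct_sum:
  assumes "direct_sum D X Y S" "zero_object D X" "zero_object D Y"
  shows "zero_object D S"
proof -
  obtain i j where o: "X \<in> objs D" "Y \<in> objs D" and S: "S \<in> objs D"
    and i: "i \<in> homs D X S" and j: "j \<in> homs D Y S"
    and ex: "\<forall>T. \<forall>f \<in> homs D X T. \<forall>g \<in> homs D Y T. \<exists>h \<in> homs D S T. cmp D h i = f \<and> cmp D h j = g"
    and un: "\<forall>T. \<forall>h \<in> homs D S T. \<forall>h' \<in> homs D S T. cmp D h i = cmp D h' i \<longrightarrow> cmp D h j = cmp D h' j \<longrightarrow> h = h'"
    using assms(1) by (rule direct_sumE)
  have "h = idt D S" if h: "h \<in> homs D S S" for h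
  proof (rule un[rule_format, OF h idt_in[OF S]])
    show "cmp D h i = cmp D (idt D S) i"
      by (rule hom_zeroD[OF zero_objectD(2)[OF assms(2) S] cmp_in[OF i h] cmp_in[OF i idt_in[OF S]]])
    show "cmp D h j = cmp D (idt D S) j"
      by (rule hom_zeroD[OF zero_objectD(2)[OF assms(3) S] cmp_in[OF j h] cmp_in[OF j idt_in[OF S]]])
  qed
  then show ?thesis unfolding zero_object_iff by (rule hom_zeroI[OF idt_in[OF S]])
qed

lemma zeros_summand:
  assumes "direct_sum D X Y S" "zero_object D S"
  shows "zero_object D X \<and> zero_object D Y"
proof -
  obtain i j where XY: "X \<in> objs D" "Y \<in> objs D" and S: "S \<in> objs D"
    and i: "i \<in> homs D X S" and j: "j \<in> homs D Y S"
    and ex: "\<forall>T. \<forall>f \<in> homs D X T. \<forall>g \<in> homs D Y T. \<exists>h \<in> homs D S T. cmp D h i = f \<and> cmp D h j = g"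
    and un: "\<forall>T. \<forall>h \<in> homs D S T. \<forall>h' \<in> homs D S T. cmp D h i = cmp D h' i \<longrightarrow> cmp D h j = cmp D h' j \<longrightarrow> h = h'"
    using assms(1) by (rule direct_sumE)
  obtain g where g: "g \<in> homs D Y X" using homs_nonempty[OF XY(2,1)] by blast
  have "f = idt D X" if f: "f \<in> homs D X X" for f
  proof -
    obtain h where h: "h \<in> homs D S X" "cmp D h i = f" using ex[rule_format, OF f g] by blast
    obtain h' where h': "h' \<in> homs D S X" "cmp D h' i = idt D X" using ex[rule_format, OF idt_in[OF XY(1)] g] by blast
    show ?thesis using hom_zeroD[OF zero_objectD(2)[OF assms(2) XY(1)] h(1) h'(1)] h(2) h'(2) by simp
  qed
  then have X: "hom_zero D X X" by (rule hom_zeroI[OF idt_in[OF XY(1)]])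
  obtain g' where g': "g' \<in> homs D X Y" using homs_nonempty[OF XY] by blast
  have "f = idt D Y" if f: "f \<in> homs D Y Y" for f
  proof -
    obtain h where h: "h \<in> homs D S Y" "cmp D h j = f" using ex[rule_format, OF g' f] by blast
    obtain h' where h': "h' \<in> homs D S Y" "cmp D h' j = idt D Y" using ex[rule_format, OF g' idt_in[OF XY(2)]] by blast
    show ?thesis using hom_zeroD[OF zero_objectD(2)[OF assms(2) XY(2)] h(1) h'(1)] h(2) h'(2) by simp
  qed
  then have "hom_zero D Y Y" by (rule hom_zeroI[OF idt_in[OF XY(2)]])
  with X show ?thesis by (simp add: zero_object_iff)
qed

lemma subcat_zeros: "subcat D zeros"
  unfolding subcat_def
proof (intro conjI ballI allI impI)
  show "zeros \<subseteq> objs D" by (auto simp: zero_object_def)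
  show "Y \<in> zeros" if "X \<in> zeros" "isomorphic D X Y" for X Y using zero_object_iso that by blast
  show "S \<in> zeros" if "X \<in> zeros" "Y \<in> zeros" "direct_sum D X Y S" for X Y S
    using zeros_direct_sum that by blast
qed auto

lemma summand_closed_zeros: "summand_closed D zeros"
  unfolding summand_closed_def using zeros_summand by blast

text \<open>A map between \<open>X\<close> and any zero object is an approximation, as all relevant morphism sets are singletons.\<close>

lemma functorially_finite_zeros:
  assumes "M \<subseteq> objs D"
  shows "functorially_finite D M zeros"
  unfolding functorially_finite_def
proof (intro ballI conjI)
  fix X assume "X \<in> M"
  then have X: "X \<in> objs D" using assms by blast
  obtain Z where Z: "zero_object D Z" using zero_ex by blast
  note ZO = zero_objectD(1)[OF Z X]
  obtain i where i: "i \<in> homs D Z X" using homs_nonempty[OF ZO X] by blast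
  obtain p where p: "p \<in> homs D X Z" using homs_nonempty[OF X ZO] by blast
  have "\<exists>h\<in>homs D N Z. g = cmp D i h" if N: "zero_object D N" and g: "g \<in> homs D N X" for N g
  proof -
    obtain h where h: "h \<in> homs D N Z" using homs_nonempty zero_objectD(1)[OF N X] ZO by blast
    then show ?thesis using hom_zeroD[OF zero_objectD(2)[OF N X] g cmp_in[OF h i]] by blast
  qed
  then show "\<exists>P\<in>zeros. \<exists>f\<in>homs D P X. \<forall>N\<in>zeros. \<forall>g\<in>homs D N X. \<exists>h\<in>homs D N P. g = cmp D f h"
    using Z i by blast
  have "\<exists>h\<in>homs D Z N. g = cmp D h p" if N: "zero_object D N" and g: "g \<in> homs D X N" for N g
  proof -
    obtain h where h: "h \<in> homs D Z N" using homs_nonempty zero_objectD(1)[OF N X] ZO by blast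
    then show ?thesis using hom_zeroD[OF zero_objectD(3)[OF N X] g cmp_in[OF p h]] by blast
  qed
  then show "\<exists>P\<in>zeros. \<exists>f\<in>homs D X P. \<forall>N\<in>zeros. \<forall>g\<in>homs D X N. \<exists>h\<in>homs D P N. g = cmp D h f"
    using Z p by blast
qed

lemma sus_in: "X \<in> objs D \<Longrightarrow> sus D X \<in> objs D"
  using sus_bij bij_betwE by blast

lemma sus_surj: "X \<in> objs D \<Longrightarrow> \<exists>Y \<in> objs D. X = sus D Y"
  using bij_betw_imp_surj_on[OF sus_bij] by blast

lemma susm_in: "f \<in> homs D X Y \<Longrightarrow> susm D f \<in> homs D (sus D X) (sus D Y)"
  using bij_betwE[OF susm_bij[of X Y]] homs_objs[of f X Y] by blast

lemma susm_surj:
  "X \<in> objs D \<Longrightarrow> Y \<in> objs D \<Longrightarrow> f \<in> homs D (sus D X) (sus D Y) \<Longrightarrow> \<exists>g \<in> homs D X Y. f = susm D g"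
  using bij_betw_imp_surj_on[OF susm_bij[of X Y]] by blast

lemma susm_inj: "f \<in> homs D X Y \<Longrightarrow> g \<in> homs D X Y \<Longrightarrow> susm D f = susm D g \<Longrightarrow> f = g"
  using inj_onD[OF bij_betw_imp_inj_on[OF susm_bij[of X Y]]] homs_objs[of f X Y] by blast

lemma hom_zero_sus: "X \<in> objs D \<Longrightarrow> Y \<in> objs D \<Longrightarrow> hom_zero D (sus D X) (sus D Y) \<longleftrightarrow> hom_zero D X Y"
  using bij_betw_same_card[OF susm_bij] by (simp add: hom_zero_def is_singleton_altdef)

lemma sus_pow_in: "X \<in> objs D \<Longrightarrow> (sus D ^^ i) X \<in> objs D"
  by (induction i) (auto simp: sus_in)

lemma sus_pow_surj: "X \<in> objs D \<Longrightarrow> \<exists>Y \<in> objs D. X = (sus D ^^ i) Y"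
proof (induction i arbitrary: X)
  case (Suc i)
  then obtain Y where "Y \<in> objs D" "X = sus D Y" using sus_surj by blast
  with Suc.IH[of Y] show ?case by auto
qed auto

lemma hom_zero_sus_pow:
  "X \<in> objs D \<Longrightarrow> Y \<in> objs D \<Longrightarrow> hom_zero D ((sus D ^^ i) X) ((sus D ^^ i) Y) \<longleftrightarrow> hom_zero D X Y"
  by (induction i) (auto simp: hom_zero_sus sus_pow_in)

lemma isomorphic_sus: "isomorphic D X Y \<Longrightarrow> isomorphic D (sus D X) (sus D Y)"
proof -
  assume "isomorphic D X Y"
  then obtain a b where ab: "a \<in> homs D X Y" "b \<in> homs D Y X" "cmp D b a = idt D X" "cmp D a b = idt D Y"
    by (rule isomorphicE)
  have "cmp D (susm D b) (susm D a) = idt D (sus D X)" "cmp D (susm D a) (susm D b) = idt D (sus D Y)"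
    using susm_cmp[OF ab(1,2)] susm_cmp[OF ab(2,1)] ab(3,4) susm_idt homs_objs[OF ab(1)] by auto
  then show ?thesis using susm_in[OF ab(1)] susm_in[OF ab(2)] unfolding isomorphic_def is_iso_def by blast
qed

lemma zero_object_sus: "X \<in> objs D \<Longrightarrow> zero_object D (sus D X) \<longleftrightarrow> zero_object D X"
  by (simp add: zero_object_iff hom_zero_sus)

lemma direct_sum_sus:
  assumes "direct_sum D X Y S"
  shows "direct_sum D (sus D X) (sus D Y) (sus D S)"
proof -
  obtain i j where XY: "X \<in> objs D" "Y \<in> objs D" and S: "S \<in> objs D"
    and i: "i \<in> homs D X S" and j: "j \<in> homs D Y S"
    and ex: "\<forall>T. \<forall>f \<in> homs D X T. \<forall>g \<in> homs D Y T. \<exists>h \<in> homs D S T. cmp D h i = f \<and> cmp D h j = g"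
    and un: "\<forall>T. \<forall>h \<in> homs D S T. \<forall>h' \<in> homs D S T. cmp D h i = cmp D h' i \<longrightarrow> cmp D h j = cmp D h' j \<longrightarrow> h = h'"
    using assms by (rule direct_sumE)
  have "\<exists>!h. h \<in> homs D (sus D S) T' \<and> cmp D h (susm D i) = f' \<and> cmp D h (susm D j) = g'"
    if T': "T' \<in> objs D" and f': "f' \<in> homs D (sus D X) T'" and g': "g' \<in> homs D (sus D Y) T'" for T' f' g'
  proof -
    obtain T where T: "T \<in> objs D" "T' = sus D T" using sus_surj[OF T'] by blast
    obtain f where f: "f \<in> homs D X T" "f' = susm D f" using susm_surj[OF XY(1) T(1)] f' T by blast
    obtain g where g: "g \<in> homs D Y T" "g' = susm D g" using susm_surj[OF XY(2) T(1)] g' T by blast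
    obtain h where h: "h \<in> homs D S T" "cmp D h i = f" "cmp D h j = g"
      using ex[rule_format, OF f(1) g(1)] by blast
    show ?thesis
    proof (rule ex1I[of _ "susm D h"])
      show "susm D h \<in> homs D (sus D S) T' \<and> cmp D (susm D h) (susm D i) = f' \<and> cmp D (susm D h) (susm D j) = g'"
        using susm_in[OF h(1)] susm_cmp[OF i h(1)] susm_cmp[OF j h(1)] h f g T by simp
    next
      fix k' assume k': "k' \<in> homs D (sus D S) T' \<and> cmp D k' (susm D i) = f' \<and> cmp D k' (susm D j) = g'"
      then have "k' \<in> homs D (sus D S) (sus D T)" using T(2) by simp
      then obtain k where k: "k \<in> homs D S T" "k' = susm D k" using susm_surj[OF S T(1)] by blast
      have "cmp D (susm D k) (susm D i) = susm D f" "cmp D (susm D k) (susm D j) = susm D g"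
        using k' unfolding k(2) f(2) g(2) by auto
      then have "susm D (cmp D k i) = susm D f" "susm D (cmp D k j) = susm D g"
        using susm_cmp[OF i k(1)] susm_cmp[OF j k(1)] by auto
      then have "cmp D k i = f" "cmp D k j = g"
        using susm_inj[OF cmp_in[OF i k(1)] f(1)] susm_inj[OF cmp_in[OF j k(1)] g(1)] by blast+
      then show "k' = susm D h" using un[rule_format, OF k(1) h(1)] h k by simp
    qed
  qed
  then show ?thesis
    unfolding direct_sum_def using XY S susm_in[OF i] susm_in[OF j] sus_in by blast
qed

lemma desus_iff: "X \<in> desus D M \<longleftrightarrow> X \<in> objs D \<and> sus D X \<in> M"
  by (simp add: desus_def)

lemma subcat_desus:
  assumes "subcat D M" shows "subcat D (desus D M)"
proof -
  have M: "\<And>X Y. X \<in> M \<Longrightarrow> Y \<in> objs D \<Longrightarrow> isomorphic D X Y \<Longrightarrow> Y \<in> M"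
    "\<And>Z. zero_object D Z \<Longrightarrow> Z \<in> M"
    "\<And>X Y S. X \<in> M \<Longrightarrow> Y \<in> M \<Longrightarrow> direct_sum D X Y S \<Longrightarrow> S \<in> M"
    using assms unfolding subcat_def by blast+
  show ?thesis
    unfolding subcat_def desus_iff
  proof (intro conjI ballI allI impI)
    show "desus D M \<subseteq> objs D" by (auto simp: desus_iff)
    show "sus D Y \<in> M" if "X \<in> desus D M" "Y \<in> objs D" "isomorphic D X Y" for X Y
      using M(1)[of "sus D X" "sus D Y"] that(1) sus_in[OF that(2)] isomorphic_sus[OF that(3)]
      by (simp add: desus_iff)
    show "Z \<in> objs D" if "zero_object D Z" for Z using that by (simp add: zero_object_def)
    then show "sus D Z \<in> M" if "zero_object D Z" for Z
      using that M(2) zero_object_sus by blast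
    show "S \<in> objs D" if "direct_sum D X Y S" for X Y S using that by (simp add: direct_sum_def)
    show "sus D S \<in> M" if "X \<in> desus D M" "Y \<in> desus D M" "direct_sum D X Y S" for X Y S
      using M(3)[OF _ _ direct_sum_sus[OF that(3)]] that by (simp add: desus_iff)
  qed
qed

lemma summand_closed_desus:
  assumes "summand_closed D M" shows "summand_closed D (desus D M)"
  unfolding summand_closed_def
proof (intro allI impI)
  fix X Y S assume *: "direct_sum D X Y S \<and> S \<in> desus D M"
  then have "sus D X \<in> M" "sus D Y \<in> M"
    using assms direct_sum_sus unfolding summand_closed_def desus_iff by blast+
  then show "X \<in> desus D M \<and> Y \<in> desus D M"
    using * unfolding desus_iff direct_sum_def by blast
qed

lemma silting_objs: "silting D M \<Longrightarrow> M \<subseteq> objs D"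
  unfolding silting_def subcat_def by (elim conjE)

lemma silting_hom: "silting D M \<Longrightarrow> X \<in> M \<Longrightarrow> Y \<in> M \<Longrightarrow> i > 0 \<Longrightarrow> hom_zero D X ((sus D ^^ i) Y)"
  by (simp add: silting_def)

lemma desus_hom_desus:
  assumes "silting D M" "X \<in> desus D M" "Y \<in> desus D M" "i > 0"
  shows "hom_zero D X ((sus D ^^ i) Y)"
proof -
  have "hom_zero D (sus D X) ((sus D ^^ i) (sus D Y))"
    using assms(2,3) silting_hom[OF assms(1) _ _ assms(4)] by (simp add: desus_iff)
  then show ?thesis
    using assms(2,3) hom_zero_sus[of X "(sus D ^^ i) Y"] sus_pow_in by (simp add: desus_iff funpow_swap1)
qed

lemma desus_hom:
  assumes "silting D M" "X \<in> desus D M" "Y \<in> M"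
  shows "hom_zero D X ((sus D ^^ i) Y)"
proof -
  have "hom_zero D (sus D X) ((sus D ^^ Suc i) Y)"
    using assms(2) silting_hom[OF assms(1) _ assms(3) zero_less_Suc] by (simp add: desus_iff)
  moreover have "X \<in> objs D" "Y \<in> objs D"
    using assms(2,3) silting_objs[OF assms(1)] by (auto simp: desus_iff)
  ultimately show ?thesis
    using hom_zero_sus[of X "(sus D ^^ i) Y"] sus_pow_in[of Y i] by simp
qed

text \<open>Thick subcategories are closed under suspension in both directions, so they contain
\<open>\<Sigma>\<inverse>M\<close> iff they contain \<open>M\<close>.\<close>

lemma thick_hull_desus:
  assumes "M \<subseteq> objs D"
  shows "(thick D) hull (desus D M) = (thick D) hull M"
proof -
  have "desus D M \<subseteq> C \<longleftrightarrow> M \<subseteq> C" if C: "thick D C" for C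
  proof -
    have c: "\<forall>X \<in> objs D. sus D X \<in> C \<longleftrightarrow> X \<in> C" using C unfolding thick_def by (elim conjE)
    show ?thesis
    proof
      assume d: "desus D M \<subseteq> C"
      show "M \<subseteq> C"
      proof
        fix Y assume Y: "Y \<in> M"
        then have "Y \<in> objs D" using assms by blast
        then obtain X where X: "X \<in> objs D" "Y = sus D X" using sus_surj by blast
        then have "X \<in> C" using d Y by (auto simp: desus_iff)
        then show "Y \<in> C" using c X by blast
      qed
    next
      assume "M \<subseteq> C" then show "desus D M \<subseteq> C" using c unfolding desus_def by blast
    qed
  qed
  then show ?thesis
    unfolding hull_def by (intro arg_cong[where f = Inter] Collect_cong conj_cong refl)
qed

lemma silting_desus:
  assumes "silting D M" shows "silting D (desus D M)"
proof -
  have "subcat D M" "summand_closed D M" "(thick D) hull M = objs D"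
    using assms by (simp_all add: silting_def)
  then have "subcat D (desus D M)" "summand_closed D (desus D M)" "(thick D) hull (desus D M) = objs D"
    using subcat_desus summand_closed_desus thick_hull_desus[OF silting_objs[OF assms]] by simp_all
  moreover have "\<forall>X \<in> desus D M. \<forall>Y \<in> desus D M. \<forall>i > 0. hom_zero D X ((sus D ^^ i) Y)"
    using desus_hom_desus[OF assms] by blast
  ultimately show ?thesis unfolding silting_def by (intro conjI)
qed

lemma zeros_subset: "subcat D M \<Longrightarrow> zero_object D Z \<Longrightarrow> Z \<in> M"
  unfolding subcat_def by blast

lemma subcat_iso:
  assumes "subcat D M" "X \<in> M" "isomorphic D X Y" shows "Y \<in> M"
proof -
  have "Y \<in> objs D" using assms(3) homs_objs unfolding isomorphic_def is_iso_def by blast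
  then show ?thesis using assms unfolding subcat_def by blast
qed

lemma silting_pair_zeros:
  assumes "silting D M"
  shows "(M, zeros) \<in> silting_pairs D"
proof -
  have "subcat D M" using assms by (simp add: silting_def)
  then have "zeros \<subseteq> M" using zeros_subset by blast
  then show ?thesis
    using assms subcat_zeros summand_closed_zeros functorially_finite_zeros[OF silting_objs[OF assms]]
    by (simp add: silting_pairs_def)
qed

end

text \<open>The properties of distinguished triangles that the argument rests on: exactness of \<open>Hom\<close> in the
middle term, and the existence and shape of triangles with a zero term.\<close>

locale triangle_category = shifted_category +
  assumes tris_objs: "(X, Y, Z, u, v, w) \<in> tris D \<Longrightarrow> X \<in> objs D \<and> Y \<in> objs D \<and> Z \<in> objs D"
    and tris_hom_from: "(X, Y, Z, u, v, w) \<in> tris D \<Longrightarrow> T \<in> objs D \<Longrightarrow> hom_zero D X T \<Longrightarrow>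
      hom_zero D Z T \<Longrightarrow> hom_zero D Y T"
    and tris_hom_to: "(X, Y, Z, u, v, w) \<in> tris D \<Longrightarrow> T \<in> objs D \<Longrightarrow> hom_zero D T X \<Longrightarrow>
      hom_zero D T Z \<Longrightarrow> hom_zero D T Y"
    and tris_zero_iso: "(X, Y, Z, u, v, w) \<in> tris D \<Longrightarrow> zero_object D Z \<Longrightarrow> isomorphic D X Y"
    and tris_id: "X \<in> objs D \<Longrightarrow> \<exists>Z u v w. zero_object D Z \<and> (X, X, Z, u, v, w) \<in> tris D"
    and tris_zero: "Y \<in> objs D \<Longrightarrow> \<exists>X Z u v w. zero_object D X \<and> isomorphic D Y Z \<and> (X, Y, Z, u, v, w) \<in> tris D"
begin

text \<open>A triangle \<open>X \<rightarrow> Y \<rightarrow> 0\<close> forces \<open>X \<cong> Y\<close>, so \<open>\<Sigma>\<inverse>M * 0 = \<Sigma>\<inverse>M\<close>, and the orthogonal of the zero objects is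
everything.\<close>

lemma right_mutation_zeros:
  assumes "silting D M"
  shows "right_mutation D zeros M = desus D M"
proof (intro Set.set_eqI iffI)
  have dM: "subcat D (desus D M)" using silting_desus[OF assms] by (simp add: silting_def)
  fix Y
  {
    assume "Y \<in> right_mutation D zeros M"
    then obtain X Z u v w where "X \<in> desus D M" "zero_object D Z" "(X, Y, Z, u, v, w) \<in> tris D"
      by (auto simp: right_mutation_def star_def)
    then show "Y \<in> desus D M" using tris_zero_iso subcat_iso[OF dM] by blast
  next
    assume Y: "Y \<in> desus D M"
    then have YO: "Y \<in> objs D" by (simp add: desus_iff)
    then have "Y \<in> star D (desus D M) zeros" using tris_id[OF YO] Y unfolding star_def by blast
    moreover have "hom_zero D X Y" if "X \<in> desus D zeros" for X
      using that zero_object_sus[of X] zero_objectD(2)[OF _ YO, of X] unfolding desus_iff by blast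
    ultimately show "Y \<in> right_mutation D zeros M"
      using YO by (simp add: right_mutation_def right_perp_def)
  }
qed

lemma two_term_self:
  assumes "silting D M" shows "two_term_silting D M M"
proof -
  have M: "subcat D M" using assms by (simp add: silting_def)
  have dM: "subcat D (desus D M)" using silting_desus[OF assms] by (simp add: silting_def)
  have "Y \<in> star D (desus D M) M" if Y: "Y \<in> M" for Y
  proof -
    have YO: "Y \<in> objs D" using Y silting_objs[OF assms] by blast
    then obtain X Z u v w where "zero_object D X" "isomorphic D Y Z" "(X, Y, Z, u, v, w) \<in> tris D"
      using tris_zero by blast
    then show ?thesis
      using YO subcat_iso[OF M Y] zeros_subset[OF dM] unfolding star_def by blast
  qed
  then show ?thesis using assms by (auto simp: two_term_silting_def)
qed

lemma two_term_desus:
  assumes "silting D M" shows "two_term_silting D M (desus D M)"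
proof -
  have M: "subcat D M" using assms by (simp add: silting_def)
  have "Y \<in> star D (desus D M) M" if Y: "Y \<in> desus D M" for Y
  proof -
    have YO: "Y \<in> objs D" using Y by (simp add: desus_iff)
    then obtain Z u v w where "zero_object D Z" "(Y, Y, Z, u, v, w) \<in> tris D"
      using tris_id by blast
    then show ?thesis using YO Y zeros_subset[OF M] unfolding star_def by blast
  qed
  then show ?thesis using silting_desus[OF assms] by (auto simp: two_term_silting_def)
qed

text \<open>With \<open>M' = M\<close> this gives \<open>N \<le> M\<close> for two-term \<open>M\<close>-silting \<open>N\<close>; with a silting pair
\<open>(M, M')\<close> it says that its right mutation is \<open>\<le> M\<close>.\<close>

lemma silt_le_of_star:
  assumes "silting D M" "N \<subseteq> star D (desus D M) M'" "M' \<subseteq> M"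
  shows "silt_le D N M"
  unfolding silt_le_def
proof (intro ballI allI impI)
  fix X Y and i :: nat assume X: "X \<in> N" and Y: "Y \<in> M" and i: "i > 0"
  have "X \<in> star D (desus D M) M'" using X assms(2) by blast
  then obtain A B u v w where *: "A \<in> desus D M" "B \<in> M'" "(A, X, B, u, v, w) \<in> tris D"
    unfolding star_def by blast
  show "hom_zero D X ((sus D ^^ i) Y)"
  proof (rule tris_hom_from[OF *(3)])
    show "(sus D ^^ i) Y \<in> objs D" using Y silting_objs[OF assms(1)] sus_pow_in by blast
    show "hom_zero D A ((sus D ^^ i) Y)" by (rule desus_hom[OF assms(1) *(1) Y])
    show "hom_zero D B ((sus D ^^ i) Y)" using silting_hom[OF assms(1) _ Y i] *(2) assms(3) by blast
  qed
qed

lemma desus_silt_le: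
  assumes "silting D M" "N \<subseteq> star D (desus D M) M"
  shows "silt_le D (desus D M) N"
  unfolding silt_le_def
proof (intro ballI allI impI)
  fix X Y and i :: nat assume X: "X \<in> desus D M" and Y: "Y \<in> N" and i: "i > 0"
  have "Y \<in> star D (desus D M) M" using Y assms(2) by blast
  then obtain A B u v w where *: "A \<in> desus D M" "B \<in> M" "(A, Y, B, u, v, w) \<in> tris D"
    unfolding star_def by blast
  have O: "A \<in> objs D" "B \<in> objs D" "Y \<in> objs D" using tris_objs[OF *(3)] by auto
  \<comment> \<open>Desuspending the first argument avoids having to suspend the triangle of \<open>Y\<close>.\<close>
  obtain X' where X': "X' \<in> objs D" "X = (sus D ^^ i) X'"
    using sus_pow_surj[of X i] X unfolding desus_iff by blast
  have "hom_zero D X' Y"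
  proof (rule tris_hom_to[OF *(3) X'(1)])
    show "hom_zero D X' A"
      using desus_hom_desus[OF assms(1) X *(1) i] hom_zero_sus_pow[OF X'(1) O(1)] X'(2) by simp
    show "hom_zero D X' B"
      using desus_hom[OF assms(1) X *(2), of i] hom_zero_sus_pow[OF X'(1) O(2)] X'(2) by simp
  qed
  then show "hom_zero D X ((sus D ^^ i) Y)" using hom_zero_sus_pow[OF X'(1) O(3)] X'(2) by simp
qed

text \<open>The chain \<open>\<Sigma>\<inverse>M \<le> R \<le> N \<le> M\<close>, where \<open>R\<close> is the right mutation of \<open>(N, N')\<close>.\<close>

lemma two_term_pair_le:
  assumes M: "silting D M" and N: "(N, N') \<in> silting_pairs D"
    and "two_term_silting D M N" "two_term_silting D M (right_mutation D N' N)"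
  shows "pair_le D (N, N') (M, zeros)"
proof -
  have "right_mutation D N' N \<subseteq> star D (desus D N) N'" by (auto simp: right_mutation_def)
  then show ?thesis
    using assms silt_le_of_star[of N _ N'] silt_le_of_star[OF M, of N M] desus_silt_le[OF M]
    by (simp add: pair_le_def right_mutation_zeros[OF M] two_term_silting_def silting_pairs_def)
qed

text \<open>One inclusion holds since \<open>(M, zeros)\<close> indexes one of the cells of the union, the other because
the order of the face poset is inclusion of closed cells.\<close>

theorem two_term_complex_eq_cell:
  assumes M: "silting D M" and X: "is_silt2 D X e"
  shows "two_term_complex D X e M = subtopology X (X closure_of e (M, zeros))"
proof -
  have P: "(M, zeros) \<in> silting_pairs D" by (rule silting_pair_zeros[OF M])
  have "X closure_of e (N, N') \<subseteq> X closure_of e (M, zeros)"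
    if "(N, N') \<in> silting_pairs D" "two_term_silting D M N" "two_term_silting D M (right_mutation D N' N)"
    for N N'
    using X two_term_pair_le[OF M that] that(1) P
    unfolding is_silt2_def Let_def P2_def by (auto dest!: bspec)
  moreover have "two_term_silting D M (right_mutation D zeros M)"
    using two_term_desus[OF M] by (simp add: right_mutation_zeros[OF M])
  ultimately have "(\<Union>(N, N') \<in> {(N, N') \<in> silting_pairs D. two_term_silting D M N \<and>
      two_term_silting D M (right_mutation D N' N)}. X closure_of e (N, N')) = X closure_of e (M, zeros)"
    using P two_term_self[OF M] by fast
  then show ?thesis unfolding two_term_complex_def by simp
qed

end

section \<open>The derived category and its suspension\<close>

lemma derived_cat_simps [simp]:
  "objs (derived_cat A) = {X. bdd_complex A X}" "homs (derived_cat A) = der_hom A"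
  "cmp (derived_cat A) = der_comp A" "sus (derived_cat A) = cpx_shift"
  "idt (derived_cat A) X = frc A X X X (cmap_id X) (cmap_id X)"
  "susm (derived_cat A) \<phi> = roof_shift ` \<phi>"
  by (simp_all add: derived_cat_def derived_cat_data_def Let_def der_map_def frc_def)

lemma der_map_frc: "der_map A X Y f = frc A X Y X (cmap_id X) f"
  by (simp add: der_map_def frc_def)

lemma frc_homotopic:
  assumes "s \<in> cpx_hom A W X" "quasi_iso W X s" "f \<in> cpx_hom A W Y" "f' \<in> cpx_hom A W Y"
    "homotopic_maps A W Y f f'"
  shows "frc A X Y W s f = frc A X Y W s f'"
proof -
  have "hclass A W Y f = hclass A W Y f'" using assms hclass_eq_iff by blast
  moreover have "K.frac A X Y (W, hclass A W X s, hclass A W Y f)"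
    using assms by (simp add: K.frac_def hclass_in_hqis hclass_in_hhom)
  ultimately show ?thesis
    using frc_eq_iff[OF assms(1,2,3,1,2,4)] K.frac_eq_refl by metis
qed

lemma frc_id_in:
  assumes "f \<in> cpx_hom A X Y" shows "frc A X Y X (cmap_id X) f \<in> der_hom A X Y"
  using frc_in_der_hom[OF cmap_id_in_cpx_hom quasi_iso_id assms] cpx_homD(1)[OF assms] by blast

lemma der_comp_id:
  assumes "\<phi> \<in> der_hom A X Y"
  shows "der_comp A \<phi> (frc A X X X (cmap_id X) (cmap_id X)) = \<phi>"
    "der_comp A (frc A Y Y Y (cmap_id Y) (cmap_id Y)) \<phi> = \<phi>"
proof -
  obtain W s f where s: "s \<in> cpx_hom A W X" "quasi_iso W X s" and f: "f \<in> cpx_hom A W Y"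
    and \<phi>: "\<phi> = frc A X Y W s f" using assms by (rule der_homE)
  have X: "bdd_complex A X" and W: "bdd_complex A W" and Y: "bdd_complex A Y"
    using cpx_homD(1,2)[OF s(1)] cpx_homD(2)[OF f] by auto
  note i = cmap_id_in_cpx_hom[OF X] quasi_iso_id[OF X] and j = cmap_id_in_cpx_hom[OF W] quasi_iso_id[OF W]
    and k = cmap_id_in_cpx_hom[OF Y] quasi_iso_id[OF Y]
  show "der_comp A \<phi> (frc A X X X (cmap_id X) (cmap_id X)) = \<phi>"
    unfolding \<phi> using der_comp_frc[OF i i(1) s f s j(1)]
    by (simp add: cmap_comp_id[OF s(1)] cmap_comp_id[OF f] homotopic_refl[OF s(1)])
  show "der_comp A (frc A Y Y Y (cmap_id Y) (cmap_id Y)) \<phi> = \<phi>"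
    unfolding \<phi> using der_comp_frc[OF s f k k(1) j f]
    by (simp add: cmap_comp_id[OF s(1)] cmap_comp_id[OF f] homotopic_refl[OF f])
qed

lemma der_comp_in:
  assumes "\<phi> \<in> der_hom A X Y" "\<psi> \<in> der_hom A Y Z"
  shows "der_comp A \<psi> \<phi> \<in> der_hom A X Z"
proof -
  obtain W s f where s: "s \<in> cpx_hom A W X" "quasi_iso W X s" and f: "f \<in> cpx_hom A W Y"
    and \<phi>: "\<phi> = frc A X Y W s f" using assms(1) by (rule der_homE)
  obtain V t g where t: "t \<in> cpx_hom A V Y" "quasi_iso V Y t" and g: "g \<in> cpx_hom A V Z"
    and \<psi>: "\<psi> = frc A Y Z V t g" using assms(2) by (rule der_homE)
  obtain U p q where p: "p \<in> cpx_hom A U W" "quasi_iso U W p" and q: "q \<in> cpx_hom A U V"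
    and e: "der_comp A \<psi> \<phi> = frc A X Z U (cmap_comp s p) (cmap_comp g q)"
    unfolding \<phi> \<psi> by (rule der_comp_frcE[OF s f t g])
  show ?thesis unfolding e
    by (rule frc_in_der_hom)
       (use cmap_comp_in_cpx_hom[OF p(1) s(1)] quasi_iso_comp_iff[OF p(1) s] p(2) cmap_comp_in_cpx_hom[OF q g] in auto)
qed

text \<open>Ore squares for the two inner composites are completed by a third one over their apexes \<open>W\<close> and
\<open>V\<close>. On its apex \<open>U\<close> both bracketings are represented by the same roof.\<close>

lemma der_comp_assoc:
  assumes "\<phi> \<in> der_hom A X Y" "\<psi> \<in> der_hom A Y Z" "\<omega> \<in> der_hom A Z T"
  shows "der_comp A (der_comp A \<omega> \<psi>) \<phi> = der_comp A \<omega> (der_comp A \<psi> \<phi>)"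
proof -
  obtain P s f where s: "s \<in> cpx_hom A P X" "quasi_iso P X s" and f: "f \<in> cpx_hom A P Y"
    and \<phi>: "\<phi> = frc A X Y P s f" using assms(1) by (rule der_homE)
  obtain Q t g where t: "t \<in> cpx_hom A Q Y" "quasi_iso Q Y t" and g: "g \<in> cpx_hom A Q Z"
    and \<psi>: "\<psi> = frc A Y Z Q t g" using assms(2) by (rule der_homE)
  obtain R r h where r: "r \<in> cpx_hom A R Z" "quasi_iso R Z r" and h: "h \<in> cpx_hom A R T"
    and \<omega>: "\<omega> = frc A Z T R r h" using assms(3) by (rule der_homE)
  obtain W p q where p: "p \<in> cpx_hom A W P" "quasi_iso W P p" and q: "q \<in> cpx_hom A W Q"
    and pq: "homotopic_maps A W Y (cmap_comp f p) (cmap_comp t q)"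
    and e1: "der_comp A \<psi> \<phi> = frc A X Z W (cmap_comp s p) (cmap_comp g q)"
    unfolding \<phi> \<psi> by (rule der_comp_frcE[OF s f t g])
  obtain V p2 q2 where p2: "p2 \<in> cpx_hom A V Q" "quasi_iso V Q p2" and q2: "q2 \<in> cpx_hom A V R"
    and pq2: "homotopic_maps A V Z (cmap_comp g p2) (cmap_comp r q2)"
    and e2: "der_comp A \<omega> \<psi> = frc A Y T V (cmap_comp t p2) (cmap_comp h q2)"
    unfolding \<psi> \<omega> by (rule der_comp_frcE[OF t g r h])
  obtain U a b where a: "a \<in> cpx_hom A U W" "quasi_iso U W a" and b: "b \<in> cpx_hom A U V"
    and ab: "homotopic_maps A U Q (cmap_comp q a) (cmap_comp p2 b)"
    by (rule ore[OF q p2])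
  note C = cmap_comp_in_cpx_hom and as = cmap_comp_assoc
  have "homotopic_maps A U Y (cmap_comp f (cmap_comp p a)) (cmap_comp t (cmap_comp q a))"
    using homotopic_comp_right[OF pq C[OF p(1) f] C[OF q t(1)] a(1)] as[OF a(1) p(1) f] as[OF a(1) q t(1)] by simp
  moreover have "homotopic_maps A U Y (cmap_comp t (cmap_comp q a)) (cmap_comp (cmap_comp t p2) b)"
    using homotopic_comp_left[OF ab C[OF a(1) q] C[OF b p2(1)] t(1)] as[OF b p2(1) t(1)] by simp
  ultimately have h1: "homotopic_maps A U Y (cmap_comp f (cmap_comp p a)) (cmap_comp (cmap_comp t p2) b)"
    by (rule homotopic_trans[OF _ _ C[OF C[OF a(1) p(1)] f] C[OF C[OF a(1) q] t(1)] C[OF b C[OF p2(1) t(1)]]])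
  have "homotopic_maps A U Z (cmap_comp (cmap_comp g q) a) (cmap_comp g (cmap_comp p2 b))"
    using homotopic_comp_left[OF ab C[OF a(1) q] C[OF b p2(1)] g] as[OF a(1) q g] by simp
  moreover have "homotopic_maps A U Z (cmap_comp g (cmap_comp p2 b)) (cmap_comp r (cmap_comp q2 b))"
    using homotopic_comp_right[OF pq2 C[OF p2(1) g] C[OF q2 r(1)] b] as[OF b p2(1) g] as[OF b q2 r(1)] by simp
  ultimately have h2: "homotopic_maps A U Z (cmap_comp (cmap_comp g q) a) (cmap_comp r (cmap_comp q2 b))"
    by (rule homotopic_trans[OF _ _ C[OF a(1) C[OF q g]] C[OF C[OF b p2(1)] g] C[OF C[OF b q2] r(1)]])
  have qp: "quasi_iso V Y (cmap_comp t p2)" "quasi_iso U P (cmap_comp p a)" "quasi_iso W X (cmap_comp s p)"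
    using quasi_iso_comp_iff[OF p2(1) t] p2(2) quasi_iso_comp_iff[OF a(1) p] a(2) quasi_iso_comp_iff[OF p(1) s] p(2) by auto
  have "der_comp A (der_comp A \<omega> \<psi>) \<phi> = frc A X T U (cmap_comp s (cmap_comp p a)) (cmap_comp (cmap_comp h q2) b)"
    unfolding e2 \<phi>
    by (rule der_comp_frc[OF s f C[OF p2(1) t(1)] qp(1) C[OF q2 h] C[OF a(1) p(1)] qp(2) b h1])
  moreover have "der_comp A \<omega> (der_comp A \<psi> \<phi>) = frc A X T U (cmap_comp (cmap_comp s p) a) (cmap_comp h (cmap_comp q2 b))"
    unfolding e1 \<omega>
    by (rule der_comp_frc[OF C[OF p(1) s(1)] qp(3) C[OF q g] r h a C[OF b q2] h2])
  ultimately show ?thesis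
    using as[OF a(1) p(1) s(1)] as[OF b q2 h] by simp
qed

lemma roof_shift_simps [simp]:
  "src (roof_shift \<rho>) = cpx_shift (src \<rho>)" "tgt (roof_shift \<rho>) = cpx_shift (tgt \<rho>)"
  "apex (roof_shift \<rho>) = cpx_shift (apex \<rho>)" "bleg (roof_shift \<rho>) = cmap_shift (bleg \<rho>)"
  "fleg (roof_shift \<rho>) = cmap_shift (fleg \<rho>)"
  by (simp_all add: roof_shift_def)

definition roof_unshift :: "('a, 'k::field) roof \<Rightarrow> ('a, 'k) roof" where
  "roof_unshift \<rho> = \<lparr>src = cpx_unshift (src \<rho>), apex = cpx_unshift (apex \<rho>), tgt = cpx_unshift (tgt \<rho>),
     bleg = cmap_unshift (bleg \<rho>), fleg = cmap_unshift (fleg \<rho>)\<rparr>"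

lemma roof_unshift_shift [simp]: "roof_shift (roof_unshift \<rho>) = \<rho>" "roof_unshift (roof_shift \<rho>) = \<rho>"
  by (simp_all add: roof_shift_def roof_unshift_def)

lemma cpx_shift_eq_iff [simp]: "cpx_shift X = cpx_shift Y \<longleftrightarrow> X = Y"
  by (metis shift_unshift(2))

text \<open>Quantifiers over complexes and chain maps may be restricted to shifted ones, which transports
the existential definitions along the shift.\<close>

lemma ex_cpx_shift: "(\<exists>X. P X) \<longleftrightarrow> (\<exists>X. P (cpx_shift X))"
  by (metis shift_unshift(1))

lemma bex_cpx_hom_shift:
  "(\<exists>u \<in> cpx_hom A (cpx_shift X) (cpx_shift Y). P u) \<longleftrightarrow> (\<exists>u \<in> cpx_hom A X Y. P (cmap_shift u))"
  by (metis shift_unshift(3) cpx_hom_shift)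

lemma is_roof_shift [simp]: "is_roof A (roof_shift \<rho>) \<longleftrightarrow> is_roof A \<rho>"
  using quasi_iso_shift[of "bleg \<rho>" A "apex \<rho>" "src \<rho>"] by (auto simp: is_roof_iff)

lemma roof_equiv_shift:
  assumes \<rho>: "is_roof A \<rho>" and \<sigma>: "is_roof A \<sigma>"
  shows "roof_equiv A (roof_shift \<rho>) (roof_shift \<sigma>) \<longleftrightarrow> roof_equiv A \<rho> \<sigma>"
proof (cases "src \<rho> = src \<sigma> \<and> tgt \<rho> = tgt \<sigma>")
  case True
  have r: "is_roof A (roof_shift \<rho>)" "is_roof A (roof_shift \<sigma>)" using assms by simp_all
  have b: "bleg \<rho> \<in> cpx_hom A (apex \<rho>) (src \<rho>)" "bleg \<sigma> \<in> cpx_hom A (apex \<sigma>) (src \<rho>)"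
    "fleg \<rho> \<in> cpx_hom A (apex \<rho>) (tgt \<rho>)" "fleg \<sigma> \<in> cpx_hom A (apex \<sigma>) (tgt \<rho>)"
    using assms True by (simp_all add: is_roof_iff)
  show ?thesis
    unfolding roof_equiv_cpx_hom[OF r] roof_equiv_cpx_hom[OF assms] roof_shift_simps
      ex_cpx_shift[of "\<lambda>W. \<exists>u \<in> cpx_hom A W (cpx_shift (apex \<rho>)). P W u" for P]
      bex_cpx_hom_shift cmap_shift_simps[symmetric] cpx_shift_eq_iff
  proof (intro conj_cong refl ex_cong1 bex_cong)
    fix W u v assume u: "u \<in> cpx_hom A W (apex \<rho>)" and v: "v \<in> cpx_hom A W (apex \<sigma>)"
    note c = cmap_comp_in_cpx_hom[OF u b(1)] cmap_comp_in_cpx_hom[OF v b(2)]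
      cmap_comp_in_cpx_hom[OF u b(3)] cmap_comp_in_cpx_hom[OF v b(4)]
    show "quasi_iso (cpx_shift W) (cpx_shift (src \<rho>)) (cmap_shift (cmap_comp (bleg \<rho>) u)) =
        quasi_iso W (src \<rho>) (cmap_comp (bleg \<rho>) u)"
      by (rule quasi_iso_shift[OF c(1)])
    show "homotopic_maps A (cpx_shift W) (cpx_shift (src \<rho>)) (cmap_shift (cmap_comp (bleg \<rho>) u))
        (cmap_shift (cmap_comp (bleg \<sigma>) v)) = 
        homotopic_maps A W (src \<rho>) (cmap_comp (bleg \<rho>) u) (cmap_comp (bleg \<sigma>) v)"
      by (rule homotopic_shift[OF c(1,2)])
    show "homotopic_maps A (cpx_shift W) (cpx_shift (tgt \<rho>)) (cmap_shift (cmap_comp (fleg \<rho>) u))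
        (cmap_shift (cmap_comp (fleg \<sigma>) v)) = 
        homotopic_maps A W (tgt \<rho>) (cmap_comp (fleg \<rho>) u) (cmap_comp (fleg \<sigma>) v)"
      by (rule homotopic_shift[OF c(3,4)])
  qed
next
  case False
  then show ?thesis by (auto simp: roof_equiv_def)
qed

lemma roof_shift_class:
  assumes "is_roof A \<rho>"
  shows "roof_shift ` roof_class A \<rho> = roof_class A (roof_shift \<rho>)"
proof (intro Set.set_eqI iffI)
  fix \<tau> assume "\<tau> \<in> roof_shift ` roof_class A \<rho>"
  then show "\<tau> \<in> roof_class A (roof_shift \<rho>)"
    using roof_equiv_shift[OF assms] by (auto simp: roof_class_def)
next
  fix \<tau> assume \<tau>: "\<tau> \<in> roof_class A (roof_shift \<rho>)"
  then have i: "is_roof A (roof_unshift \<tau>)"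
    using is_roof_shift[of A "roof_unshift \<tau>"] by (simp add: roof_class_def)
  then have "roof_unshift \<tau> \<in> roof_class A \<rho>"
    using \<tau> roof_equiv_shift[OF assms i] by (simp add: roof_class_def)
  then show "\<tau> \<in> roof_shift ` roof_class A \<rho>"
    by (metis image_eqI roof_unshift_shift(1))
qed

lemma roof_shift_frc:
  assumes "s \<in> cpx_hom A W X" "quasi_iso W X s" "f \<in> cpx_hom A W Y"
  shows "roof_shift ` frc A X Y W s f =
    frc A (cpx_shift X) (cpx_shift Y) (cpx_shift W) (cmap_shift s) (cmap_shift f)"
  using assms unfolding frc_def
  by (subst roof_shift_class) (simp_all add: is_roof_iff roof_shift_def)

lemma roof_shift_der_hom:
  "bij_betw ((`) roof_shift) (der_hom A X Y) (der_hom A (cpx_shift X) (cpx_shift Y))"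
proof (rule bij_betwI')
  show "roof_shift ` \<phi> = roof_shift ` \<psi> \<longleftrightarrow> \<phi> = \<psi>" for \<phi> \<psi> :: "('a, 'b) roof set"
    by (rule inj_image_eq_iff) (metis injI roof_unshift_shift(2))
  show "roof_shift ` \<phi> \<in> der_hom A (cpx_shift X) (cpx_shift Y)" if \<phi>: "\<phi> \<in> der_hom A X Y" for \<phi>
  proof -
    obtain W s f where s: "s \<in> cpx_hom A W X" "quasi_iso W X s" "f \<in> cpx_hom A W Y"
      and e: "\<phi> = frc A X Y W s f" using \<phi> by (rule der_homE)
    show ?thesis unfolding e roof_shift_frc[OF s]
      by (rule frc_in_der_hom) (use s quasi_iso_shift[OF s(1)] in simp_all)
  qed
  show "\<exists>\<phi>\<in>der_hom A X Y. \<psi> = roof_shift ` \<phi>" if \<psi>: "\<psi> \<in> der_hom A (cpx_shift X) (cpx_shift Y)" for \<psi>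
  proof -
    obtain W' s' f' where s': "s' \<in> cpx_hom A W' (cpx_shift X)" "quasi_iso W' (cpx_shift X) s'"
      "f' \<in> cpx_hom A W' (cpx_shift Y)" and e: "\<psi> = frc A (cpx_shift X) (cpx_shift Y) W' s' f'"
      using \<psi> by (rule der_homE)
    define W s f where "W = cpx_unshift W'" "s = cmap_unshift s'" "f = cmap_unshift f'"
    then have eq: "W' = cpx_shift W" "s' = cmap_shift s" "f' = cmap_shift f" by simp_all
    have s: "s \<in> cpx_hom A W X" "f \<in> cpx_hom A W Y" using s'(1,3) unfolding eq by simp_all
    moreover have q: "quasi_iso W X s" using s'(2) quasi_iso_shift[OF s(1)] unfolding eq by simp
    ultimately show ?thesis
      using frc_in_der_hom[OF s(1) q s(2)] roof_shift_frc[OF s(1) q s(2)] unfolding e eq by blast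
  qed
qed

lemma roof_shift_der_comp:
  assumes "\<phi> \<in> der_hom A X Y" "\<psi> \<in> der_hom A Y Z"
  shows "roof_shift ` der_comp A \<psi> \<phi> = der_comp A (roof_shift ` \<psi>) (roof_shift ` \<phi>)"
proof -
  obtain W s f where s: "s \<in> cpx_hom A W X" "quasi_iso W X s" and f: "f \<in> cpx_hom A W Y"
    and \<phi>: "\<phi> = frc A X Y W s f" using assms(1) by (rule der_homE)
  obtain V t g where t: "t \<in> cpx_hom A V Y" "quasi_iso V Y t" and g: "g \<in> cpx_hom A V Z"
    and \<psi>: "\<psi> = frc A Y Z V t g" using assms(2) by (rule der_homE)
  obtain U p q where p: "p \<in> cpx_hom A U W" "quasi_iso U W p" and q: "q \<in> cpx_hom A U V"
    and h: "homotopic_maps A U Y (cmap_comp f p) (cmap_comp t q)"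
    and e: "der_comp A \<psi> \<phi> = frc A X Z U (cmap_comp s p) (cmap_comp g q)"
    unfolding \<phi> \<psi> by (rule der_comp_frcE[OF s f t g])
  note C = cmap_comp_in_cpx_hom
  have sp: "quasi_iso U X (cmap_comp s p)" using quasi_iso_comp_iff[OF p(1) s] p(2) by simp
  have h': "homotopic_maps A (cpx_shift U) (cpx_shift Y) (cmap_comp (cmap_shift f) (cmap_shift p))
      (cmap_comp (cmap_shift t) (cmap_shift q))"
    using h homotopic_shift[OF C[OF p(1) f] C[OF q t(1)]] by (simp add: cmap_shift_simps)
  have "der_comp A (roof_shift ` \<psi>) (roof_shift ` \<phi>) = frc A (cpx_shift X) (cpx_shift Z) (cpx_shift U)
      (cmap_comp (cmap_shift s) (cmap_shift p)) (cmap_comp (cmap_shift g) (cmap_shift q))"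
    unfolding \<phi> \<psi> roof_shift_frc[OF s f] roof_shift_frc[OF t g]
    by (rule der_comp_frc[OF _ _ _ _ _ _ _ _ _ h'])
       (use s f t g p q quasi_iso_shift[OF s(1)] quasi_iso_shift[OF t(1)] quasi_iso_shift[OF p(1)] in simp_all)
  then show ?thesis
    unfolding e roof_shift_frc[OF C[OF p(1) s(1)] sp C[OF q g]] by (simp add: cmap_shift_simps)
qed

lemma frc_zero_iff:
  assumes s: "s \<in> cpx_hom A W X" "quasi_iso W X s" and f: "f \<in> cpx_hom A W Y"
  shows "frc A X Y W s f = frc A X Y X (cmap_id X) (zero_map X Y) \<longleftrightarrow>
    (\<exists>V. \<exists>t \<in> cpx_hom A V W. quasi_iso V W t \<and> homotopic_maps A V Y (cmap_comp f t) (zero_map V Y))"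
proof -
  have X: "bdd_complex A X" and Y: "bdd_complex A Y" using cpx_homD(2)[OF s(1)] cpx_homD(2)[OF f] by auto
  note i = cmap_id_in_cpx_hom[OF X] quasi_iso_id[OF X] and z = zero_map_hom[OF X Y]
  note C = cmap_comp_in_cpx_hom
  show ?thesis
  proof
    assume "frc A X Y W s f = frc A X Y X (cmap_id X) (zero_map X Y)"
    then have e: "K.frac_eq A (W, hclass A W X s, hclass A W Y f) (X, hclass A X X (cmap_id X), hclass A X Y (zero_map X Y))"
      using frc_eq_iff[OF s f i z] by blast
    have fr: "K.frac A X Y (W, hclass A W X s, hclass A W Y f)"
      "K.frac A X Y (X, hclass A X X (cmap_id X), hclass A X Y (zero_map X Y))"
      using s f i z by (auto simp: K.frac_def hclass_in_hqis hclass_in_hhom)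
    obtain V u v where uv: "u \<in> hhom A V W" "v \<in> hhom A V X" "u \<in> hqis A"
      "hcomp A (hclass A W Y f) u = hcomp A (hclass A X Y (zero_map X Y)) v"
      by (rule K.frac_eqE[OF e fr])
    obtain t where t: "t \<in> cpx_hom A V W" "u = hclass A V W t" using uv(1) by (rule hhomE)
    obtain k where k: "k \<in> cpx_hom A V X" "v = hclass A V X k" using uv(2) by (rule hhomE)
    have "quasi_iso V W t" using uv(3) t hclass_in_hqis by metis
    moreover have "homotopic_maps A V Y (cmap_comp f t) (zero_map V Y)"
      using uv(4) hcomp_hclass[OF t(1) f] hcomp_hclass[OF k(1) z] zero_map_comp(1)[OF k(1) Y]
        hclass_eq_iff[OF C[OF t(1) f] zero_map_hom[OF cpx_homD(1)[OF t(1)] Y]] t(2) k(2) by simp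
    ultimately show "\<exists>V. \<exists>t \<in> cpx_hom A V W. quasi_iso V W t \<and>
        homotopic_maps A V Y (cmap_comp f t) (zero_map V Y)" using t(1) by blast
  next
    assume "\<exists>V. \<exists>t \<in> cpx_hom A V W. quasi_iso V W t \<and> homotopic_maps A V Y (cmap_comp f t) (zero_map V Y)"
    then obtain V t where t: "t \<in> cpx_hom A V W" "quasi_iso V W t"
      "homotopic_maps A V Y (cmap_comp f t) (zero_map V Y)" by blast
    have V: "bdd_complex A V" using cpx_homD(1)[OF t(1)] .
    note st = C[OF t(1) s(1)]
    have q: "quasi_iso V X (cmap_comp s t)" using quasi_iso_comp_iff[OF t(1) s] t(2) by simp
    have "frc A X Y W s f = frc A X Y V (cmap_comp s t) (cmap_comp f t)"
      by (rule frc_refine[OF s f t(1,2)])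
    also have "\<dots> = frc A X Y V (cmap_comp s t) (zero_map V Y)"
      by (rule frc_homotopic[OF st q C[OF t(1) f] zero_map_hom[OF V Y] t(3)])
    also have "\<dots> = frc A X Y X (cmap_id X) (zero_map X Y)"
      using frc_refine[OF i z st q] cmap_comp_id(2)[OF st] zero_map_comp(1)[OF st Y] by simp
    finally show "frc A X Y W s f = frc A X Y X (cmap_id X) (zero_map X Y)" .
  qed
qed

text \<open>A roof represents the zero morphism iff its forward leg is null-homotopic on a refinement of the
apex; the morphism set is a singleton iff this holds for all roofs.\<close>

lemma hom_zero_derived_iff:
  assumes X: "bdd_complex A X" and Y: "bdd_complex A Y"
  shows "hom_zero (derived_cat A) X Y \<longleftrightarrow> (\<forall>W. \<forall>s \<in> cpx_hom A W X. \<forall>f \<in> cpx_hom A W Y. quasi_iso W X s \<longrightarrow>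
    (\<exists>V. \<exists>t \<in> cpx_hom A V W. quasi_iso V W t \<and> homotopic_maps A V Y (cmap_comp f t) (zero_map V Y)))"
    (is "_ \<longleftrightarrow> ?R")
proof
  let ?z = "frc A X Y X (cmap_id X) (zero_map X Y)"
  have z: "?z \<in> der_hom A X Y" by (rule frc_id_in[OF zero_map_hom[OF X Y]])
  {
    assume h: "hom_zero (derived_cat A) X Y"
    show ?R
    proof (intro allI ballI impI)
      fix W s f assume s: "s \<in> cpx_hom A W X" and f: "f \<in> cpx_hom A W Y" and q: "quasi_iso W X s"
      have "frc A X Y W s f = ?z"
        using h z frc_in_der_hom[OF s q f] by (auto simp: hom_zero_def is_singleton_def)
      then show "\<exists>V. \<exists>t \<in> cpx_hom A V W. quasi_iso V W t \<and> homotopic_maps A V Y (cmap_comp f t) (zero_map V Y)"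
        using frc_zero_iff[OF s q f] by simp
    qed
  next
    assume R: ?R
    have "\<phi> = ?z" if \<phi>: "\<phi> \<in> der_hom A X Y" for \<phi>
    proof -
      obtain W s f where s: "s \<in> cpx_hom A W X" "quasi_iso W X s" and f: "f \<in> cpx_hom A W Y"
        and e: "\<phi> = frc A X Y W s f" using \<phi> by (rule der_homE)
      show ?thesis unfolding e using frc_zero_iff[OF s f] R s f by blast
    qed
    then show "hom_zero (derived_cat A) X Y"
      unfolding hom_zero_def derived_cat_simps using z by (intro is_singletonI') auto
  }
qed

lemma acyclic_of_quasi_iso:
  assumes "s \<in> cpx_hom A W X" "quasi_iso W X s" "acyclic_cpx X"
  shows "acyclic_cpx W"
  unfolding acyclic_cpx_def
proof (intro allI subsetI)
  fix i x assume x: "x \<in> cocyc W i"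
  then have "mop (s i) x \<in> cobnd X i"
    using cpx_hom_cocyc[OF assms(1) x] assms(3) unfolding acyclic_cpx_def by blast
  then show "x \<in> cobnd W i" by (rule quasi_isoD(1)[OF assms(2,1) x])
qed

lemma zero_object_of_acyclic:
  assumes Z: "bdd_complex A Z" and ac: "acyclic_cpx Z"
  shows "zero_object (derived_cat A) Z"
proof -
  have "hom_zero (derived_cat A) Z T \<and> hom_zero (derived_cat A) T Z" if T: "bdd_complex A T" for T
  proof
    show "hom_zero (derived_cat A) T Z"
      unfolding hom_zero_derived_iff[OF T Z]
    proof (intro allI ballI impI)
      fix W s f assume f: "f \<in> cpx_hom A W Z"
      obtain V t where "t \<in> cpx_hom A V W" "quasi_iso V W t" "homotopic_maps A V Z (cmap_comp f t) (zero_map V Z)"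
        by (rule cocone[OF f ac])
      then show "\<exists>V. \<exists>t\<in>cpx_hom A V W. quasi_iso V W t \<and> homotopic_maps A V Z (cmap_comp f t) (zero_map V Z)"
        by blast
    qed
    show "hom_zero (derived_cat A) Z T"
      unfolding hom_zero_derived_iff[OF Z T]
    proof (intro allI ballI impI)
      fix W s f assume s: "s \<in> cpx_hom A W Z" and f: "f \<in> cpx_hom A W T" and q: "quasi_iso W Z s"
      have W: "bdd_complex A W" using cpx_homD(1)[OF f] .
      obtain V t where t: "t \<in> cpx_hom A V W" "quasi_iso V W t"
        "homotopic_maps A V W (cmap_comp (cmap_id W) t) (zero_map V W)"
        by (rule cocone[OF cmap_id_in_cpx_hom[OF W] acyclic_of_quasi_iso[OF s q ac]])
      have V: "bdd_complex A V" using cpx_homD(1)[OF t(1)] .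
      have "homotopic_maps A V W t (zero_map V W)" using t(3) cmap_comp_id(2)[OF t(1)] by simp
      then have "homotopic_maps A V T (cmap_comp f t) (cmap_comp f (zero_map V W))"
        by (rule homotopic_comp_left[OF _ t(1) zero_map_hom[OF V W] f])
      then show "\<exists>V. \<exists>t\<in>cpx_hom A V W. quasi_iso V W t \<and> homotopic_maps A V T (cmap_comp f t) (zero_map V T)"
        using t zero_map_comp(2)[OF f V] by auto
    qed
  qed
  then show ?thesis using Z by (simp add: zero_object_def hom_zero_def)
qed

lemma shifted_category_derived: "shifted_category (derived_cat A)"
proof
  let ?D = "derived_cat A"
  fix X Y Z W :: "('a, 'b) cpx"
  show "f \<in> homs ?D X Y \<Longrightarrow> X \<in> objs ?D \<and> Y \<in> objs ?D" for f
    using cpx_homD(2) by (auto elim!: der_homE)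
  show "f \<in> homs ?D X Y \<Longrightarrow> g \<in> homs ?D Y Z \<Longrightarrow>
     cmp ?D g f \<in> homs ?D X Z" for f g
    using der_comp_in by simp
  show "f \<in> homs ?D X Y \<Longrightarrow> g \<in> homs ?D Y Z \<Longrightarrow> h \<in> homs ?D Z W \<Longrightarrow>
    cmp ?D (cmp ?D h g) f = cmp ?D h (cmp ?D g f)" for f g h
    using der_comp_assoc by simp
  show "X \<in> objs ?D \<Longrightarrow> idt ?D X \<in> homs ?D X X"
    using frc_id_in[OF cmap_id_in_cpx_hom] by simp
  show "f \<in> homs ?D X Y \<Longrightarrow> cmp ?D f (idt ?D X) = f" for f
    using der_comp_id(1) by simp
  show "f \<in> homs ?D X Y \<Longrightarrow> cmp ?D (idt ?D Y) f = f" for f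
    using der_comp_id(2) by simp
  show "bij_betw (sus ?D) (objs ?D) (objs ?D)"
    by (rule bij_betw_byWitness[where f' = cpx_unshift]) auto
  have "susm ?D = (`) roof_shift" by (simp add: fun_eq_iff)
  then show "bij_betw (susm ?D) (homs ?D X Y)
     (homs ?D (sus ?D X) (sus ?D Y))"
    using roof_shift_der_hom[of A X Y] by (simp only: derived_cat_simps)
  show "f \<in> homs ?D X Y \<Longrightarrow> g \<in> homs ?D Y Z \<Longrightarrow>
     susm ?D (cmp ?D g f) = cmp ?D (susm ?D g) (susm ?D f)" for f g
    using roof_shift_der_comp by simp
  show "X \<in> objs ?D \<Longrightarrow> susm ?D (idt ?D X) = idt ?D (sus ?D X)"
    using roof_shift_frc[OF cmap_id_in_cpx_hom quasi_iso_id cmap_id_in_cpx_hom]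
    by (simp add: cmap_shift_simps)
  show "\<exists>Z. zero_object ?D Z"
    using zero_object_of_acyclic[OF bdd_complex_zero acyclic_zero] by blast
qed

section \<open>Triangles of the derived category\<close>

interpretation DC: shifted_category "derived_cat A" for A :: "('a, 'k::field) kalgebra"
  by (rule shifted_category_derived)

text \<open>The identity becomes null-homotopic along a quasi-isomorphism \<open>t\<close>, so the zero map into \<open>Z\<close> is
homotopic to \<open>t\<close> and surjective on cohomology.\<close>

lemma acyclic_of_zero_object:
  assumes "zero_object (derived_cat A) Z"
  shows "acyclic_cpx Z"
proof -
  have Z: "bdd_complex A Z" and h: "hom_zero (derived_cat A) Z Z"
    using assms DC.zero_object_iff by (auto simp: zero_object_def)
  note i = cmap_id_in_cpx_hom[OF Z] quasi_iso_id[OF Z]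
  obtain V t where t: "t \<in> cpx_hom A V Z" "quasi_iso V Z t"
    "homotopic_maps A V Z (cmap_comp (cmap_id Z) t) (zero_map V Z)"
    using h i unfolding hom_zero_derived_iff[OF Z Z] by blast
  have V: "bdd_complex A V" using cpx_homD(1)[OF t(1)] .
  note z = zero_map_hom[OF V Z]
  have q: "quasi_iso V Z (zero_map V Z)"
    using quasi_iso_homotopic[OF _ t(1) z] t cmap_comp_id(2)[OF t(1)] by simp
  show ?thesis
    unfolding acyclic_cpx_def
  proof (intro allI subsetI)
    fix i y assume "y \<in> cocyc Z i"
    then obtain x where "y - mop (zero_map V Z i) x \<in> cobnd Z i" using quasi_isoD(2)[OF q z] by blast
    then show "y \<in> cobnd Z i" by simp
  qed
qed

lemma isomorphic_of_quasi_iso: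
  assumes f: "f \<in> cpx_hom A X Y" and q: "quasi_iso X Y f"
  shows "isomorphic (derived_cat A) X Y"
proof -
  have X: "bdd_complex A X" and Y: "bdd_complex A Y" using cpx_homD(1,2)[OF f] .
  note i = cmap_id_in_cpx_hom[OF X] quasi_iso_id[OF X] and j = cmap_id_in_cpx_hom[OF Y] quasi_iso_id[OF Y]
  let ?f = "frc A X Y X (cmap_id X) f" and ?g = "frc A Y X X f (cmap_id X)"
  have "der_comp A ?g ?f = frc A X X X (cmap_id X) (cmap_id X)"
    using der_comp_frc[OF i f f q i(1) i i(1)] cmap_comp_id[OF f] cmap_comp_id[OF i(1)] homotopic_refl[OF f] by simp
  moreover have "der_comp A ?f ?g = frc A Y Y X f f"
    using der_comp_frc[OF f q i(1) i f i i(1)] cmap_comp_id[OF f] cmap_comp_id[OF i(1)] homotopic_refl[OF i(1)] by simp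
  moreover have "frc A Y Y X f f = frc A Y Y Y (cmap_id Y) (cmap_id Y)"
    using frc_refine[OF j j(1) f q] cmap_comp_id[OF f] by simp
  ultimately show ?thesis
    using frc_id_in[OF f] frc_in_der_hom[OF f q i(1)]
    unfolding isomorphic_def is_iso_def derived_cat_simps by metis
qed

lemma quasi_iso_of_acyclic_cone:
  fixes X :: "('a, 'k::field) cpx"
  assumes f: "f \<in> cpx_hom A X Y" and ac: "acyclic_cpx (cone X Y f)"
  shows "quasi_iso X Y f"
proof (rule quasi_isoI[OF f])
  note [simp] = cpx_homD[OF f] bdd_complex_dims[of A X] bdd_complex_dims[of A Y]
  fix i
  {
    fix x assume x: "x \<in> cocyc X i" and "mop (f i) x \<in> cobnd Y i"
    then obtain b where b: "mop (f i) x = mop (df Y (i - 1)) b" by (auto simp: cobnd_def)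
    have rx: "restr (cdim X (i - 1 + 1)) x = x" using x by (simp add: cocyc_def)
    have "x + pushr (cdim X (i - 1 + 1)) (- restr (cdim Y (i - 1)) b) \<in> cocyc (cone X Y f) (i - 1)"
      using x by (subst cone_cocyc[OF f rx]) (simp_all add: b mop_restr)
    then have "x + pushr (cdim X (i - 1 + 1)) (- restr (cdim Y (i - 1)) b) \<in> cobnd (cone X Y f) (i - 1)"
      using ac unfolding acyclic_cpx_def by blast
    then obtain a' where "x = - mop (df X (i - 1)) a'"
      unfolding cone_cobnd[OF f rx] by blast
    then have "x = mop (df X (i - 1)) (- a')" by simp
    then show "x \<in> cobnd X i" by (metis cobndI(1))
  next
    fix y assume y: "y \<in> cocyc Y i"
    then have ry: "restr (cdim Y i) y = y" by (simp add: cocyc_def)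
    have r0: "restr (cdim X (i + 1)) 0 = (0 :: 'k seqv)" by simp
    have "0 + pushr (cdim X (i + 1)) y \<in> cocyc (cone X Y f) i"
      using y by (subst cone_cocyc[OF f r0 ry]) (simp_all add: cocyc_def)
    then have "0 + pushr (cdim X (i + 1)) y \<in> cobnd (cone X Y f) i"
      using ac unfolding acyclic_cpx_def by blast
    then obtain a' b' where ab: "0 = - mop (df X i) a'" "y = mop (f i) a' + mop (df Y (i - 1)) b'"
      unfolding cone_cobnd[OF f r0] by blast
    have "restr (cdim X i) a' \<in> cocyc X i" using ab(1) by (simp add: cocyc_def mop_restr)
    moreover have "y - mop (f i) (restr (cdim X i) a') \<in> cobnd Y i"
      using ab(2) by (simp add: mop_restr cobndI)
    ultimately show "\<exists>x\<in>cocyc X i. y - mop (f i) x \<in> cobnd Y i" by blast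
  }
qed

lemma is_iso_derived_data: "is_iso (derived_cat_data A) = is_iso (derived_cat A)"
  by (simp add: is_iso_def fun_eq_iff derived_cat_def Let_def)

text \<open>The two records \<open>derived_cat_data A\<close> and \<open>derived_cat A\<close> differ in the field \<open>tris\<close> only, so the
definition of the triangles may be read in the derived category itself.\<close>

lemma tris_derived_iff:
  "(X, Y, Z, u, v, w) \<in> tris (derived_cat A) \<longleftrightarrow>
     bdd_complex A X \<and> bdd_complex A Y \<and> bdd_complex A Z \<and>
     u \<in> der_hom A X Y \<and> v \<in> der_hom A Y Z \<and> w \<in> der_hom A Z (cpx_shift X) \<and>
     (\<exists>X' Y' f a b c. bdd_complex A X' \<and> bdd_complex A Y' \<and> f \<in> chain_maps A X' Y' \<and>
        is_iso (derived_cat A) X X' a \<and> is_iso (derived_cat A) Y Y' b \<and>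
        is_iso (derived_cat A) Z (cone X' Y' f) c \<and>
        der_comp A b u = der_comp A (der_map A X' Y' f) a \<and>
        der_comp A c v = der_comp A (der_map A Y' (cone X' Y' f) (cone_in X' Y')) b \<and>
        der_comp A (roof_shift ` a) w =
          der_comp A (der_map A (cone X' Y' f) (cpx_shift X') (cone_out X' Y')) c)"
proof -
  let ?E = "derived_cat_data A"
  have E: "objs ?E = {X. bdd_complex A X}" "homs ?E = der_hom A" "cmp ?E = der_comp A"
    "sus ?E = cpx_shift" "susm ?E = (\<lambda>\<phi>. roof_shift ` \<phi>)"
    by (simp_all add: derived_cat_data_def)
  show ?thesis
    unfolding is_iso_derived_data[symmetric]
    by (simp add: derived_cat_def[of A] Let_def E)
qed

text \<open>Vanishing of \<open>Hom\<close>-sets is invariant under isomorphism of objects, so three isomorphisms to a cone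
triangle suffice to carry statements about cones over to all distinguished triangles.\<close>

lemma tris_derivedE:
  assumes "(X, Y, Z, u, v, w) \<in> tris (derived_cat A)"
  obtains X' Y' f where "X \<in> objs (derived_cat A)" "Y \<in> objs (derived_cat A)" "Z \<in> objs (derived_cat A)"
    "f \<in> cpx_hom A X' Y'" "isomorphic (derived_cat A) X X'" "isomorphic (derived_cat A) Y Y'"
    "isomorphic (derived_cat A) Z (cone X' Y' f)"
proof -
  have o: "X \<in> objs (derived_cat A)" "Y \<in> objs (derived_cat A)" "Z \<in> objs (derived_cat A)"
    using assms unfolding tris_derived_iff by simp_all
  obtain X' Y' f a b c where "f \<in> cpx_hom A X' Y'" "is_iso (derived_cat A) X X' a"
    "is_iso (derived_cat A) Y Y' b" "is_iso (derived_cat A) Z (cone X' Y' f) c"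
    using assms unfolding tris_derived_iff cpx_hom_def by blast
  then show ?thesis using that[OF o] unfolding isomorphic_def by blast
qed

lemma cone_triangle:
  assumes f: "f \<in> cpx_hom A X Y"
  shows "(X, Y, cone X Y f, der_map A X Y f, der_map A Y (cone X Y f) (cone_in X Y),
    der_map A (cone X Y f) (cpx_shift X) (cone_out X Y)) \<in> tris (derived_cat A)"
proof -
  let ?C = "cone X Y f" and ?D = "derived_cat A"
  have b: "bdd_complex A X" "bdd_complex A Y" "bdd_complex A ?C"
    using cpx_homD(1,2)[OF f] bdd_complex_cone[OF f] by auto
  have id: "is_iso ?D T T (idt ?D T)" if "bdd_complex A T" for T
    unfolding is_iso_def
  proof (intro conjI bexI)
    have T: "T \<in> objs ?D" using that by simp
    show i: "idt ?D T \<in> homs ?D T T" "idt ?D T \<in> homs ?D T T" using DC.idt_in[OF T] by auto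
    show "cmp ?D (idt ?D T) (idt ?D T) = idt ?D T" "cmp ?D (idt ?D T) (idt ?D T) = idt ?D T"
      using DC.idt_cmp[OF i(1)] by auto
  qed
  have h: "der_map A X Y f \<in> der_hom A X Y" "der_map A Y ?C (cone_in X Y) \<in> der_hom A Y ?C"
    "der_map A ?C (cpx_shift X) (cone_out X Y) \<in> der_hom A ?C (cpx_shift X)"
    unfolding der_map_frc
    using frc_id_in[OF f] frc_id_in[OF cone_in_hom[OF f]] frc_id_in[OF cone_out_hom[OF f]] by auto
  have sid: "roof_shift ` idt ?D X = idt ?D (cpx_shift X)"
    using DC.susm_idt[of X A] b(1) by (simp del: derived_cat_simps(5))
  have comp: "der_comp A (idt ?D T') \<phi> = der_comp A \<phi> (idt ?D T)" if "\<phi> \<in> der_hom A T T'" for \<phi> T T'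
    using der_comp_id[OF that] by simp
  show ?thesis
    unfolding tris_derived_iff
    by (intro conjI b h exI[of _ X] exI[of _ Y] exI[of _ f] exI[of _ "idt ?D X"] exI[of _ "idt ?D Y"]
        exI[of _ "idt ?D ?C"] id cpx_homD(3)[OF f] comp)
       (simp only: sid comp[OF h(3)])
qed

text \<open>Exactness of \<open>Hom(-, T)\<close>. Let \<open>Y \<leftarrow> W \<rightarrow> T\<close> be a roof with legs \<open>s\<close> and \<open>g\<close>. Pulling \<open>f\<close> back along
\<open>s\<close> gives \<open>q : P \<rightarrow> W\<close> over a quasi-isomorphism \<open>P \<rightarrow> X\<close>, and \<open>g \<circ> q\<close> is null-homotopic after a
refinement because \<open>Hom(X, T) = 0\<close>. So \<open>g\<close> extends to \<open>cone q\<close>, which is quasi-isomorphic to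
\<open>cone f\<close>; since \<open>Hom(cone f, T) = 0\<close>, the extension vanishes on a refinement, and so does \<open>g\<close>.\<close>

lemma hom_zero_from_cone:
  assumes f: "f \<in> cpx_hom A X Y" and T: "bdd_complex A T"
    and hX: "hom_zero (derived_cat A) X T" and hC: "hom_zero (derived_cat A) (cone X Y f) T"
  shows "hom_zero (derived_cat A) Y T"
proof -
  let ?C = "cone X Y f"
  have X: "bdd_complex A X" and Y: "bdd_complex A Y" using cpx_homD(1,2)[OF f] .
  have C: "bdd_complex A ?C" by (rule bdd_complex_cone[OF f])
  note cc = cmap_comp_in_cpx_hom and as = cmap_comp_assoc
  show ?thesis
    unfolding hom_zero_derived_iff[OF Y T]
  proof (intro allI ballI impI)
    fix W s g assume s: "s \<in> cpx_hom A W Y" and g: "g \<in> cpx_hom A W T" and qs: "quasi_iso W Y s"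
    obtain P p q where p: "p \<in> cpx_hom A P X" "quasi_iso P X p" and q: "q \<in> cpx_hom A P W"
      and pq: "homotopic_maps A P Y (cmap_comp f p) (cmap_comp s q)"
      by (rule ore[OF f s qs])
    obtain P' t where t: "t \<in> cpx_hom A P' P" "quasi_iso P' P t"
      and n: "homotopic_maps A P' T (cmap_comp (cmap_comp g q) t) (zero_map P' T)"
      using hX p cc[OF q g] unfolding hom_zero_derived_iff[OF X T] by blast
    define p1 q1 where "p1 = cmap_comp p t" "q1 = cmap_comp q t"
    have p1: "p1 \<in> cpx_hom A P' X" and q1: "q1 \<in> cpx_hom A P' W"
      unfolding p1_q1_def using cc[OF t(1) p(1)] cc[OF t(1) q] by auto
    have qp1: "quasi_iso P' X p1" unfolding p1_q1_def using quasi_iso_comp_iff[OF t(1) p] t(2) by simp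
    have n1: "homotopic_maps A P' T (cmap_comp g q1) (zero_map P' T)"
      using n as[OF t(1) q g] unfolding p1_q1_def by simp
    have "homotopic_maps A P' Y (cmap_comp f p1) (cmap_comp s q1)"
      using homotopic_comp_right[OF pq cc[OF p(1) f] cc[OF q s] t(1)] as[OF t(1) p(1) f] as[OF t(1) q s]
      unfolding p1_q1_def by simp
    then have pq1: "homotopic_maps A P' Y (cmap_comp s q1) (cmap_comp f p1)"
      by (rule homotopic_sym[OF _ cc[OF p1 f] cc[OF q1 s]])
    obtain G where G: "G \<in> cpx_hom A (cone P' W q1) T" "cmap_comp G (cone_in P' W) = g"
      by (rule extend_over_cone[OF q1 g n1])
    obtain \<phi> where \<phi>: "\<phi> \<in> cpx_hom A (cone P' W q1) ?C" "quasi_iso (cone P' W q1) ?C \<phi>"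
      by (rule quasi_iso_cone_map[OF f q1 p1 s qp1 qs pq1])
    obtain V k where k: "k \<in> cpx_hom A V (cone P' W q1)" "quasi_iso V (cone P' W q1) k"
      and n2: "homotopic_maps A V T (cmap_comp G k) (zero_map V T)"
      using hC \<phi> G(1) unfolding hom_zero_derived_iff[OF C T] by blast
    note ci = cone_in_hom[OF q1]
    obtain U u l where u: "u \<in> cpx_hom A U W" "quasi_iso U W u" and l: "l \<in> cpx_hom A U V"
      and ul: "homotopic_maps A U (cone P' W q1) (cmap_comp (cone_in P' W) u) (cmap_comp k l)"
      by (rule ore[OF ci k])
    have V: "bdd_complex A V" and U: "bdd_complex A U" using cpx_homD(1)[OF k(1)] cpx_homD(1)[OF l] by auto
    have "homotopic_maps A U T (cmap_comp g u) (cmap_comp (cmap_comp G k) l)"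
      using homotopic_comp_left[OF ul cc[OF u(1) ci] cc[OF l k(1)] G(1)] as[OF u(1) ci G(1)] as[OF l k(1) G(1)] G(2)
      by simp
    moreover have "homotopic_maps A U T (cmap_comp (cmap_comp G k) l) (zero_map U T)"
      using homotopic_comp_right[OF n2 cc[OF k(1) G(1)] zero_map_hom[OF V T] l] zero_map_comp(1)[OF l T] by simp
    ultimately have "homotopic_maps A U T (cmap_comp g u) (zero_map U T)"
      by (rule homotopic_trans[OF _ _ cc[OF u(1) g] cc[OF l cc[OF k(1) G(1)]] zero_map_hom[OF U T]])
    then show "\<exists>V. \<exists>t\<in>cpx_hom A V W. quasi_iso V W t \<and> homotopic_maps A V T (cmap_comp g t) (zero_map V T)"
      using u by blast
  qed
qed

text \<open>Exactness of \<open>Hom(T, -)\<close>. For a roof \<open>T \<leftarrow> W \<rightarrow> Y\<close>, the map \<open>W \<rightarrow> Y \<rightarrow> cone f\<close> is null-homotopic on a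
refinement, where \<open>W \<rightarrow> Y\<close> thus factors through \<open>f\<close>; the factor in turn vanishes on a refinement.\<close>

lemma hom_zero_to_cone:
  assumes f: "f \<in> cpx_hom A X Y" and T: "bdd_complex A T"
    and hX: "hom_zero (derived_cat A) T X" and hC: "hom_zero (derived_cat A) T (cone X Y f)"
  shows "hom_zero (derived_cat A) T Y"
proof -
  let ?C = "cone X Y f"
  have X: "bdd_complex A X" and Y: "bdd_complex A Y" using cpx_homD(1,2)[OF f] .
  have C: "bdd_complex A ?C" by (rule bdd_complex_cone[OF f])
  note cc = cmap_comp_in_cpx_hom and as = cmap_comp_assoc and ci = cone_in_hom[OF f]
  show ?thesis
    unfolding hom_zero_derived_iff[OF T Y]
  proof (intro allI ballI impI)
    fix W s g assume s: "s \<in> cpx_hom A W T" and g: "g \<in> cpx_hom A W Y" and qs: "quasi_iso W T s"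
    obtain V t where t: "t \<in> cpx_hom A V W" "quasi_iso V W t"
      and n: "homotopic_maps A V ?C (cmap_comp (cmap_comp (cone_in X Y) g) t) (zero_map V ?C)"
      using hC s qs cc[OF g ci] unfolding hom_zero_derived_iff[OF T C] by blast
    have "homotopic_maps A V ?C (cmap_comp (cone_in X Y) (cmap_comp g t)) (zero_map V ?C)"
      using n as[OF t(1) g ci] by simp
    then obtain a where a: "a \<in> cpx_hom A V X" "homotopic_maps A V Y (cmap_comp g t) (cmap_comp f a)"
      by (rule factor_through_cone_source[OF f cc[OF t(1) g]])
    have "quasi_iso V T (cmap_comp s t)" using quasi_iso_comp_iff[OF t(1) s qs] t(2) by simp
    then obtain U u where u: "u \<in> cpx_hom A U V" "quasi_iso U V u"
      and n2: "homotopic_maps A U X (cmap_comp a u) (zero_map U X)"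
      using hX cc[OF t(1) s] a(1) unfolding hom_zero_derived_iff[OF T X] by blast
    have U: "bdd_complex A U" using cpx_homD(1)[OF u(1)] .
    have "homotopic_maps A U Y (cmap_comp g (cmap_comp t u)) (cmap_comp f (cmap_comp a u))"
      using homotopic_comp_right[OF a(2) cc[OF t(1) g] cc[OF a(1) f] u(1)] as[OF u(1) t(1) g] as[OF u(1) a(1) f] by simp
    moreover have "homotopic_maps A U Y (cmap_comp f (cmap_comp a u)) (zero_map U Y)"
      using homotopic_comp_left[OF n2 cc[OF u(1) a(1)] zero_map_hom[OF U X] f] zero_map_comp(2)[OF f U] by simp
    ultimately have "homotopic_maps A U Y (cmap_comp g (cmap_comp t u)) (zero_map U Y)"
      by (rule homotopic_trans[OF _ _ cc[OF cc[OF u(1) t(1)] g] cc[OF cc[OF u(1) a(1)] f] zero_map_hom[OF U Y]])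
    moreover have "quasi_iso U W (cmap_comp t u)" using quasi_iso_comp_iff[OF u(1) t] u(2) by simp
    ultimately show "\<exists>V. \<exists>t\<in>cpx_hom A V W. quasi_iso V W t \<and> homotopic_maps A V Y (cmap_comp g t) (zero_map V Y)"
      using cc[OF u(1) t(1)] by blast
  qed
qed

lemma triangle_category_derived: "triangle_category (derived_cat A)"
proof
  fix X Y Z T :: "('a, 'b) cpx" and u v w
  let ?D = "derived_cat A"
  assume tri: "(X, Y, Z, u, v, w) \<in> tris ?D"
  obtain X' Y' f where o: "X \<in> objs ?D" "Y \<in> objs ?D" "Z \<in> objs ?D"
    and f: "f \<in> cpx_hom A X' Y'" and iX: "isomorphic ?D X X'" and iY: "isomorphic ?D Y Y'"
    and iZ: "isomorphic ?D Z (cone X' Y' f)" using tri by (rule tris_derivedE)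
  show "X \<in> objs ?D \<and> Y \<in> objs ?D \<and> Z \<in> objs ?D" using o by simp
  show "hom_zero ?D Y T" if "T \<in> objs ?D" "hom_zero ?D X T" "hom_zero ?D Z T"
  proof (rule DC.hom_zero_iso_from[OF DC.isomorphic_sym[OF iY]], rule hom_zero_from_cone[OF f])
    show "bdd_complex A T" using that(1) by simp
  qed (use DC.hom_zero_iso_from[OF iX] DC.hom_zero_iso_from[OF iZ] that in blast)+
  show "hom_zero ?D T Y" if "T \<in> objs ?D" "hom_zero ?D T X" "hom_zero ?D T Z"
  proof (rule DC.hom_zero_iso_to[OF DC.isomorphic_sym[OF iY]], rule hom_zero_to_cone[OF f])
    show "bdd_complex A T" using that(1) by simp
  qed (use DC.hom_zero_iso_to[OF iX] DC.hom_zero_iso_to[OF iZ] that in blast)+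
  show "isomorphic ?D X Y" if "zero_object ?D Z"
  proof -
    have "acyclic_cpx (cone X' Y' f)"
      by (rule acyclic_of_zero_object[OF DC.zero_object_iso[OF that iZ]])
    then have "isomorphic ?D X' Y'"
      by (rule isomorphic_of_quasi_iso[OF f quasi_iso_of_acyclic_cone[OF f]])
    then show ?thesis
      using DC.isomorphic_trans[OF iX] DC.isomorphic_trans[OF _ DC.isomorphic_sym[OF iY]] by blast
  qed
next
  fix X :: "('a, 'b) cpx"
  let ?D = "derived_cat A"
  assume "X \<in> objs ?D"
  then have X: "bdd_complex A X" by simp
  note i = cmap_id_in_cpx_hom[OF X] quasi_iso_id[OF X]
  show "\<exists>Z u v w. zero_object ?D Z \<and> (X, X, Z, u, v, w) \<in> tris ?D"
    using zero_object_of_acyclic[OF bdd_complex_cone[OF i(1)] acyclic_cone[OF i]] cone_triangle[OF i(1)] by blast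
  note z = zero_map_hom[OF bdd_complex_zero X]
  have "isomorphic ?D X (cone zero_cpx X (zero_map zero_cpx X))"
    by (rule isomorphic_of_quasi_iso[OF cone_in_hom[OF z] quasi_iso_cone_in[OF z acyclic_zero]])
  then show "\<exists>Z' Z u v w. zero_object ?D Z' \<and> isomorphic ?D X Z \<and> (Z', X, Z, u, v, w) \<in> tris ?D"
    using zero_object_of_acyclic[OF bdd_complex_zero acyclic_zero] cone_triangle[OF z] by blast
qed

section \<open>Closed cells are contractible\<close>

lemma contractible_space_disc: "contractible_space (disc d)"
proof -
  let ?S = "{x. \<forall>i\<ge>d. x i = 0} \<inter> {x :: nat \<Rightarrow> real. (\<Sum>i<d. x i ^ 2) \<le> 1}"
  have disc: "disc d = subtopology (powertop_real UNIV) ?S"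
    by (simp add: disc_def Euclidean_space_def subtopology_subtopology)
  let ?h = "\<lambda>(t, x :: nat \<Rightarrow> real) i. (1 - t) * x i"
  have "(\<Sum>i<d. ((1 - t) * x i) ^ 2) \<le> 1" if "0 \<le> t" "t \<le> 1" "(\<Sum>i<d. x i ^ 2) \<le> 1" for t :: real and x :: "nat \<Rightarrow> real"
  proof -
    have "(\<Sum>i<d. ((1 - t) * x i) ^ 2) = (1 - t) ^ 2 * (\<Sum>i<d. x i ^ 2)"
      by (simp add: power_mult_distrib sum_distrib_left)
    also have "\<dots> \<le> 1 * 1"
      using that by (intro mult_mono power_le_one) (auto intro: sum_nonneg)
    finally show ?thesis by simp
  qed
  then have "continuous_map (prod_topology (top_of_set {0..1}) (disc d)) (disc d) ?h"
    unfolding disc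
  proof (subst continuous_map_in_subtopology, intro conjI)
    let ?P = "prod_topology (top_of_set {0..1::real}) (subtopology (powertop_real UNIV) ?S)"
    have fst: "continuous_map ?P euclideanreal fst"
      by (rule continuous_map_into_fulltopology[OF continuous_map_fst])
    have "continuous_map ?P euclideanreal (\<lambda>p. snd p i)" for i
      using continuous_map_compose[OF continuous_map_snd
          continuous_map_from_subtopology[OF continuous_map_product_coordinates[of i UNIV]]]
      by (simp add: comp_def)
    then have "continuous_map ?P euclideanreal (\<lambda>p. (1 - fst p) * snd p i)" for i
      by (intro continuous_map_real_mult continuous_map_diff fst) auto
    then show "continuous_map ?P (powertop_real UNIV) ?h"
      by (simp add: continuous_map_componentwise_UNIV case_prod_unfold)
  qed (auto simp: image_subset_iff)
  then have "homotopic_with (\<lambda>x. True) (disc d) (disc d) id (\<lambda>x i. 0)"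
    unfolding homotopic_with_def by (intro exI[of _ ?h] conjI) auto
  then show ?thesis
    unfolding contractible_space_def by blast
qed

lemma closed_cell_contractible:
  assumes "regular_CW X J e" "i \<in> J"
  shows "topspace (subtopology X (X closure_of e i)) \<noteq> {}"
    "contractible_space (subtopology X (X closure_of e i))"
proof -
  obtain d \<Phi> where h: "homeomorphic_map (disc d) (subtopology X (X closure_of e i)) \<Phi>"
    using assms unfolding regular_CW_def by (elim conjE exE) (drule (1) bspec, elim conjE exE)
  show "contractible_space (subtopology X (X closure_of e i))"
    using homeomorphic_space_contractibility[OF homeomorphic_map_imp_homeomorphic_space[OF h]]
      contractible_space_disc by simp
  have "(\<lambda>i. 0) \<in> topspace (disc d)" by (simp add: disc_def topspace_Euclidean_space)
  then show "topspace (subtopology X (X closure_of e i)) \<noteq> {}"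
    using homeomorphic_imp_surjective_map[OF h] by blast
qed

theorem corollary7p3:
  fixes r n m :: nat
    and D :: "((((int, int) qpath \<Rightarrow> 'k::alg_closed_field) set, 'k) cpx,
               (((int, int) qpath \<Rightarrow> 'k) set, 'k) roof set) tricat"
    and M :: "(((int, int) qpath \<Rightarrow> 'k) set, 'k) cpx set"
    and X :: "'x topology"
    and e :: "(((int, int) qpath \<Rightarrow> 'k) set, 'k) cpx set \<times>
              (((int, int) qpath \<Rightarrow> 'k) set, 'k) cpx set \<Rightarrow> 'x set"
  assumes "n > r" and "r > 0"
    and "D = derived_cat (dd_algebra r n m)"
    and "silting D M"
    and "is_silt2 D X e"
  shows "topspace (two_term_complex D X e M) \<noteq> {} \<and> contractible_space (two_term_complex D X e M)"
proof -
  interpret triangle_category D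
    unfolding assms(3) by (rule triangle_category_derived)
  have "regular_CW X (silting_pairs D) e" using assms(5) by (simp add: is_silt2_def)
  then show ?thesis
    unfolding two_term_complex_eq_cell[OF assms(4,5)]
    using closed_cell_contractible[OF _ silting_pair_zeros[OF assms(4)]] by blast
qed

end
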